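(* Let $n \ge 3$. There is an algorithm which, given two pyramidal tours with step-backs $x$ and $y$ on the cities $\{1,\dots,n\}$ (each given, e.g., as the cyclic sequence of its cities or by its successor function), decides in time $O(n)$ whether the vertices $\mathbf{v}(x)$ and $\mathbf{v}(y)$ of the polytope $\operatorname{PSB}(n)$ are adjacent in the 1-skeleton of $\operatorname{PSB}(n)$.
   Context: Let $K_n=(V,E)$ be the complete directed graph on the vertex set $V=\{1,\dots,n\}$ (cities), with arc set $E$ consisting of all ordered pairs $(u,v)$, $u\neq v$. A Hamiltonian tour $\tau$ is a directed cycle through all cities; $\tau(i)$ denotes the successor of city $i$, $\tau^{-1}(i)$ its predecessor, and $\tau^{k}(i)$, $\tau^{-k}(i)$ the $k$-th successor and $k$-th predecessor. A city $i$ is a peak if $\tau^{-1}(i)<i$ and $\tau(i)<i$. A city $i$ is a step-back peak if either ($\tau^{-1}(i)<i$, $\tau(i)=i-1$, $\tau^2(i)>i$) or ($\tau^{-2}(i)>i$, $\tau^{-1}(i)=i-1$, $\tau(i)<i$). A proper peak is a peak that is not a step-back peak. A pyramidal tour with step-backs is a Hamiltonian tour whose only proper peak is $n$. For a tour $x$, its characteristic vector $\mathbf{v}(x)\in\mathbb{R}^{E}$ has $\mathbf{v}(x)_e=1$ if the arc $e$ is used by $x$ and $0$ otherwise. The polytope of pyramidal tours with step-backs is $\operatorname{PSB}(n)=\operatorname{conv}\{\mathbf{v}(x) : x \text{ is a pyramidal tour with step-backs in } K_n\}$. The 1-skeleton of a polytope is the graph whose vertices are the vertices of the polytope and whose edges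 are the one-dimensional faces (geometric edges) of the polytope; two vertices are adjacent if they span such an edge. *)

theory Defs
  imports
    "HOL-Analysis.Analysis"
    "HOL-Library.Function_Algebras"
    "HOL-Combinatorics.Orbits"
begin

section \<open>Pyramidal tours with step-backs\<close>

text \<open>A tour is its successor function. The condition \<open>\<tau> permutes {1..n}\<close> forces
  \<open>\<tau>\<close> to be the identity outside \<open>{1..n}\<close>, so each tour has exactly one representation;
  the predecessor of \<open>i\<close> is \<open>inv \<tau> i\<close>.\<close>

definition hamiltonian_tour :: "nat \<Rightarrow> (nat \<Rightarrow> nat) \<Rightarrow> bool" where
  "hamiltonian_tour n \<tau> \<longleftrightarrow> \<tau> permutes {1..n} \<and> cyclic_on \<tau> {1..n}"

definition peak :: "(nat \<Rightarrow> nat) \<Rightarrow> nat \<Rightarrow> bool" where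
  "peak \<tau> i \<longleftrightarrow> inv \<tau> i < i \<and> \<tau> i < i"

definition step_back_peak :: "(nat \<Rightarrow> nat) \<Rightarrow> nat \<Rightarrow> bool" where
  "step_back_peak \<tau> i \<longleftrightarrow>
     inv \<tau> i < i \<and> \<tau> i = i - 1 \<and> \<tau> (\<tau> i) > i \<or>
     inv \<tau> (inv \<tau> i) > i \<and> inv \<tau> i = i - 1 \<and> \<tau> i < i"

definition proper_peak :: "(nat \<Rightarrow> nat) \<Rightarrow> nat \<Rightarrow> bool" where
  "proper_peak \<tau> i \<longleftrightarrow> peak \<tau> i \<and> \<not> step_back_peak \<tau> i"

definition psb_tour :: "nat \<Rightarrow> (nat \<Rightarrow> nat) \<Rightarrow> bool" where
  "psb_tour n \<tau> \<longleftrightarrow> hamiltonian_tour n \<tau> \<and> {i \<in> {1..n}. proper_peak \<tau> i} = {n}"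

section \<open>The polytope and its 1-skeleton\<close>

text \<open>Since \<open>n\<close> must be quantified inside the main statement, \<open>\<real>\<^sup>E\<close> cannot be a
  type. It is represented by the functions \<open>nat \<times> nat \<Rightarrow> real\<close> vanishing outside the arc set.
  The library has no vector space structure on functions; we supply the pointwise one.\<close>

instantiation "fun" :: (type, real_vector) real_vector
begin

definition scaleR_fun :: "real \<Rightarrow> ('a \<Rightarrow> 'b) \<Rightarrow> 'a \<Rightarrow> 'b" where
  "scaleR_fun r f = (\<lambda>x. r *\<^sub>R f x)"

instance
  by standard (auto simp: scaleR_fun_def scaleR_add_right scaleR_add_left)

end

definition arcs :: "nat \<Rightarrow> (nat \<times> nat) set" where
  "arcs n = {(u, v). u \<in> {1..n} \<and> v \<in> {1..n} \<and> u \<noteq> v}"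

definition char_vec :: "nat \<Rightarrow> (nat \<Rightarrow> nat) \<Rightarrow> nat \<times> nat \<Rightarrow> real" where
  "char_vec n \<tau> = (\<lambda>(u, v). if (u, v) \<in> arcs n \<and> v = \<tau> u then 1 else 0)"

definition PSB :: "nat \<Rightarrow> (nat \<times> nat \<Rightarrow> real) set" where
  "PSB n = convex hull (char_vec n ` {\<tau>. psb_tour n \<tau>})"

text \<open>The library's \<open>edge_of\<close> and \<open>aff_dim\<close> are restricted to the class \<open>euclidean_space\<close>.
  The second conjunct spells out \<open>aff_dim F = 1\<close>.\<close>

definition geometric_edge_of :: "'a::real_vector set \<Rightarrow> 'a set \<Rightarrow> bool" where
  "geometric_edge_of F S \<longleftrightarrow>
     F face_of S \<and>
     (\<exists>B. affine hull B = affine hull F \<and> \<not> affine_dependent B \<and> card B = 2)"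

definition skeleton_adjacent :: "'a::real_vector set \<Rightarrow> 'a \<Rightarrow> 'a \<Rightarrow> bool" where
  "skeleton_adjacent S v w \<longleftrightarrow>
     v extreme_point_of S \<and> w extreme_point_of S \<and> geometric_edge_of (convex hull {v, w}) S"

section \<open>Machine model\<close>

text \<open>Algorithms are programs of a word RAM, presented as a While language over finitely many
  scalar registers and arrays of natural numbers. Every node of an expression that is evaluated
  costs one time unit, and so does every assignment, skip and branch; subtraction is truncated.

  The parameter \<open>W\<close> of \<open>exec\<close> bounds word contents: the program is stuck when it
  tries to store a value, or to store at an address, larger than \<open>W\<close>. (Intermediate values of a
  fixed program's expressions then exceed \<open>W\<close> at most by a constant factor or constant.)
  Without such a bound, repeated unit-cost doubling would produce exponentially large numbers.\<close>

datatype aexp =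
    Lit nat
  | Var string
  | Elem string aexp
  | Add aexp aexp
  | Sub aexp aexp

datatype bexp =
    Lt aexp aexp
  | Eql aexp aexp
  | BNot bexp
  | BAnd bexp bexp

datatype com =
    Skip
  | Assign string aexp
  | Store string aexp aexp
  | Seq com com
  | Cond bexp com com
  | While bexp com

record store =
  reg :: "string \<Rightarrow> nat"
  arr :: "string \<Rightarrow> nat \<Rightarrow> nat"

fun aval :: "aexp \<Rightarrow> store \<Rightarrow> nat" where
  "aval (Lit k) s = k"
| "aval (Var r) s = reg s r"
| "aval (Elem A a) s = arr s A (aval a s)"
| "aval (Add a b) s = aval a s + aval b s"
| "aval (Sub a b) s = aval a s - aval b s"

fun bval :: "bexp \<Rightarrow> store \<Rightarrow> bool" where
  "bval (Lt a b) s = (aval a s < aval b s)"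
| "bval (Eql a b) s = (aval a s = aval b s)"
| "bval (BNot b) s = (\<not> bval b s)"
| "bval (BAnd b c) s = (bval b s \<and> bval c s)"

fun acost :: "aexp \<Rightarrow> nat" where
  "acost (Lit k) = 1"
| "acost (Var r) = 1"
| "acost (Elem A a) = 1 + acost a"
| "acost (Add a b) = 1 + acost a + acost b"
| "acost (Sub a b) = 1 + acost a + acost b"

fun bcost :: "bexp \<Rightarrow> nat" where
  "bcost (Lt a b) = 1 + acost a + acost b"
| "bcost (Eql a b) = 1 + acost a + acost b"
| "bcost (BNot b) = 1 + bcost b"
| "bcost (BAnd b c) = 1 + bcost b + bcost c"

text \<open>\<open>exec W c s t s'\<close>: started in \<open>s\<close>, the program \<open>c\<close> terminates in \<open>s'\<close> after \<open>t\<close> time units.\<close>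

inductive exec :: "nat \<Rightarrow> com \<Rightarrow> store \<Rightarrow> nat \<Rightarrow> store \<Rightarrow> bool" for W :: nat where
  Skip: "exec W Skip s 1 s"
| Assign: "aval a s \<le> W \<Longrightarrow>
    exec W (Assign r a) s (1 + acost a) (s\<lparr>reg := (reg s)(r := aval a s)\<rparr>)"
| Store: "aval i s \<le> W \<Longrightarrow> aval a s \<le> W \<Longrightarrow>
    exec W (Store A i a) s (1 + acost i + acost a)
      (s\<lparr>arr := (arr s)(A := (arr s A)(aval i s := aval a s))\<rparr>)"
| Seq: "exec W c1 s t1 s1 \<Longrightarrow> exec W c2 s1 t2 s2 \<Longrightarrow> exec W (Seq c1 c2) s (t1 + t2) s2"
| CondTrue: "bval b s \<Longrightarrow> exec W c1 s t s1 \<Longrightarrow> exec W (Cond b c1 c2) s (1 + bcost b + t) s1"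
| CondFalse: "\<not> bval b s \<Longrightarrow> exec W c2 s t s1 \<Longrightarrow> exec W (Cond b c1 c2) s (1 + bcost b + t) s1"
| WhileFalse: "\<not> bval b s \<Longrightarrow> exec W (While b c) s (1 + bcost b) s"
| WhileTrue: "bval b s \<Longrightarrow> exec W c s t1 s1 \<Longrightarrow> exec W (While b c) s1 t2 s2 \<Longrightarrow>
    exec W (While b c) s (1 + bcost b + t1 + t2) s2"

inductive_cases SkipE: "exec W Skip s t s'"
inductive_cases AssignE: "exec W (Assign r a) s t s'"
inductive_cases StoreE: "exec W (Store A i a) s t s'"
inductive_cases SeqE: "exec W (Seq c1 c2) s t s'"
inductive_cases CondE: "exec W (Cond b c1 c2) s t s'"
inductive_cases WhileE: "exec W (While b c) s t s'"

text \<open>Execution is deterministic, so in the existence of a terminating run with the right answer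
  (\<open>answers_within\<close> below) there is no hidden choice.\<close>

lemma exec_deterministic:
  "exec W c s t s1 \<Longrightarrow> exec W c s t' s1' \<Longrightarrow> t' = t \<and> s1' = s1"
proof (induction arbitrary: t' s1' rule: exec.induct)
  case Skip
  then show ?case by (rule SkipE) simp
next
  case Assign
  from Assign.prems show ?case by (rule AssignE) simp
next
  case Store
  from Store.prems show ?case by (rule StoreE) simp
next
  case (Seq c1 s t1 s1 c2 t2 s2)
  from Seq.prems show ?case by (rule SeqE) (metis Seq.IH)
next
  case (CondTrue b s c1 t s1 c2)
  from CondTrue.prems CondTrue.hyps show ?case by (auto elim!: CondE dest: CondTrue.IH)
next
  case (CondFalse b s c2 t s1 c1)
  from CondFalse.prems CondFalse.hyps show ?case by (auto elim!: CondE dest: CondFalse.IH)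
next
  case (WhileFalse b s c)
  from WhileFalse.prems show ?case by (rule WhileE) (simp_all add: WhileFalse.hyps)
next
  case (WhileTrue b s c t1 s1 t2 s2)
  from WhileTrue.prems show ?case
  proof (rule WhileE)
    fix t1a s1a t2a
    assume "t' = Suc (bcost b + t1a + t2a)" and "exec W c s t1a s1a"
      and "exec W (While b c) s1a t2a s1'"
    then show ?thesis using WhileTrue.IH(1) [of t1a s1a] WhileTrue.IH(2) [of t2a s1'] by auto
  qed (use WhileTrue.hyps in auto)
qed

section \<open>Input encodings and decision in linear time\<close>

definition input :: "nat \<Rightarrow> (nat \<Rightarrow> nat) \<Rightarrow> (nat \<Rightarrow> nat) \<Rightarrow> store" where
  "input n a b = \<lparr>reg = (\<lambda>_. 0)(''n'' := n), arr = (\<lambda>_ _. 0)(''x'' := a, ''y'' := b)\<rparr>"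

definition successor_array :: "nat \<Rightarrow> (nat \<Rightarrow> nat) \<Rightarrow> nat \<Rightarrow> nat" where
  "successor_array n \<tau> = (\<lambda>i. if i \<in> {1..n} then \<tau> i else 0)"

text \<open>The cyclic sequence of cities, written down from an arbitrary first city \<open>c\<close>.\<close>

definition sequence_array :: "nat \<Rightarrow> (nat \<Rightarrow> nat) \<Rightarrow> nat \<Rightarrow> nat \<Rightarrow> nat" where
  "sequence_array n \<tau> c = (\<lambda>i. if i < n then (\<tau> ^^ i) c else 0)"

text \<open>\<open>T\<close> bounds both the running time and the word contents; with \<open>T = C * n\<close> for a constant
  \<open>C\<close>, this is linear time with words of \<open>O(log n)\<close> bits.\<close>

definition answers_within :: "nat \<Rightarrow> com \<Rightarrow> store \<Rightarrow> bool \<Rightarrow> bool" where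
  "answers_within T P s Q \<longleftrightarrow>
     (\<exists>t s'. exec T P s t s' \<and> t \<le> T \<and> reg s' ''answer'' = (if Q then 1 else 0))"

end

theory Submission
  imports Defs
begin

text \<open>A permutation without fixed points is a pyramidal tour with step-backs iff every cut between
  \<open>i\<close> and \<open>i + 1\<close> is crossed upwards by exactly one arc, or by two arcs because of a step-back at the
  cut. A tour inside \<open>x \<union> y\<close> is a labelling that tells for each city whether its outgoing arc is taken
  from \<open>x\<close> or from \<open>y\<close>. The characteristic vectors are non-adjacent iff a convex combination of other
  tours lies on the segment between them. Each cut condition is made of implications between labels,
  and balancedness of the combination turns every implication into an equality; then flipping all labels
  again gives a tour. Hence the vertices are adjacent iff the graph formed by these equalities connects
  all cities at which \<open>x\<close> and \<open>y\<close> differ. This graph has \<open>O(n)\<close> edges, found by one sweep over the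
  cuts in each of four orientations, and its connectivity is decided by breadth-first search.\<close>

section \<open>Tours and cuts\<close>

text \<open>Being a single cycle is a global property, yet it follows from the local cut conditions:
  the largest city of a cycle avoiding \<open>n\<close> would be a step-back peak, and a step-back
  leads above its peak. So a mixture of \<open>x\<close> and \<open>y\<close> can be tested cut by
  cut. The difficulty lies in the step-backs. An ascending one at \<open>i\<close> involves the arcs
  out of \<open>i\<close>, out of \<open>Suc i\<close> and into \<open>Suc i\<close>, and which of
  them depend on each other varies with the way \<open>x\<close> passes the same cut. The edges are
  chosen to meet two needs at once: a labelling constant on them yields admissible cuts, and every
  tour in the support of a combination on the segment is constant on them. Reversal turns descending
  step-backs into ascending ones, and exchanging \<open>x\<close> and \<open>y\<close> moves the
  step-back to \<open>y\<close>, so only an ascending step-back of \<open>y\<close> has to be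
  analysed. Connectivity is expressed by Boolean labellings instead of paths, in the geometry as
  well as in the search. Each city contributes at most five edges per orientation, which gives the
  bound \<open>20 * n\<close>.\<close>

text \<open>\<open>up_tails i z\<close> are the tails of the arcs that cross the cut between \<open>i\<close> and \<open>Suc i\<close> upwards.
  \<open>up_step_back z i\<close> is a step-back on the ascending part, visiting \<open>Suc i\<close> and then \<open>i\<close>; a step-back on
  the descending part is \<open>up_step_back (inv z) i\<close>.\<close>

definition up_tails :: "nat \<Rightarrow> (nat \<Rightarrow> nat) \<Rightarrow> nat set" where
  "up_tails i z = {u \<in> {1..i}. i < z u}"

definition up_step_back :: "(nat \<Rightarrow> nat) \<Rightarrow> nat \<Rightarrow> bool" where
  "up_step_back z i \<longleftrightarrow> z (Suc i) = i \<and> Suc i < z i \<and> inv z (Suc i) < i"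

definition cut_ok :: "(nat \<Rightarrow> nat) \<Rightarrow> nat \<Rightarrow> bool" where
  "cut_ok z i \<longleftrightarrow> card (up_tails i z) = 1 \<or> card (up_tails i z) = 2 \<and> (up_step_back z i \<or> up_step_back (inv z) i)"

definition derangement :: "nat \<Rightarrow> (nat \<Rightarrow> nat) \<Rightarrow> bool" where
  "derangement n z \<longleftrightarrow> z permutes {1..n} \<and> (\<forall>i\<in>{1..n}. z i \<noteq> i)"

definition valid :: "nat \<Rightarrow> (nat \<Rightarrow> nat) \<Rightarrow> bool" where
  "valid n z \<longleftrightarrow> derangement n z \<and> (\<forall>i\<in>{1..<n}. cut_ok z i)"

lemma finite_up_tails [simp]: "finite (up_tails i z)"
  by (simp add: up_tails_def)

lemma up_tails_0 [simp]: "up_tails 0 z = {}"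
  by (auto simp: up_tails_def)

lemma derangement_inv: "derangement n z \<Longrightarrow> derangement n (inv z)"
  unfolding derangement_def by (metis permutes_inv permutes_inverses(1))

lemma inv_inv: "derangement n z \<Longrightarrow> inv (inv z) = z"
  unfolding derangement_def by (metis permutes_inv_inv)

lemma derangement_eq_iff: "derangement n z \<Longrightarrow> inv z v = u \<longleftrightarrow> z u = v"
  unfolding derangement_def by (metis permutes_inverses)

lemma derangement_mem: "derangement n z \<Longrightarrow> z u \<in> {1..n} \<longleftrightarrow> u \<in> {1..n}"
  unfolding derangement_def by (metis permutes_in_image)

lemma derangement_outside: "derangement n z \<Longrightarrow> u \<notin> {1..n} \<Longrightarrow> z u = u"
  using permutes_not_in[of z "{1..n}" u] by (auto simp: derangement_def)

lemma derangement_inj: "derangement n z \<Longrightarrow> z u = z v \<longleftrightarrow> u = v"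
  by (metis derangement_eq_iff)

section \<open>Counting the arcs across a cut\<close>

text \<open>The weight is arbitrary because two instances matter: weight 1 gives the number of
  tails, the identity gives their sum, and the program keeps both in registers. Additions on both
  sides avoid truncated subtraction.\<close>

lemma sum_up_tails_Suc:
  fixes f :: "nat \<Rightarrow> nat"
  assumes z: "derangement n z" and i: "Suc i \<le> n"
  shows "sum f (up_tails (Suc i) z) + (if inv z (Suc i) < Suc i then f (inv z (Suc i)) else 0)
       = sum f (up_tails i z) + (if Suc i < z (Suc i) then f (Suc i) else 0)"
proof -
  let ?v = "inv z (Suc i)"
  have v: "z ?v = Suc i" and v1: "?v \<ge> 1" "?v \<noteq> Suc i"
    using derangement_eq_iff[OF z] derangement_mem[OF derangement_inv[OF z], of "Suc i"] i z
    by (auto simp: derangement_def)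
  \<comment> \<open>These arcs cross both neighbouring cuts. The two tail sets can differ from
    \<open>A\<close> only by the arc into \<open>Suc i\<close> and the arc out of
    \<open>Suc i\<close>.\<close>
  define A where "A = {u \<in> {1..i}. Suc i < z u}"
  have U: "up_tails i z = (if ?v < Suc i then insert ?v A else A)"
  proof -
    have "u \<in> up_tails i z \<longleftrightarrow> u \<in> A \<or> u \<le> i \<and> u = ?v" for u
      using v v1 derangement_eq_iff[OF z, of "Suc i" u]
      by (auto simp: up_tails_def A_def)
    then show ?thesis by (auto simp: less_Suc_eq_le)
  qed
  have U': "up_tails (Suc i) z = (if Suc i < z (Suc i) then insert (Suc i) A else A)"
    by (auto simp: up_tails_def A_def le_Suc_eq)
  have "finite A" "?v \<notin> A" "Suc i \<notin> A" using v by (auto simp: A_def)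
  then show ?thesis by (auto simp: U U')
qed

lemma card_up_tails_Suc:
  assumes "derangement n z" "Suc i \<le> n"
  shows "card (up_tails (Suc i) z) + (if inv z (Suc i) < Suc i then 1 else 0)
       = card (up_tails i z) + (if Suc i < z (Suc i) then 1 else 0)"
  using sum_up_tails_Suc[OF assms, of "\<lambda>_. 1"] by (simp only: card_eq_sum)

text \<open>Among the \<open>i\<close> arcs with tail in \<open>{1..i}\<close>, those that do not
  cross have both ends in \<open>{1..i}\<close>, and reversal is a bijection between the inner arcs
  of \<open>z\<close> and of \<open>inv z\<close>.\<close>

lemma card_up_tails_inv:
  assumes z: "derangement n z" and "i \<le> n"
  shows "card (up_tails i (inv z)) = card (up_tails i z)"
proof -
  have zp: "z permutes {1..n}" using z by (simp add: derangement_def)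
  have 1: "{u \<in> {1..i}. z u \<le> i} \<union> up_tails i z = {1..i}" "{u \<in> {1..i}. z u \<le> i} \<inter> up_tails i z = {}"
    by (auto simp: up_tails_def)
  have 2: "{u \<in> {1..i}. inv z u \<le> i} \<union> up_tails i (inv z) = {1..i}"
    "{u \<in> {1..i}. inv z u \<le> i} \<inter> up_tails i (inv z) = {}"
    by (auto simp: up_tails_def)
  have "bij_betw z {u \<in> {1..i}. z u \<le> i} {u \<in> {1..i}. inv z u \<le> i}"
  proof (rule bij_betw_byWitness[where f' = "inv z"])
    show "z ` {u \<in> {1..i}. z u \<le> i} \<subseteq> {u \<in> {1..i}. inv z u \<le> i}"
      using \<open>i \<le> n\<close> derangement_mem[OF z] permutes_inverses[OF zp] by force
    show "inv z ` {u \<in> {1..i}. inv z u \<le> i} \<subseteq> {u \<in> {1..i}. z u \<le> i}"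
      using \<open>i \<le> n\<close> derangement_mem[OF derangement_inv[OF z]] permutes_inverses[OF zp] by force
  qed (use permutes_inverses[OF zp] in auto)
  then have "card {u \<in> {1..i}. z u \<le> i} = card {u \<in> {1..i}. inv z u \<le> i}"
    by (rule bij_betw_same_card)
  moreover have "card {u \<in> {1..i}. z u \<le> i} + card (up_tails i z) = i"
    using card_Un_disjoint[OF _ _ 1(2)] 1(1) by simp
  moreover have "card {u \<in> {1..i}. inv z u \<le> i} + card (up_tails i (inv z)) = i"
    using card_Un_disjoint[OF _ _ 2(2)] 2(1) by simp
  ultimately show ?thesis by simp
qed

lemma cut_ok_inv:
  assumes "derangement n z" "i \<le> n"
  shows "cut_ok (inv z) i \<longleftrightarrow> cut_ok z i"
  using assms by (auto simp: cut_ok_def card_up_tails_inv inv_inv)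

lemma valid_inv: "valid n z \<Longrightarrow> valid n (inv z)"
  by (auto simp: valid_def derangement_inv cut_ok_inv)

lemma up_step_back_up_tails:
  assumes "valid n z" "i \<in> {1..<n}" "up_step_back z i"
  shows "up_tails i z = {inv z (Suc i), i}" "card (up_tails i z) = 2"
proof -
  have z: "derangement n z" and ok: "cut_ok z i" using assms by (auto simp: valid_def)
  have "inv z (Suc i) \<ge> 1"
    using derangement_mem[OF derangement_inv[OF z], of "Suc i"] assms(2) by auto
  then have sub: "{inv z (Suc i), i} \<subseteq> up_tails i z"
    using assms derangement_eq_iff[OF z, of "Suc i" "inv z (Suc i)"] by (auto simp: up_tails_def up_step_back_def)
  have c: "card {inv z (Suc i), i} = 2"
    using assms(3) by (auto simp: up_step_back_def)
  show "card (up_tails i z) = 2"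
    using card_mono[OF _ sub] c ok by (auto simp: cut_ok_def)
  then show "up_tails i z = {inv z (Suc i), i}"
    using card_subset_eq[OF _ sub] c by auto
qed

section \<open>Pyramidal tours with step-backs as cut conditions\<close>

text \<open>The cuts are treated from the top, where one arc crosses. Passing a city on the way down
  increases the count exactly if the city is a peak. Below \<open>n\<close> it is then a step-back
  peak, which is the exception that \<open>cut_ok\<close> allows.\<close>

lemma psb_tour_imp_valid:
  assumes n: "n \<ge> 3" and t: "psb_tour n z"
  shows "valid n z"
proof -
  have perm: "z permutes {1..n}" and cyc: "cyclic_on z {1..n}"
    and pp: "{i \<in> {1..n}. proper_peak z i} = {n}"
    using t by (auto simp: psb_tour_def hamiltonian_tour_def)
  have orb: "orbit z s = {1..n}" if "s \<in> {1..n}" for s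
    using cyc that by (metis cyclic_on_alldef)
  have nofix: "z i \<noteq> i" if i: "i \<in> {1..n}" for i
  proof
    assume "z i = i"
    have "s = i" if "s \<in> orbit z i" for s
      using that by induction (auto simp: \<open>z i = i\<close>)
    with orb[OF i] have "{1..n} \<subseteq> {i}" by auto
    then show False using n by (auto simp: subset_singleton_iff)
  qed
  have z: "derangement n z" using perm nofix by (simp add: derangement_def)
  \<comment> \<open>With no arc leading upwards, \<open>{1..i}\<close> would be closed under
    \<open>z\<close>, and the orbit of 1 would miss \<open>n\<close>.\<close>
  have pos: "card (up_tails i z) \<ge> 1" if i: "i \<in> {1..<n}" for i
  proof (rule ccontr)
    assume "\<not> ?thesis"
    then have e: "up_tails i z = {}" by (simp add: not_le)
    have 1: "z u \<in> {1..i}" if "u \<in> {1..i}" for u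
      using e that i derangement_mem[OF z, of u] by (auto simp: up_tails_def not_less)
    have "s \<in> {1..i}" if "s \<in> orbit z 1" for s
      using that by induction (use i 1 in auto)
    moreover have "n \<in> orbit z 1" using orb[of 1] n by simp
    ultimately show False using i by force
  qed
  have "i < n \<Longrightarrow> 1 \<le> i \<Longrightarrow> cut_ok z i" for i
  proof (induction "n - i" arbitrary: i rule: less_induct)
    case less
    have i: "Suc i \<le> n" "1 \<le> i" using less.prems by auto
    let ?v = "inv z (Suc i)"
    have v: "z ?v = Suc i" using derangement_eq_iff[OF z] by blast
    have v2: "?v \<in> {1..n}" using derangement_mem[OF z, of ?v] v i by auto
    then have vne: "?v \<noteq> Suc i" using nofix[OF v2] v by auto
    have zne: "z (Suc i) \<noteq> Suc i" using nofix i by auto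
    have zmem: "z (Suc i) \<in> {1..n}" using derangement_mem[OF z, of "Suc i"] i by auto
    note cs = card_up_tails_Suc[OF z i(1)]
    show ?case
    proof (cases "Suc i = n")
      case True
      have "z u \<le> n" if "u \<in> {1..n}" for u using derangement_mem[OF z, of u] that by auto
      then have "up_tails n z = {}" by (auto simp: up_tails_def not_less)
      then show ?thesis using cs True zmem v2 vne by (auto simp: cut_ok_def split: if_splits)
    next
      case False
      then have i': "Suc i \<in> {1..<n}" using i by auto
      have IH: "cut_ok z (Suc i)" using less.hyps[of "Suc i"] i i' by auto
      \<comment> \<open>The lower city of a step-back is a valley, so a count of two falls back to
        one at the next cut and can never grow to three.\<close>
      have sb2: "card (up_tails (Suc i) z) = 2 \<Longrightarrow> Suc i < z (Suc i) \<and> Suc i < ?v"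
        using IH vne derangement_eq_iff[OF z, of "Suc i" "Suc (Suc i)"]
          derangement_eq_iff[OF z, of "Suc (Suc i)" "Suc i"]
        by (auto simp: cut_ok_def up_step_back_def)
      have c12: "card (up_tails (Suc i) z) = 1 \<or> card (up_tails (Suc i) z) = 2"
        using IH by (auto simp: cut_ok_def)
      show ?thesis
      proof (cases "?v < Suc i \<and> z (Suc i) < Suc i")
        case True
        then have "card (up_tails (Suc i) z) = 1" using c12 sb2 by linarith
        with True have c: "card (up_tails i z) = 2" using cs by simp
        have "Suc i \<notin> {i \<in> {1..n}. proper_peak z i}" unfolding pp using i' by simp
        then have "\<not> proper_peak z (Suc i)" using i' by simp
        then have "step_back_peak z (Suc i)"
          using True by (auto simp: proper_peak_def peak_def)
        then have "up_step_back z i \<or> up_step_back (inv z) i"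
        proof (unfold step_back_peak_def, elim disjE conjE, goal_cases)
          case 1
          have "?v \<noteq> i" using v 1 by auto
          then have "up_step_back z i" using 1 by (simp add: up_step_back_def)
          then show ?case ..
        next
          case 2
          have "z (Suc i) \<noteq> i" using 2 derangement_eq_iff[OF z, of i "Suc i"] by auto
          then have "up_step_back (inv z) i" using 2 by (simp add: up_step_back_def inv_inv[OF z])
          then show ?case ..
        qed
        then show ?thesis using c by (auto simp: cut_ok_def)
      next
        case F: False
        have "card (up_tails i z) = 1"
          using F cs c12 sb2 vne zne pos[of i] i by (simp split: if_splits; force)
        then show ?thesis by (simp add: cut_ok_def)
      qed
    qed
  qed
  then show ?thesis using z by (auto simp: valid_def)
qed

text \<open>A peak raises the count from the cut above it to the cut below it, and the count above
  is at least one. Hence it is two below, where \<open>cut_ok\<close> demands a step-back.\<close>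

lemma valid_peak:
  assumes v: "valid n z" and i: "Suc i < n" "1 \<le> i"
    and pk: "inv z (Suc i) < Suc i" "z (Suc i) < Suc i"
  shows "up_step_back z i \<or> up_step_back (inv z) i"
proof -
  have z: "derangement n z" using v by (simp add: valid_def)
  have "cut_ok z i" "cut_ok z (Suc i)" using v i by (auto simp: valid_def)
  then show ?thesis using card_up_tails_Suc[OF z, of i] i pk by (auto simp: cut_ok_def)
qed

text \<open>Both parts rest on \<open>valid_peak\<close>: a peak other than \<open>n\<close> is a
  step-back peak, and this also rules out cycles that avoid \<open>n\<close>.\<close>

lemma valid_imp_psb_tour:
  assumes n: "n \<ge> 3" and v: "valid n z"
  shows "psb_tour n z"
proof -
  have z: "derangement n z" and ok: "\<And>i. i \<in> {1..<n} \<Longrightarrow> cut_ok z i"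
    using v by (auto simp: valid_def)
  have perm: "z permutes {1..n}" and nofix: "\<And>i. i \<in> {1..n} \<Longrightarrow> z i \<noteq> i"
    using z by (auto simp: derangement_def)
  have fin: "finite {1..n}" by simp
  have permu: "permutation z" using perm by (auto simp: permutation_permutes)
  have inorb: "n \<in> orbit z s" if s: "s \<in> {1..n}" for s
  proof (rule ccontr)
    assume nin: "n \<notin> orbit z s"
    let ?O = "orbit z s"
    have O: "?O \<subseteq> {1..n}"
      using permutes_orbit_subset[OF perm s] .
    have finO: "finite ?O" using O by (rule finite_subset) simp
    have sO: "s \<in> ?O" using permutation_self_in_orbit[OF permu] .
    \<comment> \<open>The maximum of a cycle is a peak. As \<open>m\<close> is not \<open>n\<close>,
      a step-back takes place there, and two steps forwards or backwards lead to a larger city of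
      the same cycle.\<close>
    define m where "m = Max ?O"
    have mO: "m \<in> ?O" unfolding m_def using finO sO by (intro Max_in) auto
    have mmax: "u \<in> ?O \<Longrightarrow> u \<le> m" for u unfolding m_def using finO by simp
    have zO: "u \<in> ?O \<Longrightarrow> z u \<in> ?O" for u by (rule orbit.step)
    have izO: "u \<in> ?O \<Longrightarrow> inv z u \<in> ?O" for u
      using orbit_inv_eq[OF permu] sO
      by (metis orbit.step orbit_inv_eq permu orbit_swap orbit_trans)
    have m: "m \<in> {1..n}" "m \<noteq> n" using O mO nin by auto
    have zm: "z m < m" using mmax[OF zO[OF mO]] nofix[OF m(1)] by simp
    have im: "inv z m < m"
      using mmax[OF izO[OF mO]] nofix[OF m(1)] derangement_eq_iff[OF z, of m m] by (cases "inv z m = m") auto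
    obtain i where mi: "m = Suc i" "1 \<le> i"
      using zm m derangement_mem[OF z, of m] by (cases m) auto
    from valid_peak[OF v, of i] im zm mi m
    consider "up_step_back z i" | "up_step_back (inv z) i" by auto
    then show False
    proof cases
      case 1
      then show ?thesis using mmax[OF zO[OF zO[OF mO]]] mi by (auto simp: up_step_back_def)
    next
      case 2
      then show ?thesis using mmax[OF izO[OF izO[OF mO]]] mi by (auto simp: up_step_back_def)
    qed
  qed
  have orbn: "{1..n} = orbit z n"
  proof
    show "{1..n} \<subseteq> orbit z n"
      using inorb orbit_swap[OF permutation_self_in_orbit[OF permu]] by blast
    show "orbit z n \<subseteq> {1..n}" using permutes_orbit_subset[OF perm, of n] n by auto
  qed
  have "cyclic_on z {1..n}"
    unfolding cyclic_on_def by (rule bexI[of _ n], rule orbn) (use n in simp)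
  then have ham: "hamiltonian_tour n z" using perm by (simp add: hamiltonian_tour_def)
  have mem: "z u \<in> {1..n}" "inv z u \<in> {1..n}" if "u \<in> {1..n}" for u
    using that derangement_mem[OF z, of u] derangement_mem[OF derangement_inv[OF z], of u] by simp_all
  have n1: "n \<in> {1..n}" using n by simp
  have "z n \<noteq> n" "inv z n \<noteq> n"
    using nofix[OF n1] derangement_eq_iff[OF z, of n n] by auto
  then have pn: "proper_peak z n"
    using mem(1)[OF n1] mem(2)[OF n1] mem(1)[OF mem(1)[OF n1]] mem(2)[OF mem(2)[OF n1]]
    by (simp add: proper_peak_def peak_def step_back_peak_def)
  have np: "\<not> proper_peak z j" if j: "j \<in> {1..n}" "j \<noteq> n" for j
  proof
    assume p: "proper_peak z j"
    then have pk: "inv z j < j" "z j < j" by (auto simp: proper_peak_def peak_def)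
    obtain i where mi: "j = Suc i" "1 \<le> i"
      using pk j derangement_mem[OF z, of j] by (cases j) auto
    from valid_peak[OF v, of i] pk mi j
    have "up_step_back z i \<or> up_step_back (inv z) i" by auto
    then have "step_back_peak z j"
      using pk by (auto simp: mi up_step_back_def step_back_peak_def)
    then show False using p by (simp add: proper_peak_def)
  qed
  have "{i \<in> {1..n}. proper_peak z i} = {n}"
    using pn np n by auto
  then show ?thesis using ham by (simp add: psb_tour_def)
qed

lemma psb_tour_iff_valid: "n \<ge> 3 \<Longrightarrow> psb_tour n z \<longleftrightarrow> valid n z"
  using psb_tour_imp_valid valid_imp_psb_tour by blast

section \<open>Labellings inside the union of two tours\<close>

definition mix :: "(nat \<Rightarrow> nat) \<Rightarrow> (nat \<Rightarrow> nat) \<Rightarrow> (nat \<Rightarrow> bool) \<Rightarrow> nat \<Rightarrow> nat" where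
  "mix x y l = (\<lambda>u. if l u then y u else x u)"

text \<open>Edges link cities whose outgoing arcs must come from the same tour in every complementary pair
  of tours inside \<open>x \<union> y\<close>. The sums only name the elements of singletons.\<close>

definition edges :: "(nat \<Rightarrow> nat) \<Rightarrow> (nat \<Rightarrow> nat) \<Rightarrow> nat \<Rightarrow> (nat \<times> nat) set" where
  "edges x y i = {(i, inv y (x i))}
     \<union> (if card (up_tails i x) = 1 \<and> card (up_tails i y) = 1 then {(\<Sum>(up_tails i x), \<Sum>(up_tails i y))} else {})
     \<union> (if up_step_back y i \<and> x i \<le> Suc i \<and> x (Suc i) \<noteq> i then {(i, Suc i)} else {})
     \<union> (if up_step_back y i \<and> x i < i \<and> x (\<Sum>(up_tails i x)) \<noteq> Suc i
        then {(inv y (Suc i), \<Sum>(up_tails i x)), (i, \<Sum>(up_tails i x))} else {})"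

definition compatible :: "nat \<Rightarrow> (nat \<Rightarrow> nat) \<Rightarrow> (nat \<Rightarrow> nat) \<Rightarrow> (nat \<Rightarrow> 'a) \<Rightarrow> bool" where
  "compatible n x y l \<longleftrightarrow> (\<forall>i\<in>{1..n}. \<forall>(u, v)\<in>edges x y i. l u = l v)"

lemma compatible_perm:
  assumes "compatible n x y l" "derangement n y" "u \<in> {1..n}" "x u = y v"
  shows "l u = l v"
proof -
  have "(u, v) \<in> edges x y u"
    using assms derangement_eq_iff[OF assms(2), of "x u" v] by (auto simp: edges_def)
  then show ?thesis using assms by (auto simp: compatible_def)
qed

lemma compatible_single:
  assumes "compatible n x y l" "i \<in> {1..n}" "up_tails i x = {p}" "up_tails i y = {q}"
  shows "l p = l q"
proof -
  have "(p, q) \<in> edges x y i" using assms by (auto simp: edges_def)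
  then show ?thesis using assms by (auto simp: compatible_def)
qed

section \<open>Mixtures along consistent labellings are valid\<close>

lemma up_tails_mix: "up_tails i (mix x y l) = {u \<in> up_tails i x. \<not> l u} \<union> {u \<in> up_tails i y. l u}"
  by (auto simp: up_tails_def mix_def)

lemma up_step_back_inv_iff:
  assumes "derangement n z"
  shows "up_step_back (inv z) i \<longleftrightarrow> z i = Suc i \<and> Suc i < inv z i \<and> z (Suc i) < i"
  using derangement_eq_iff[OF assms, of "Suc i" i]
  by (simp add: up_step_back_def inv_inv[OF assms])

text \<open>An ascending step-back at the cut needs \<open>x i\<close> above \<open>Suc i\<close>
  and a descending one needs \<open>x i = Suc i\<close>. A downward arc out of \<open>i\<close>
  excludes both, so one arc crosses and its tail is not \<open>i\<close>.\<close>

lemma single_up_if_down: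
  assumes v: "valid n x" and i: "i \<in> {1..<n}" and lt: "x i < i"
  obtains p where "up_tails i x = {p}" "1 \<le> p" "p < i" "i < x p"
proof -
  have x: "derangement n x" and "cut_ok x i" using v i by (auto simp: valid_def)
  then have "card (up_tails i x) = 1"
    using lt by (auto simp: cut_ok_def up_step_back_def[of x] up_step_back_inv_iff[OF x])
  then obtain p where Ux: "up_tails i x = {p}" by (auto simp: card_1_singleton_iff)
  then have "p \<in> up_tails i x" by simp
  then have "p \<ge> 1" "p \<le> i" "i < x p" by (auto simp: up_tails_def)
  moreover have "p \<noteq> i" using lt \<open>i < x p\<close> by auto
  ultimately show ?thesis using that[OF Ux] by simp
qed

lemma derangement_mix:
  assumes x: "derangement n x" and y: "derangement n y" and l: "compatible n x y l"
  shows "derangement n (mix x y l)"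
proof -
  let ?z = "mix x y l"
  note perm = compatible_perm[OF l y]
  have "inj_on ?z {1..n}"
  proof (rule inj_onI)
    fix u v assume "u \<in> {1..n}" "v \<in> {1..n}" "?z u = ?z v"
    then show "u = v"
      using perm[of u v] perm[of v u] derangement_inj[OF x] derangement_inj[OF y]
      by (auto simp: mix_def split: if_splits)
  qed
  moreover have "?z ` {1..n} \<subseteq> {1..n}"
  proof (rule image_subsetI)
    fix u assume "u \<in> {1..n}"
    then show "?z u \<in> {1..n}"
      using derangement_mem[OF x, of u] derangement_mem[OF y, of u] by (simp add: mix_def)
  qed
  ultimately have "bij_betw ?z {1..n} {1..n}"
    by (simp add: bij_betw_def endo_inj_surj)
  moreover have "?z u = u" if "u \<notin> {1..n}" for u
    using x y that by (auto simp: mix_def derangement_def permutes_not_in)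
  ultimately have "?z permutes {1..n}" by (rule bij_imp_permutes)
  then show ?thesis using x y by (auto simp: derangement_def mix_def)
qed

text \<open>The two candidate tails of the arc into \<open>v\<close>, namely \<open>inv x v\<close>
  and \<open>inv y v\<close>, carry equal labels by the first kind of edge. Therefore the label of
  an incoming arc may be read at \<open>inv x v\<close>, and reversal commutes with mixing.\<close>

lemma inv_mix:
  assumes x: "derangement n x" and y: "derangement n y" and l: "compatible n x y l"
  shows "inv (mix x y l) = mix (inv x) (inv y) (l \<circ> inv x)"
proof
  fix v
  have ix: "x (inv x v) = v" and iy: "y (inv y v) = v"
    using derangement_eq_iff[OF x] derangement_eq_iff[OF y] by blast+
  show "inv (mix x y l) v = mix (inv x) (inv y) (l \<circ> inv x) v"
  proof (cases "v \<in> {1..n}")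
    case True
    then have "l (inv x v) = l (inv y v)"
      using compatible_perm[OF l y, of "inv x v" "inv y v"] ix iy
        derangement_mem[OF derangement_inv[OF x], of v] by simp
    then have "mix x y l (mix (inv x) (inv y) (l \<circ> inv x) v) = v"
      using ix iy by (simp add: mix_def)
    then show ?thesis using derangement_eq_iff[OF derangement_mix[OF assms]] by blast
  next
    case False
    then have "inv x v = v" "inv y v = v"
      using derangement_inv[OF x] derangement_inv[OF y]
      by (auto simp: derangement_def permutes_not_in)
    then have "mix x y l (mix (inv x) (inv y) (l \<circ> inv x) v) = v"
      using ix iy by (simp add: mix_def)
    then show ?thesis using derangement_eq_iff[OF derangement_mix[OF assms]] by blast
  qed
qed

lemma step_back_cut_ok:
  assumes z: "derangement n z" and "up_tails i z = {q, i}" "z q = Suc i" "q < i" "z (Suc i) = i" "Suc i < z i"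
  shows "cut_ok z i"
proof -
  have "inv z (Suc i) = q" using derangement_eq_iff[OF z] assms by blast
  then show ?thesis using assms by (simp add: cut_ok_def up_step_back_def)
qed

lemma card_up_tails_1I:
  assumes "valid n z" "i \<in> {1..<n}" "p \<in> up_tails i z" "card (up_tails i z) = 1"
  shows "up_tails i z = {p}"
  using assms by (auto simp: card_1_singleton_iff)

text \<open>On a two-cycle \<open>Suc i\<close> would be a peak below \<open>n\<close>, but a
  step-back continues beyond \<open>Suc i\<close> in one direction and so cannot close up.\<close>

lemma no_two_cycle:
  assumes v: "valid n x" and i: "1 \<le> i" "Suc i < n" and "x i = Suc i"
  shows "x (Suc i) \<noteq> i"
proof
  assume a: "x (Suc i) = i"
  have x: "derangement n x" using v by (simp add: valid_def)
  have "inv x (Suc i) = i" "inv x i = Suc i" using assms a derangement_eq_iff[OF x] by auto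
  then show False using valid_peak[OF v i(2,1)] assms a by (auto simp: up_step_back_def)
qed

text \<open>If the cut has a single tail in both tours, these tails have equal labels. For a
  step-back of \<open>y\<close> the edges ensure that the mixture either contains a complete
  step-back or keeps an admissible crossing of \<open>x\<close>. The other situations reduce to this
  one by exchange and reversal.\<close>

lemma mix_cut_ok:
  assumes vx: "valid n x" and vy: "valid n y" and l: "compatible n x y l" and i: "i \<in> {1..<n}"
    and c: "card (up_tails i x) = 1 \<and> card (up_tails i y) = 1 \<or> up_step_back y i"
  shows "cut_ok (mix x y l) i"
proof -
  let ?z = "mix x y l"
  have x: "derangement n x" and y: "derangement n y"
    and cx: "\<And>i. i \<in> {1..<n} \<Longrightarrow> cut_ok x i" and cy: "\<And>i. i \<in> {1..<n} \<Longrightarrow> cut_ok y i"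
    using vx vy by (auto simp: valid_def)
  have z: "derangement n ?z" by (rule derangement_mix[OF x y l])
  note perm = compatible_perm[OF l y]
  show ?thesis
  proof (cases "up_step_back y i")
    case False
    then obtain p q where pq: "up_tails i x = {p}" "up_tails i y = {q}"
      using c by (auto simp: card_1_singleton_iff)
    then have "l p = l q" using compatible_single[OF l _ pq] i by simp
    then have "up_tails i ?z = (if l p then {q} else {p})" using pq by (auto simp: up_tails_mix)
    then show ?thesis by (simp add: cut_ok_def)
  next
    case sb: True
    define a where "a = inv y (Suc i)"
    have Uy: "up_tails i y = {a, i}" using up_step_back_up_tails[OF vy i sb] by (simp add: a_def)
    have a: "y a = Suc i" "a < i" "a \<ge> 1" and yi: "y (Suc i) = i" "Suc i < y i"
      using derangement_eq_iff[OF y, of "Suc i" a] sb Uy by (auto simp: up_step_back_def a_def up_tails_def)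
    have yin: "inv y i = Suc i" using derangement_eq_iff[OF y] yi by simp
    have i': "Suc i < n" using yi i derangement_mem[OF y, of i] by auto
    \<comment> \<open>City \<open>i\<close> is a valley of \<open>y\<close>, so the cut below it is
      crossed only by the arc out of \<open>a\<close>. This lower cut supplies links to
      \<open>a\<close> that are not visible at the cut \<open>i\<close> itself.\<close>
    obtain j where j: "i = Suc j" "j \<ge> 1" using a by (cases i) auto
    have jn: "j \<in> {1..<n}" using j i by auto
    have xmem: "\<And>u. u \<in> {1..n} \<Longrightarrow> inv x u \<in> {1..n}"
      using derangement_mem[OF derangement_inv[OF x]] by blast
    have cardyj: "card (up_tails j y) = 1"
      using card_up_tails_Suc[OF y, of j] up_step_back_up_tails(2)[OF vy i sb] yin yi i j by auto
    have Uyj: "up_tails j y = {a}"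
      by (rule card_up_tails_1I[OF vy jn _ cardyj]) (use a j in \<open>auto simp: up_tails_def\<close>)
    have xi: "x i \<noteq> i" using x i by (auto simp: derangement_def)
    consider (gt) "Suc i < x i" | (eq) "x i = Suc i" | (lt) "x i < i" using xi by linarith
    then show ?thesis
    proof cases
      \<comment> \<open>The arc out of \<open>i\<close> crosses in either tour, so its label is
        immaterial. If \<open>x\<close> crosses once, the head \<open>i\<close> and the lower cut
        tie \<open>Suc i\<close> to \<open>a\<close>. Otherwise \<open>x\<close> makes a step-back
        here too, and only the arcs into \<open>Suc i\<close> must agree.\<close>
      case gt
      show ?thesis
      proof (cases "card (up_tails i x) = 1")
        case c1: True
        have Ux: "up_tails i x = {i}"
          by (rule card_up_tails_1I[OF vx i _ c1]) (use gt i in \<open>auto simp: up_tails_def\<close>)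
        have "card (up_tails j x) \<ge> 1" using cx[OF jn] by (auto simp: cut_ok_def)
        then have cj: "card (up_tails j x) = 1" "inv x i < i"
          using card_up_tails_Suc[OF x, of j] gt c1 i j by (auto split: if_splits)
        have "inv x i \<in> {1..n}" "x (inv x i) = i"
          using xmem[of i] i derangement_eq_iff[OF x] by auto
        then have "up_tails j x = {inv x i}"
          by (intro card_up_tails_1I[OF vx jn _ cj(1)]) (use cj j in \<open>auto simp: up_tails_def\<close>)
        then have "l (inv x i) = l a"
          using compatible_single[OF l _ _ Uyj] jn by auto
        moreover have "l (inv x i) = l (Suc i)"
          using perm[of "inv x i" "Suc i"] \<open>inv x i \<in> {1..n}\<close> \<open>x (inv x i) = i\<close> yi by simp
        ultimately have la: "l (Suc i) = l a" by simp
        have U: "up_tails i ?z = (if l a then {a, i} else {i})"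
          using Ux Uy a by (auto simp: up_tails_mix)
        show ?thesis
        proof (cases "l a")
          case True
          then show ?thesis
            by (intro step_back_cut_ok[OF z, of i a]) (use U a yi gt la in \<open>auto simp: mix_def\<close>)
        next
          case False
          then show ?thesis using U by (simp add: cut_ok_def)
        qed
      next
        case False
        then have "up_step_back x i"
          using cx[OF i] gt by (auto simp: cut_ok_def up_step_back_inv_iff[OF x])
        define b where "b = inv x (Suc i)"
        have Ux: "up_tails i x = {b, i}" using up_step_back_up_tails[OF vx i \<open>up_step_back x i\<close>] by (simp add: b_def)
        have b: "x b = Suc i" "b < i" "b \<ge> 1" and xi: "x (Suc i) = i"
          using derangement_eq_iff[OF x, of "Suc i" b] \<open>up_step_back x i\<close> Ux by (auto simp: up_step_back_def b_def up_tails_def)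
        have lb: "l b = l a" using perm[of b a] b a i by simp
        have U: "up_tails i ?z = (if l a then {a, i} else {b, i})"
          using Ux Uy a b lb by (auto simp: up_tails_mix)
        show ?thesis
          by (rule step_back_cut_ok[OF z, of i "if l a then a else b"])
            (use U a b lb yi xi gt in \<open>auto simp: mix_def\<close>)
      qed
    next
      \<comment> \<open>In \<open>x\<close> the arc into \<open>Suc i\<close> starts at
        \<open>i\<close>, which ties \<open>i\<close> to \<open>a\<close>, and the third kind of
        edge adds \<open>Suc i\<close>. If \<open>x\<close> steps back while descending, its second
        crossing \<open>p\<close> is tied to \<open>a\<close> through the lower cut.\<close>
      case eq
      have "x (Suc i) \<noteq> i" by (rule no_two_cycle[OF vx _ i' eq]) (use i in simp)
      then have "(i, Suc i) \<in> edges x y i" using eq sb by (simp add: edges_def)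
      then have lS: "l (Suc i) = l i" using l i by (auto simp: compatible_def)
      have la: "l a = l i" using perm[of i a] a eq i by simp
      show ?thesis
      proof (cases "card (up_tails i x) = 1")
        case c1: True
        have Ux: "up_tails i x = {i}"
          by (rule card_up_tails_1I[OF vx i _ c1]) (use eq i in \<open>auto simp: up_tails_def\<close>)
        have U: "up_tails i ?z = (if l i then {a, i} else {i})"
          using Ux Uy a la by (auto simp: up_tails_mix)
        show ?thesis
        proof (cases "l i")
          case True
          then show ?thesis
            by (intro step_back_cut_ok[OF z, of i a]) (use U a yi la lS in \<open>auto simp: mix_def\<close>)
        next
          case False
          then show ?thesis using U by (simp add: cut_ok_def)
        qed
      next
        case False
        then have c2: "card (up_tails i x) = 2" and "up_step_back (inv x) i"
          using cx[OF i] eq by (auto simp: cut_ok_def up_step_back_def)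
        then have sx: "Suc i < inv x i" "x (Suc i) < i" by (auto simp: up_step_back_inv_iff[OF x])
        have cj: "card (up_tails j x) = 1"
          using card_up_tails_Suc[OF x, of j] c2 eq sx i j by auto
        then obtain p where Ujx: "up_tails j x = {p}" by (auto simp: card_1_singleton_iff)
        have lp: "l p = l a" using compatible_single[OF l _ Ujx Uyj] jn by simp
        have iU: "i \<in> up_tails i x" using eq i by (auto simp: up_tails_def)
        have "up_tails i x - {i} \<subseteq> up_tails j x" using j by (auto simp: up_tails_def)
        moreover have "card (up_tails i x - {i}) = 1" using c2 iU by simp
        ultimately have "up_tails i x - {i} = {p}" using Ujx by (auto simp: card_1_singleton_iff)
        then have Ux: "up_tails i x = {p, i}" "p \<noteq> i" using iU by auto
        have U: "up_tails i ?z = (if l i then {a, i} else {p, i})"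
          using Ux Uy a la lp by (auto simp: up_tails_mix)
        show ?thesis
        proof (cases "l i")
          case True
          then show ?thesis
            by (intro step_back_cut_ok[OF z, of i a]) (use U a yi la lS in \<open>auto simp: mix_def\<close>)
        next
          case False
          have ixi: "inv x i \<in> {1..n}" "x (inv x i) = i"
            using xmem[of i] i derangement_eq_iff[OF x] by auto
          then have "l (inv x i) = l (Suc i)" using perm[of "inv x i" "Suc i"] yi by simp
          then have "?z (inv x i) = i" using False lS ixi by (simp add: mix_def)
          then have "inv ?z i = inv x i" using derangement_eq_iff[OF z] by blast
          moreover have "?z i = Suc i" "?z (Suc i) < i"
            using False lS sx eq by (simp_all add: mix_def)
          ultimately have "up_step_back (inv ?z) i"
            using sx by (simp add: up_step_back_inv_iff[OF z])
          moreover have "card (up_tails i ?z) = 2" using U False Ux by simp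
          ultimately show ?thesis by (simp add: cut_ok_def)
        qed
      qed
    next
      \<comment> \<open>Only \<open>p\<close> crosses in \<open>x\<close>. If its arc ends in
        \<open>Suc i\<close>, it can stand in for the arc out of \<open>a\<close>; otherwise
        \<open>a\<close> and \<open>i\<close> must both switch together with
        \<open>p\<close>.\<close>
      case lt
      obtain p where Ux: "up_tails i x = {p}" and p: "p < i" "p \<ge> 1" "i < x p"
        using single_up_if_down[OF vx i lt] .
      show ?thesis
      proof (cases "x p = Suc i")
        case True
        have "x (Suc i) \<noteq> i"
        proof
          assume "x (Suc i) = i"
          moreover have "inv x (Suc i) = p" using True derangement_eq_iff[OF x] by simp
          ultimately show False
            using valid_peak[OF vx i'] i p lt by (auto simp: up_step_back_def)
        qed
        then have "(i, Suc i) \<in> edges x y i" using lt sb by (simp add: edges_def)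
        then have lS: "l (Suc i) = l i" using l i by (auto simp: compatible_def)
        have lp: "l p = l a" using perm[of p a] a p True i by simp
        define q where "q = (if l a then a else p)"
        have U: "up_tails i ?z = (if l i then {q, i} else {q})"
          using Ux Uy a p lp by (auto simp: up_tails_mix q_def)
        show ?thesis
        proof (cases "l i")
          case T: True
          have "q < i" "?z q = Suc i" "?z (Suc i) = i" "Suc i < ?z i"
            using a p lp True T lS yi by (simp_all add: q_def mix_def)
          then show ?thesis using step_back_cut_ok[OF z, of i q] U T by simp
        next
          case False
          then show ?thesis using U by (simp add: cut_ok_def)
        qed
      next
        case False
        then have "(a, p) \<in> edges x y i" "(i, p) \<in> edges x y i"
          using Ux lt sb by (auto simp: edges_def a_def)
        then have la: "l a = l p" "l i = l p" using l i by (auto simp: compatible_def)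
        \<comment> \<open>If also \<open>x (Suc i) = i\<close>, both tours lead from
          \<open>Suc i\<close> to \<open>i\<close>, and no agreement of labels is required.\<close>
        have lS: "x (Suc i) \<noteq> i \<Longrightarrow> l (Suc i) = l i"
        proof -
          assume "x (Suc i) \<noteq> i"
          then have "(i, Suc i) \<in> edges x y i" using lt sb by (simp add: edges_def)
          then show ?thesis using l i by (auto simp: compatible_def)
        qed
        have U: "up_tails i ?z = (if l i then {a, i} else {p})"
          using Ux Uy a la by (auto simp: up_tails_mix)
        show ?thesis
        proof (cases "l i")
          case True
          then show ?thesis
            by (intro step_back_cut_ok[OF z, of i a]) (use U a yi la lS in \<open>auto simp: mix_def\<close>)
        next
          case False
          then show ?thesis using U by (simp add: cut_ok_def)
        qed
      qed
    qed
  qed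
qed

text \<open>Constraints on incoming arcs are constraints for the reversed tours; the arc into \<open>v\<close> is
  represented by its tail \<open>inv x v\<close>.\<close>

definition consistent :: "nat \<Rightarrow> (nat \<Rightarrow> nat) \<Rightarrow> (nat \<Rightarrow> nat) \<Rightarrow> (nat \<Rightarrow> bool) \<Rightarrow> bool" where
  "consistent n x y l \<longleftrightarrow> compatible n x y l \<and> compatible n y x l \<and>
     compatible n (inv x) (inv y) (l \<circ> inv x) \<and> compatible n (inv y) (inv x) (l \<circ> inv x)"

lemma compatible_Not: "compatible n x y (\<lambda>u. \<not> l u) \<longleftrightarrow> compatible n x y l"
  by (auto simp: compatible_def)

lemma mix_Not: "mix y x (\<lambda>u. \<not> l u) = mix x y l"
  by (auto simp: mix_def)

lemma consistent_Not: "consistent n x y (\<lambda>u. \<not> l u) \<longleftrightarrow> consistent n x y l"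
  using compatible_Not[of n "inv x" "inv y" "l \<circ> inv x"] compatible_Not[of n "inv y" "inv x" "l \<circ> inv x"]
  by (simp add: consistent_def compatible_Not o_def)

text \<open>At each cut either both tours cross once or one of them has a step-back in one of two
  directions. Exchanging the tours negates the labels but leaves the mixture unchanged, and reversal
  preserves \<open>cut_ok\<close>; this reduces all cases to \<open>mix_cut_ok\<close>.\<close>

lemma valid_mix:
  assumes vx: "valid n x" and vy: "valid n y" and g: "consistent n x y l"
  shows "valid n (mix x y l)"
proof -
  have x: "derangement n x" and y: "derangement n y" using vx vy by (auto simp: valid_def)
  have r: "compatible n x y l" "compatible n y x (\<lambda>u. \<not> l u)"
    "compatible n (inv x) (inv y) (l \<circ> inv x)" "compatible n (inv y) (inv x) (\<lambda>u. \<not> (l \<circ> inv x) u)"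
    using g by (auto simp: consistent_def compatible_Not simp del: o_apply)
  have z: "derangement n (mix x y l)" by (rule derangement_mix[OF x y r(1)])
  have "cut_ok (mix x y l) i" if i: "i \<in> {1..<n}" for i
  proof -
    have "card (up_tails i x) = 1 \<or> up_step_back x i \<or> up_step_back (inv x) i"
      "card (up_tails i y) = 1 \<or> up_step_back y i \<or> up_step_back (inv y) i"
      using vx vy i by (auto simp: valid_def cut_ok_def)
    then consider "card (up_tails i x) = 1 \<and> card (up_tails i y) = 1 \<or> up_step_back y i" | "up_step_back x i"
      | "up_step_back (inv y) i" | "up_step_back (inv x) i" by blast
    then show ?thesis
    proof cases
      case 1
      then show ?thesis using mix_cut_ok[OF vx vy r(1) i] by simp
    next
      case 2
      then show ?thesis using mix_cut_ok[OF vy vx r(2) i] by (simp add: mix_Not)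
    next
      case 3
      then have "cut_ok (inv (mix x y l)) i"
        using mix_cut_ok[OF valid_inv[OF vx] valid_inv[OF vy] r(3) i] inv_mix[OF x y r(1)] by simp
      then show ?thesis using cut_ok_inv[OF z] i by simp
    next
      case 4
      then have "cut_ok (inv (mix x y l)) i"
        using mix_cut_ok[OF valid_inv[OF vy] valid_inv[OF vx] r(4) i] inv_mix[OF x y r(1)]
        by (simp add: mix_Not del: o_apply)
      then show ?thesis using cut_ok_inv[OF z] i by simp
    qed
  qed
  then show ?thesis using z by (simp add: valid_def)
qed

section \<open>Balanced families of tours\<close>

text \<open>The tours in the support of a convex combination that lies on the segment between \<open>x\<close> and \<open>y\<close>.
  All arcs of \<open>y - x\<close> carry the same total weight, so an implication between two of them that holds
  throughout \<open>Z\<close> is an equivalence.\<close>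

locale balanced_family =
  fixes n :: nat and x y :: "nat \<Rightarrow> nat" and Z :: "(nat \<Rightarrow> nat) set"
    and w :: "(nat \<Rightarrow> nat) \<Rightarrow> real" and c :: real
  assumes vx: "valid n x" and vy: "valid n y" and fin: "finite Z"
    and vZ: "z \<in> Z \<Longrightarrow> valid n z"
    and xy: "z \<in> Z \<Longrightarrow> z u = x u \<or> z u = y u"
    and pos: "z \<in> Z \<Longrightarrow> w z > 0"
    and bal: "x u \<noteq> y u \<Longrightarrow> (\<Sum>z\<in>Z. w z * of_bool (z u = y u)) = c"
begin

definition tied :: "nat \<Rightarrow> nat \<Rightarrow> bool" where
  "tied u v \<longleftrightarrow> u = v \<or> x u \<noteq> y u \<and> x v \<noteq> y v \<and> (\<forall>z\<in>Z. z u = y u \<longleftrightarrow> z v = y v)"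

lemma tied_sym: "tied u v \<Longrightarrow> tied v u"
  by (auto simp: tied_def)

lemma tiedD: "tied u v \<Longrightarrow> z \<in> Z \<Longrightarrow> z u = y u \<longleftrightarrow> z v = y v"
  by (auto simp: tied_def)

text \<open>The events \<open>z u = y u\<close> and \<open>z v = y v\<close> both have weight
  \<open>c\<close>. Under the implication their difference is a sum of nonnegative terms with total
  0, so every term vanishes.\<close>

lemma tiedI:
  assumes u: "x u \<noteq> y u" and v: "x v \<noteq> y v" and imp: "\<And>z. z \<in> Z \<Longrightarrow> z u = y u \<Longrightarrow> z v = y v"
  shows "tied u v"
proof -
  let ?f = "\<lambda>z. w z * (of_bool (z v = y v) - of_bool (z u = y u))"
  have "sum ?f Z = 0"
    using bal[OF u] bal[OF v] by (simp add: right_diff_distrib sum_subtractf)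
  moreover have "?f z \<ge> 0" if "z \<in> Z" for z
    using imp[OF that] pos[OF that] by auto
  ultimately have "\<forall>z\<in>Z. ?f z = 0" using sum_nonneg_eq_0_iff[OF fin, of ?f] by blast
  then have "z u = y u \<longleftrightarrow> z v = y v" if "z \<in> Z" for z
    using pos[OF that] that by (auto split: if_splits)
  then show ?thesis using u v by (simp add: tied_def)
qed

lemma derangement_x: "derangement n x" and derangement_y: "derangement n y"
  using vx vy by (auto simp: valid_def)

lemma tied_perm:
  assumes "x u = y v"
  shows "tied u v"
proof (cases "u = v")
  case False
  have "x v \<noteq> y v" "x u \<noteq> y u"
    using assms False derangement_inj[OF derangement_x, of u v] derangement_inj[OF derangement_y, of u v] by auto
  moreover have "z u = y u" if z: "z \<in> Z" and "z v = y v" for z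
  proof (rule ccontr)
    assume "z u \<noteq> y u"
    then have "z u = z v" using xy[OF z, of u] that assms by auto
    moreover have "derangement n z" using vZ[OF z] by (simp add: valid_def)
    ultimately show False using derangement_inj False by blast
  qed
  ultimately show ?thesis using tied_sym[OF tiedI] by blast
qed (simp add: tied_def)

text \<open>If \<open>z\<close> follows \<open>y\<close> at \<open>p\<close>, then \<open>p\<close>
  does not cross any more, and \<open>q\<close> is the only city left that can provide the crossing
  which each cut needs.\<close>

lemma tied_single:
  assumes i: "i \<in> {1..<n}" and Ux: "up_tails i x = {p}" and Uy: "up_tails i y = {q}"
  shows "tied p q"
proof (cases "p = q")
  case False
  have pq: "p \<in> up_tails i x" "p \<notin> up_tails i y" "q \<notin> up_tails i x" "q \<in> up_tails i y"
    using Ux Uy False by auto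
  show ?thesis
  proof (rule tiedI)
    show "x p \<noteq> y p" "x q \<noteq> y q" using pq by (auto simp: up_tails_def)
    fix z assume z: "z \<in> Z" and zp: "z p = y p"
    show "z q = y q"
    proof (rule ccontr)
      assume "z q \<noteq> y q"
      then have zq: "z q = x q" using xy[OF z, of q] by simp
      have "u \<notin> up_tails i z" for u
      proof
        assume u: "u \<in> up_tails i z"
        then have "u \<in> up_tails i x \<or> u \<in> up_tails i y" using xy[OF z, of u] by (auto simp: up_tails_def)
        then have "u = p \<or> u = q" using Ux Uy by auto
        then show False using u zp zq pq by (auto simp: up_tails_def)
      qed
      then have "up_tails i z = {}" by blast
      moreover have "cut_ok z i" using vZ[OF z] i by (simp add: valid_def)
      ultimately show False by (simp add: cut_ok_def)
    qed
  qed
qed (simp add: tied_def)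

lemma step_back_forced:
  assumes i: "i \<in> {1..<n}" and z: "z \<in> Z" and q: "q \<ge> 1" "q < i" "z q = Suc i" and zi: "z i > Suc i"
  shows "z (Suc i) = i"
proof -
  have d: "derangement n z" and ok: "cut_ok z i" using vZ[OF z] i by (auto simp: valid_def)
  have sub: "{q, i} \<subseteq> up_tails i z" using q zi i by (auto simp: up_tails_def)
  then have "card (up_tails i z) \<ge> 2" using card_mono[OF finite_up_tails sub] q by simp
  then show ?thesis using ok zi by (auto simp: cut_ok_def up_step_back_inv_iff[OF d]) (simp add: up_step_back_def)
qed

text \<open>One of two crossing arcs ends in \<open>Suc i\<close>. In an ascending step-back the
  tails are \<open>i\<close> and the predecessor of \<open>Suc i\<close>, hence \<open>p\<close> is
  that predecessor; in a descending one the arc starts at \<open>i\<close>.\<close>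

lemma two_up_tails:
  assumes i: "i \<in> {1..<n}" and z: "z \<in> Z" and pq: "p \<noteq> q" "p \<in> up_tails i z" "q \<in> up_tails i z" "p \<noteq> i"
  shows "z p = Suc i \<or> z i = Suc i"
proof -
  have v: "valid n z" and d: "derangement n z" and ok: "cut_ok z i"
    using vZ[OF z] i by (auto simp: valid_def)
  have "card (up_tails i z) \<ge> 2" using card_mono[OF finite_up_tails, of "{p, q}" i z] pq by simp
  then consider "up_step_back z i" | "up_step_back (inv z) i" using ok by (auto simp: cut_ok_def)
  then show ?thesis
  proof cases
    case 1
    then have "p = inv z (Suc i)" using up_step_back_up_tails(1)[OF v i 1] pq by auto
    then show ?thesis using derangement_eq_iff[OF d, of "Suc i" p] by simp
  qed (simp add: up_step_back_inv_iff[OF d])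
qed

text \<open>The counterpart of \<open>mix_cut_ok\<close>: no edge is stronger than what balancedness
  enforces. For each kind of edge some implication between its end points holds in every member of
  \<open>Z\<close>.\<close>

lemma edges_tied:
  assumes i: "i \<in> {1..n}" and e: "(u, v) \<in> edges x y i"
  shows "tied u v"
proof (cases "u = i \<and> v = inv y (x i)")
  case True
  then show ?thesis using tied_perm[of u v] derangement_eq_iff[OF derangement_y, of "x i" v] by auto
next
  case np: False
  \<comment> \<open>At \<open>i = n\<close> only the first kind of edge occurs: no arc crosses this
    cut, and \<open>y\<close> fixes \<open>Suc n\<close>.\<close>
  have i1: "i \<in> {1..<n}"
  proof (rule ccontr)
    assume "\<not> ?thesis"
    then have [simp]: "i = n" using i by auto
    have "up_tails n x = {}" using derangement_mem[OF derangement_x] by (force simp: up_tails_def not_less)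
    moreover have "y (Suc n) = Suc n" using derangement_y by (auto simp: derangement_def permutes_not_in)
    ultimately show False using e np by (auto simp: edges_def up_step_back_def split: if_splits)
  qed
  consider (single) "card (up_tails i x) = 1" "card (up_tails i y) = 1" "u = \<Sum>(up_tails i x)" "v = \<Sum>(up_tails i y)"
    | (sb) "up_step_back y i" using e np by (auto simp: edges_def split: if_splits)
  then show ?thesis
  proof cases
    case single
    then show ?thesis using tied_single[OF i1] by (auto simp: card_1_singleton_iff)
  next
    case sb
    define a where "a = inv y (Suc i)"
    have Uy: "up_tails i y = {a, i}" using up_step_back_up_tails[OF vy i1 sb] by (simp add: a_def)
    have a: "y a = Suc i" "a < i" "a \<ge> 1" and yi: "y (Suc i) = i" "Suc i < y i"
      using derangement_eq_iff[OF derangement_y, of "Suc i" a] sb Uy by (auto simp: up_step_back_def a_def up_tails_def)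
    have i': "Suc i < n" using yi i derangement_mem[OF derangement_y, of i] by auto
    have single: "\<exists>p. up_tails i x = {p} \<and> 1 \<le> p \<and> p < i \<and> i < x p" if lt: "x i < i"
      using single_up_if_down[OF vx i1 lt] by blast
    \<comment> \<open>If \<open>z\<close> took \<open>x\<close> at \<open>p\<close> and
      \<open>y\<close> at \<open>a\<close> or at \<open>i\<close> (a city other than
      \<open>p\<close>), two arcs would cross, but neither the arc out of \<open>p\<close> nor that
      out of \<open>i\<close> would end in \<open>Suc i\<close>, against
      \<open>two_up_tails\<close>.\<close>
    have tp: "tied a p \<and> tied i p"
      if lt: "x i < i" and Ux: "up_tails i x = {p}" and xp: "x p \<noteq> Suc i" for p
    proof -
      have p: "1 \<le> p" "p < i" "i < x p" using single[OF lt] Ux by auto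
      have D: "x i \<noteq> y i" using lt yi by auto
      have Da: "x a \<noteq> y a" if "a \<noteq> p"
      proof -
        have "a \<notin> up_tails i x" using that Ux by simp
        then show ?thesis using a by (auto simp: up_tails_def)
      qed
      have Dp: "x p \<noteq> y p"
      proof (cases "p = a")
        case False
        then have "p \<notin> up_tails i y" using Uy p by simp
        then show ?thesis using p by (auto simp: up_tails_def)
      qed (use a xp in simp)
      have zp: "z p = y p" if z: "z \<in> Z" and q: "q \<noteq> p" "q \<in> up_tails i y" "z q = y q"
        and zi: "z i \<noteq> Suc i" for z q
      proof (rule ccontr)
        assume "z p \<noteq> y p"
        then have "z p = x p" using xy[OF z, of p] by simp
        moreover have "p \<in> up_tails i z" "q \<in> up_tails i z"
          using p q \<open>z p = x p\<close> by (auto simp: up_tails_def)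
        ultimately show False using two_up_tails[OF i1 z, of p q] q p xp zi by auto
      qed
      have zi: "z i \<noteq> Suc i" if "z \<in> Z" for z
        using xy[OF that, of i] lt yi by auto
      have "tied i p"
        by (rule tiedI[OF D Dp], rule zp[of _ i]) (use Uy p zi in auto)
      moreover have "tied a p"
      proof (cases "a = p")
        case False
        show ?thesis by (rule tiedI[OF Da[OF False] Dp], rule zp[of _ a]) (use Uy p zi False in auto)
      qed (simp add: tied_def)
      ultimately show ?thesis by simp
    qed
    from e np sb consider "u = i" "v = Suc i" "x i \<le> Suc i" "x (Suc i) \<noteq> i"
      | "x i < i" "x (\<Sum>(up_tails i x)) \<noteq> Suc i" "u = a \<or> u = i" "v = \<Sum>(up_tails i x)"
      | "card (up_tails i x) = 1" "card (up_tails i y) = 1"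
      by (auto simp: edges_def a_def split: if_splits)
    then show ?thesis
    proof cases
      case 1
      have xi: "x i = Suc i \<or> x i < i" using 1 derangement_x i by (auto simp: derangement_def le_Suc_eq)
      \<comment> \<open>Following \<open>y\<close> at \<open>i\<close> gives one crossing arc that
        ends above \<open>Suc i\<close>. It remains to find a second one from below into
        \<open>Suc i\<close>; then \<open>step_back_forced\<close> applies. The tail is
        \<open>a\<close> or, if \<open>p\<close> also leads to \<open>Suc i\<close>, one of the
        two.\<close>
      have "z (Suc i) = y (Suc i)" if z: "z \<in> Z" and zi: "z i = y i" for z
      proof -
        have "\<exists>q\<ge>1. q < i \<and> z q = Suc i"
        proof (cases "x i = Suc i")
          case True
          then have "tied i a" using tied_perm[of i a] a by simp
          then have "z a = y a" using tiedD[OF _ z] zi by blast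
          then show ?thesis using a by auto
        next
          case False
          then have lt: "x i < i" using xi by simp
          then obtain p where p: "up_tails i x = {p}" "1 \<le> p" "p < i" "i < x p" using single by blast
          show ?thesis
          proof (cases "x p = Suc i")
            case True
            then have "tied p a" using tied_perm[of p a] a by simp
            then have "z p = x p \<or> z a = y a" using tiedD[OF _ z] xy[OF z, of p] by blast
            then show ?thesis using a p True by auto
          next
            case False
            then have "tied a p" "tied i p" using tp[OF lt p(1)] by auto
            then have "z a = y a" using tiedD[OF _ z] zi by blast
            then show ?thesis using a by auto
          qed
        qed
        then obtain q where "q \<ge> 1" "q < i" "z q = Suc i" by blast
        then have "z (Suc i) = i" using step_back_forced[OF i1 z] zi yi by simp
        then show ?thesis using yi by simp
      qed
      then have "tied i (Suc i)" using 1 yi by (intro tiedI) auto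
      then show ?thesis using 1 by simp
    next
      case 2
      then show ?thesis using single[OF 2(1)] tp[OF 2(1)] by auto
    next
      case 3
      then show ?thesis using up_step_back_up_tails(2)[OF vy i1 sb] by simp
    qed
  qed
qed

lemma compatibleI: "(\<And>u v. tied u v \<Longrightarrow> l u = l v) \<Longrightarrow> compatible n x y l"
  using edges_tied unfolding compatible_def by blast

end

section \<open>Exchange and reversal of balanced families\<close>

lemma balanced_family_swap:
  assumes "balanced_family n x y Z w c"
  shows "balanced_family n y x Z w (sum w Z - c)"
proof -
  interpret balanced_family n x y Z w c by (rule assms)
  show ?thesis
  proof
    fix u assume u: "y u \<noteq> x u"
    have "w z * of_bool (z u = x u) = w z - w z * of_bool (z u = y u)" if "z \<in> Z" for z
      using xy[OF that, of u] u by auto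
    then show "(\<Sum>z\<in>Z. w z * of_bool (z u = x u)) = sum w Z - c"
      using bal[of u] u by (simp add: sum_subtractf)
  qed (use vx vy fin vZ xy pos in auto)
qed

lemma balanced_family_inv:
  assumes "balanced_family n x y Z w c"
  shows "balanced_family n (inv x) (inv y) (inv ` Z) (w \<circ> inv) c"
proof -
  interpret balanced_family n x y Z w c by (rule assms)
  have d: "derangement n z" if "z \<in> Z" for z using vZ[OF that] by (simp add: valid_def)
  have ii: "inv (inv z) = z" if "z \<in> Z" for z using inv_inv[OF d[OF that]] .
  have inj: "inj_on inv Z" by (rule inj_on_inverseI[of _ inv]) (rule ii)
  show ?thesis
  proof
    fix u assume u: "inv x u \<noteq> inv y u"
    let ?v = "inv y u"
    have v: "y ?v = u" "x ?v \<noteq> y ?v"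
      using u derangement_eq_iff[OF derangement_y, of u ?v] derangement_eq_iff[OF derangement_x, of u ?v] by auto
    have "(\<Sum>z\<in>inv ` Z. (w \<circ> inv) z * of_bool (z u = inv y u))
        = (\<Sum>z\<in>Z. w z * of_bool (z ?v = y ?v))"
      unfolding sum.reindex[OF inj]
      by (rule sum.cong) (use v ii derangement_eq_iff[OF d] in \<open>auto simp: v(1)\<close>)
    then show "(\<Sum>z\<in>inv ` Z. (w \<circ> inv) z * of_bool (z u = inv y u)) = c"
      using bal[OF v(2)] by simp
  next
    fix z u assume "z \<in> inv ` Z"
    then obtain z' where z': "z = inv z'" "z' \<in> Z" by auto
    show "z u = inv x u \<or> z u = inv y u"
      using xy[OF z'(2), of "inv z' u"] derangement_eq_iff[OF d[OF z'(2)], of u "inv z' u"]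
        derangement_eq_iff[OF derangement_x, of u "inv z' u"] derangement_eq_iff[OF derangement_y, of u "inv z' u"] z'(1)
      by auto
  qed (use vx vy fin vZ pos valid_inv ii in auto)
qed

text \<open>Ties derived in all four orientations make every member of the family a consistent
  labelling. Where \<open>x\<close> and \<open>y\<close> agree, the label is set to False; ties
  between distinct cities never involve such cities.\<close>

lemma balanced_family_consistent:
  assumes "balanced_family n x y Z w c" and z: "z \<in> Z"
  shows "consistent n x y (\<lambda>u. x u \<noteq> y u \<and> z u = y u)"
proof -
  interpret balanced_family n x y Z w c by (rule assms)
  interpret s: balanced_family n y x Z w "sum w Z - c" by (rule balanced_family_swap[OF assms(1)])
  interpret i: balanced_family n "inv x" "inv y" "inv ` Z" "w \<circ> inv" c
    by (rule balanced_family_inv[OF assms(1)])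
  interpret j: balanced_family n "inv y" "inv x" "inv ` Z" "w \<circ> inv" "sum (w \<circ> inv) (inv ` Z) - c"
    by (rule balanced_family_swap[OF i.balanced_family_axioms])
  have dz: "derangement n z" using vZ[OF z] by (simp add: valid_def)
  have iz: "inv z \<in> inv ` Z" using z by simp
  \<comment> \<open>The label read at the tail \<open>inv x u\<close> of a head \<open>u\<close> is
    the label that the reversed tours assign to \<open>u\<close>, so the reversed families speak
    about the same labelling.\<close>
  have lab: "(x (inv x u) \<noteq> y (inv x u) \<and> z (inv x u) = y (inv x u))
      \<longleftrightarrow> inv x u \<noteq> inv y u \<and> inv z u = inv y u" for u
  proof -
    define v where "v = inv x u"
    have "x v = u" using derangement_eq_iff[OF derangement_x] v_def by blast
    moreover have "inv y u = v \<longleftrightarrow> y v = u" "inv z u = v \<longleftrightarrow> z v = u"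
      using derangement_eq_iff[OF derangement_y] derangement_eq_iff[OF dz] by blast+
    moreover have "inv z u = v \<or> inv z u = inv y u" using i.xy[OF iz, of u] v_def by simp
    ultimately have "(x v \<noteq> y v \<and> z v = y v) \<longleftrightarrow> v \<noteq> inv y u \<and> inv z u = inv y u"
      using xy[OF z, of v] by metis
    then show ?thesis by (simp add: v_def)
  qed
  have "compatible n x y (\<lambda>u. x u \<noteq> y u \<and> z u = y u)"
    by (rule compatibleI) (use z in \<open>auto simp: tied_def\<close>)
  moreover have "compatible n y x (\<lambda>u. x u \<noteq> y u \<and> z u = y u)"
  proof (rule s.compatibleI)
    fix u v assume "s.tied u v"
    then show "(x u \<noteq> y u \<and> z u = y u) = (x v \<noteq> y v \<and> z v = y v)"
      using z xy[OF z, of u] xy[OF z, of v] unfolding s.tied_def by metis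
  qed
  moreover have "compatible n (inv x) (inv y) (\<lambda>u. inv x u \<noteq> inv y u \<and> inv z u = inv y u)"
    by (rule i.compatibleI) (use iz in \<open>auto simp: i.tied_def\<close>)
  moreover have "compatible n (inv y) (inv x) (\<lambda>u. inv x u \<noteq> inv y u \<and> inv z u = inv y u)"
  proof (rule j.compatibleI)
    fix u v assume "j.tied u v"
    then show "(inv x u \<noteq> inv y u \<and> inv z u = inv y u) = (inv x v \<noteq> inv y v \<and> inv z v = inv y v)"
      using iz i.xy[OF iz, of u] i.xy[OF iz, of v] unfolding j.tied_def by metis
  qed
  ultimately show ?thesis by (simp add: consistent_def o_def lab)
qed

section \<open>Adjacency in the 1-skeleton\<close>

text \<open>Connectivity without paths: no two-valued labelling constant on the edges separates two
  cities at which the tours differ.\<close>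

definition adj_crit :: "nat \<Rightarrow> (nat \<Rightarrow> nat) \<Rightarrow> (nat \<Rightarrow> nat) \<Rightarrow> bool" where
  "adj_crit n x y \<longleftrightarrow> x \<noteq> y \<and>
     (\<forall>l. consistent n x y l \<longrightarrow> (\<forall>u v. x u \<noteq> y u \<longrightarrow> x v \<noteq> y v \<longrightarrow> l u = l v))"

section \<open>Characteristic vectors and convex combinations\<close>

lemma sum_fun_apply:
  fixes f :: "'a \<Rightarrow> 'b \<Rightarrow> 'c::comm_monoid_add"
  shows "(\<Sum>i\<in>A. f i) e = (\<Sum>i\<in>A. f i e)"
  by (induction A rule: infinite_finite_induct) (simp_all add: zero_fun_def plus_fun_def)

lemma finite_valid: "finite {z. valid n z}"
  by (rule finite_subset[OF _ finite_permutations[of "{1..n}"]])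
    (auto simp: valid_def derangement_def)

lemma char_vec_apply:
  assumes "derangement n z" "u \<in> {1..n}"
  shows "char_vec n z (u, v) = of_bool (z u = v)"
proof -
  have "z u \<noteq> u" "z u \<in> {1..n}"
    using assms derangement_mem[OF assms(1), of u] by (auto simp: derangement_def)
  then show ?thesis using assms(2) by (auto simp: char_vec_def arcs_def)
qed

lemma char_vec_inj:
  assumes "derangement n z" "derangement n z'" "char_vec n z = char_vec n z'"
  shows "z = z'"
proof
  fix u
  show "z u = z' u"
  proof (cases "u \<in> {1..n}")
    case True
    have "of_bool (z u = z u) = (of_bool (z' u = z u) :: real)"
      using assms char_vec_apply[OF _ True] by metis
    then show ?thesis by (simp split: if_splits)
  next
    case False
    then show ?thesis using assms(1,2) derangement_outside by metis
  qed
qed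

text \<open>Injectivity of \<open>char_vec\<close> on valid permutations allows the weights to be
  indexed by tours instead of vectors.\<close>

lemma PSB_combination:
  assumes n: "n \<ge> 3" and a: "a \<in> PSB n"
  obtains f where "\<And>z. valid n z \<Longrightarrow> f z \<ge> 0" "sum f {z. valid n z} = 1"
    "a = (\<Sum>z | valid n z. f z *\<^sub>R char_vec n z)"
proof -
  let ?T = "{z. valid n z}"
  have T: "{\<tau>. psb_tour n \<tau>} = ?T" using psb_tour_iff_valid[OF n] by simp
  have inj: "inj_on (char_vec n) ?T"
    by (rule inj_onI) (auto intro: char_vec_inj simp: valid_def)
  from a obtain g where g: "\<forall>v\<in>char_vec n ` ?T. 0 \<le> g v" "sum g (char_vec n ` ?T) = 1"
    "(\<Sum>v\<in>char_vec n ` ?T. g v *\<^sub>R v) = a"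
    unfolding PSB_def T convex_hull_finite[OF finite_imageI[OF finite_valid]] by blast
  show ?thesis
  proof (rule that[of "g \<circ> char_vec n"])
    show "(g \<circ> char_vec n) z \<ge> 0" if "valid n z" for z using g(1) that by simp
    show "sum (g \<circ> char_vec n) ?T = 1" using g(2) by (simp add: sum.reindex[OF inj])
    show "a = (\<Sum>z | valid n z. (g \<circ> char_vec n) z *\<^sub>R char_vec n z)"
      using g(3) by (simp add: sum.reindex[OF inj])
  qed
qed

lemma char_vec_in_PSB: "n \<ge> 3 \<Longrightarrow> valid n z \<Longrightarrow> char_vec n z \<in> PSB n"
  unfolding PSB_def by (rule hull_inc) (auto simp: psb_tour_iff_valid)

text \<open>Comparing coordinates shows that the tours of positive weight use only arcs of
  \<open>x\<close> and \<open>y\<close> and form a balanced family with \<open>c = t\<close>. Each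
  of them is then a consistent labelling, hence constant on the differing cities.\<close>

lemma combination_support:
  assumes vx: "valid n x" and vy: "valid n y"
    and const: "\<And>l u v. consistent n x y l \<Longrightarrow> x u \<noteq> y u \<Longrightarrow> x v \<noteq> y v \<Longrightarrow> l u = l v"
    and f: "\<And>z. valid n z \<Longrightarrow> f z \<ge> 0"
    and eq: "(\<Sum>z | valid n z. f z *\<^sub>R char_vec n z) = (1 - t) *\<^sub>R char_vec n x + t *\<^sub>R char_vec n y"
    and z: "valid n z" "f z > 0"
  shows "z = x \<or> z = y"
proof -
  have x: "derangement n x" and y: "derangement n y" using vx vy by (auto simp: valid_def)
  define Z where "Z = {z. valid n z \<and> f z > 0}"
  have fin: "finite Z" by (rule finite_subset[OF _ finite_valid]) (auto simp: Z_def)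
  have coord: "(\<Sum>z\<in>Z. f z * of_bool (z u = v)) = (1 - t) * of_bool (x u = v) + t * of_bool (y u = v)"
    if u: "u \<in> {1..n}" for u v
  proof -
    have "(\<Sum>z | valid n z. f z * of_bool (z u = v)) = (\<Sum>z | valid n z. f z * char_vec n z (u, v))"
      by (rule sum.cong) (auto simp: char_vec_apply[OF _ u] valid_def)
    also have "\<dots> = (\<Sum>z | valid n z. f z *\<^sub>R char_vec n z) (u, v)"
      by (simp add: sum_fun_apply scaleR_fun_def)
    also have "\<dots> = (1 - t) * of_bool (x u = v) + t * of_bool (y u = v)"
      unfolding eq by (simp add: plus_fun_def scaleR_fun_def char_vec_apply[OF x u] char_vec_apply[OF y u])
    also have "(\<Sum>z | valid n z. f z * of_bool (z u = v)) = (\<Sum>z\<in>Z. f z * of_bool (z u = v))"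
      by (rule sum.mono_neutral_right) (use f in \<open>force simp: Z_def finite_valid less_le\<close>)+
    finally show ?thesis .
  qed
  have xy: "z u = x u \<or> z u = y u" if z: "z \<in> Z" for z u
  proof (cases "u \<in> {1..n}")
    case u: True
    show ?thesis
    proof (rule ccontr)
      assume "\<not> ?thesis"
      then have "(\<Sum>z'\<in>Z. f z' * of_bool (z' u = z u)) = 0" using coord[OF u, of "z u"] by auto
      moreover have "f z * of_bool (z u = z u) \<le> (\<Sum>z'\<in>Z. f z' * of_bool (z' u = z u))"
        by (rule member_le_sum[OF z _ fin, where f = "\<lambda>z'. f z' * of_bool (z' u = z u)"])
          (auto simp: Z_def)
      ultimately show False using z by (simp add: Z_def)
    qed
  next
    case False
    then have "z u = u" "x u = u" using x z derangement_outside by (auto simp: Z_def valid_def)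
    then show ?thesis by simp
  qed
  have bf: "balanced_family n x y Z f t"
  proof
    fix u assume u: "x u \<noteq> y u"
    then have "u \<in> {1..n}" using x y derangement_outside by metis
    then show "(\<Sum>z\<in>Z. f z * of_bool (z u = y u)) = t" using coord[of u "y u"] u by simp
  qed (use vx vy fin xy in \<open>auto simp: Z_def\<close>)
  have zZ: "z \<in> Z" using z by (simp add: Z_def)
  note g = const[OF balanced_family_consistent[OF bf zZ]]
  show ?thesis
  proof (cases "\<exists>u. x u \<noteq> y u \<and> z u = y u")
    case True
    then obtain u where u: "x u \<noteq> y u" "z u = y u" by blast
    have "z v = y v" for v
      using g[OF u(1), of v] u xy[OF zZ, of v] by (cases "x v = y v") simp_all
    then show ?thesis by blast
  next
    case False
    then have "z v = x v" for v using xy[OF zZ, of v] by metis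
    then show ?thesis by blast
  qed
qed

lemma face_of_PSB:
  assumes n: "n \<ge> 3" and vx: "valid n x" and vy: "valid n y"
    and const: "\<And>l u v. consistent n x y l \<Longrightarrow> x u \<noteq> y u \<Longrightarrow> x v \<noteq> y v \<Longrightarrow> l u = l v"
  shows "(convex hull {char_vec n x, char_vec n y}) face_of PSB n"
  unfolding face_of_def
proof (intro conjI ballI impI)
  let ?T = "{z. valid n z}" and ?C = "convex hull {char_vec n x, char_vec n y}"
  show "?C \<subseteq> PSB n"
    using char_vec_in_PSB[OF n] vx vy by (intro hull_minimal) (auto simp: PSB_def convex_convex_hull)
  show "convex ?C" by (rule convex_convex_hull)
  fix a b m assume a: "a \<in> PSB n" and b: "b \<in> PSB n" and m: "m \<in> ?C" and seg: "m \<in> open_segment a b"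
  obtain f where f: "\<And>z. valid n z \<Longrightarrow> f z \<ge> 0" "sum f ?T = 1"
    "a = (\<Sum>z\<in>?T. f z *\<^sub>R char_vec n z)" by (rule PSB_combination[OF n a]) blast
  obtain g where g: "\<And>z. valid n z \<Longrightarrow> g z \<ge> 0" "sum g ?T = 1"
    "b = (\<Sum>z\<in>?T. g z *\<^sub>R char_vec n z)" by (rule PSB_combination[OF n b]) blast
  obtain s where s: "0 < s" "s < 1" "m = (1 - s) *\<^sub>R a + s *\<^sub>R b"
    using seg by (auto simp: in_segment)
  obtain t where t: "m = (1 - t) *\<^sub>R char_vec n x + t *\<^sub>R char_vec n y"
    using m by (auto simp: segment_convex_hull[symmetric] in_segment)
  \<comment> \<open>Both coefficients \<open>1 - s\<close> and \<open>s\<close> are positive, so the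
    support of the combination for \<open>m\<close> contains the supports for \<open>a\<close> and
    for \<open>b\<close>. Restricting the former to \<open>x\<close> and \<open>y\<close> restricts
    the latter.\<close>
  define h where "h z = (1 - s) * f z + s * g z" for z
  have "m = (\<Sum>z\<in>?T. h z *\<^sub>R char_vec n z)"
    by (simp add: s f(3) g(3) h_def scaleR_sum_right scaleR_add_left sum.distrib)
  then have eq: "(\<Sum>z\<in>?T. h z *\<^sub>R char_vec n z) = (1 - t) *\<^sub>R char_vec n x + t *\<^sub>R char_vec n y"
    using t by simp
  have h0: "h z \<ge> 0" if "valid n z" for z using f(1)[OF that] g(1)[OF that] s by (simp add: h_def)
  note supp = combination_support[OF vx vy const h0 eq]
  have inC: "(\<Sum>z\<in>?T. k z *\<^sub>R char_vec n z) \<in> ?C"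
    if k: "\<And>z. valid n z \<Longrightarrow> k z \<ge> 0" "sum k ?T = 1"
      and kh: "\<And>z. valid n z \<Longrightarrow> k z > 0 \<Longrightarrow> h z > 0" for k
  proof -
    let ?S = "{z. valid n z \<and> k z > 0}"
    have fin: "finite ?S" by (rule finite_subset[OF _ finite_valid]) auto
    have "sum k ?S = 1"
      unfolding k(2)[symmetric] by (rule sum.mono_neutral_left) (use k in \<open>force simp: finite_valid less_le\<close>)+
    moreover have "(\<Sum>z\<in>?T. k z *\<^sub>R char_vec n z) = (\<Sum>z\<in>?S. k z *\<^sub>R char_vec n z)"
      by (rule sum.mono_neutral_right) (use k in \<open>force simp: finite_valid less_le\<close>)+
    moreover have "(\<Sum>z\<in>?S. k z *\<^sub>R char_vec n z) \<in> ?C"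
    proof (rule convex_sum[OF fin convex_convex_hull])
      show "sum k ?S = 1" by fact
      fix z assume z: "z \<in> ?S"
      then show "0 \<le> k z" by simp
      have "z = x \<or> z = y" using supp[of z] z kh by simp
      then show "char_vec n z \<in> ?C" by (auto intro: hull_inc)
    qed
    ultimately show ?thesis by simp
  qed
  show "a \<in> ?C"
    unfolding f(3) using s f g by (intro inC) (auto simp: h_def intro!: add_pos_nonneg)
  show "b \<in> ?C"
    unfolding g(3) using s f g by (intro inC) (auto simp: h_def intro!: add_nonneg_pos)
qed

text \<open>The degenerate case \<open>y = x\<close> of the face lemma: there are no differing
  cities, and the segment is a point.\<close>

lemma extreme_point_of_PSB:
  assumes "n \<ge> 3" "valid n x"
  shows "char_vec n x extreme_point_of PSB n"
  using face_of_PSB[OF assms assms(2)] by (simp add: face_of_singleton)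

text \<open>A consistent labelling and its negation give two tours with the same midpoint as
  \<open>x\<close> and \<open>y\<close>. A face containing the midpoint contains both tours, but a
  mixture that takes proper arcs from each side is not on the segment.\<close>

lemma consistent_const_if_adjacent:
  assumes n: "n \<ge> 3" and vx: "valid n x" and vy: "valid n y"
    and face: "(convex hull {char_vec n x, char_vec n y}) face_of PSB n"
    and g: "consistent n x y l" and u: "x u \<noteq> y u" "l u" and v: "x v \<noteq> y v" "\<not> l v"
  shows False
proof -
  have x: "derangement n x" and y: "derangement n y" using vx vy by (auto simp: valid_def)
  define z where "z = mix x y l"
  define t where "t = mix x y (\<lambda>u. \<not> l u)"
  have vz: "valid n z" unfolding z_def by (rule valid_mix[OF vx vy g])
  have vt: "valid n t" unfolding t_def by (rule valid_mix[OF vx vy]) (simp add: consistent_Not g)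
  have z: "derangement n z" and t: "derangement n t" using vz vt by (auto simp: valid_def)
  have un: "u \<in> {1..n}" and vn: "v \<in> {1..n}"
    using x y u v derangement_outside by metis+
  have sum: "char_vec n z + char_vec n t = char_vec n x + char_vec n y"
  proof
    fix e :: "nat \<times> nat"
    show "(char_vec n z + char_vec n t) e = (char_vec n x + char_vec n y) e"
      by (cases e) (auto simp: char_vec_def z_def t_def mix_def plus_fun_def)
  qed
  have ne: "char_vec n z \<noteq> char_vec n t"
  proof
    assume "char_vec n z = char_vec n t"
    then have "z = t" using char_vec_inj z t by blast
    then have "z u = t u" by simp
    then show False using u by (simp add: z_def t_def mix_def)
  qed
  let ?m = "(1/2) *\<^sub>R (char_vec n x + char_vec n y)"
  have "?m \<in> convex hull {char_vec n x, char_vec n y}"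
    unfolding segment_convex_hull[symmetric] in_segment
    by (rule exI[of _ "1/2"]) (simp add: scaleR_add_right)
  moreover have "?m \<in> open_segment (char_vec n z) (char_vec n t)"
    unfolding in_segment using ne
    by (intro conjI exI[of _ "1/2"]) (simp_all add: sum[symmetric] scaleR_add_right)
  ultimately have "char_vec n z \<in> convex hull {char_vec n x, char_vec n y}"
    using face_ofD[OF face] char_vec_in_PSB[OF n] vz vt by blast
  then obtain s where s: "char_vec n z = (1 - s) *\<^sub>R char_vec n x + s *\<^sub>R char_vec n y"
    by (auto simp: segment_convex_hull[symmetric] in_segment)
  have at: "of_bool (z w = b) = (1 - s) * of_bool (x w = b) + s * of_bool (y w = b)"
    if w: "w \<in> {1..n}" for w b
    using arg_cong[OF s, of "\<lambda>h. h (w, b)"]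
    by (simp add: plus_fun_def scaleR_fun_def char_vec_apply[OF x w] char_vec_apply[OF y w] char_vec_apply[OF z w])
  \<comment> \<open>The arc of \<open>y\<close> at \<open>u\<close> is absent from \<open>x\<close>
    and present in \<open>z\<close>, which puts \<open>z\<close> at the end \<open>y\<close>; the
    arc of \<open>x\<close> at \<open>v\<close> puts it at the other end.\<close>
  have "s = 1" using at[OF un, of "y u"] u by (simp add: z_def mix_def)
  moreover have "1 - s = 1" using at[OF vn, of "x v"] v by (simp add: z_def mix_def)
  ultimately show False by simp
qed

theorem skeleton_adjacent_iff:
  assumes n: "n \<ge> 3" and vx: "valid n x" and vy: "valid n y"
  shows "skeleton_adjacent (PSB n) (char_vec n x) (char_vec n y) \<longleftrightarrow> adj_crit n x y"
proof
  assume a: "skeleton_adjacent (PSB n) (char_vec n x) (char_vec n y)"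
  then have face: "(convex hull {char_vec n x, char_vec n y}) face_of PSB n"
    and "\<exists>B. affine hull B = affine hull (convex hull {char_vec n x, char_vec n y}) \<and> card B = 2"
    by (auto simp: skeleton_adjacent_def geometric_edge_of_def)
  then obtain B where B: "affine hull B = affine hull {char_vec n x, char_vec n y}" "card B = 2"
    by (auto simp del: affine_hull_eq)
  have "x \<noteq> y"
  proof
    assume "x = y"
    then have "affine hull B = {char_vec n y}" using B by (simp add: hull_same)
    then have "B \<subseteq> {char_vec n y}" using hull_subset[of B affine] by simp
    then have "card B \<le> 1" using card_mono[of "{char_vec n y}" B] by simp
    then show False using B by simp
  qed
  moreover have "l u = l v" if "consistent n x y l" "x u \<noteq> y u" "x v \<noteq> y v" for l u v
    using consistent_const_if_adjacent[OF n vx vy face that(1)] that by blast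
  ultimately show "adj_crit n x y" by (auto simp: adj_crit_def)
next
  assume c: "adj_crit n x y"
  then have ne: "char_vec n x \<noteq> char_vec n y"
    using char_vec_inj[of n x y] vx vy by (auto simp: adj_crit_def valid_def)
  have "(convex hull {char_vec n x, char_vec n y}) face_of PSB n"
    using c by (intro face_of_PSB[OF n vx vy]) (auto simp: adj_crit_def)
  moreover have "\<exists>B. affine hull B = affine hull (convex hull {char_vec n x, char_vec n y}) \<and>
      \<not> affine_dependent B \<and> card B = 2"
    by (rule exI[of _ "{char_vec n x, char_vec n y}"]) (use ne in simp)
  ultimately show "skeleton_adjacent (PSB n) (char_vec n x) (char_vec n y)"
    using extreme_point_of_PSB[OF n] vx vy
    by (simp add: skeleton_adjacent_def geometric_edge_of_def)
qed

section \<open>Reasoning about programs\<close>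

text \<open>The existence of one run is total correctness here, since execution is
  deterministic.\<close>

definition runs :: "nat \<Rightarrow> com \<Rightarrow> store \<Rightarrow> nat \<Rightarrow> (store \<Rightarrow> bool) \<Rightarrow> bool" where
  "runs W c s T Q \<longleftrightarrow> (\<exists>t s'. exec W c s t s' \<and> t \<le> T \<and> Q s')"

lemma runs_mono: "runs W c s T Q \<Longrightarrow> T \<le> T' \<Longrightarrow> (\<And>s'. Q s' \<Longrightarrow> Q' s') \<Longrightarrow> runs W c s T' Q'"
  unfolding runs_def by (meson order_trans)

lemma runs_Seq:
  "runs W c1 s T1 R \<Longrightarrow> (\<And>s'. R s' \<Longrightarrow> runs W c2 s' T2 Q) \<Longrightarrow> runs W (Seq c1 c2) s (T1 + T2) Q"
  unfolding runs_def by (meson exec.Seq add_mono)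

text \<open>The index \<open>k\<close> of the invariant is the variant, an upper bound for the
  number of remaining rounds.\<close>

lemma runs_While:
  assumes step: "\<And>k s. I k s \<Longrightarrow> bval b s \<Longrightarrow> \<exists>k'. k = Suc k' \<and> runs W c s B (I k')"
    and exit: "\<And>k s. I k s \<Longrightarrow> \<not> bval b s \<Longrightarrow> Q s"
    and start: "I k s"
  shows "runs W (While b c) s (k * (1 + bcost b + B) + 1 + bcost b) Q"
  using start
proof (induction k arbitrary: s)
  case 0
  then have "\<not> bval b s" using step by blast
  then show ?case
    unfolding runs_def using exec.WhileFalse[of b s W c] exit[OF 0]
    by (intro exI[of _ "1 + bcost b"] exI[of _ s]) simp
next
  case (Suc k)
  show ?case
  proof (cases "bval b s")
    case False
    then show ?thesis
      unfolding runs_def using exec.WhileFalse[of b s W c] exit[OF Suc.prems]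
      by (intro exI[of _ "1 + bcost b"] exI[of _ s]) simp
  next
    case True
    then obtain t1 s1 where 1: "exec W c s t1 s1" "t1 \<le> B" "I k s1"
      using step[OF Suc.prems] by (auto simp: runs_def)
    obtain t2 s2 where 2: "exec W (While b c) s1 t2 s2" "t2 \<le> k * (1 + bcost b + B) + 1 + bcost b" "Q s2"
      using Suc.IH[OF 1(3)] by (auto simp: runs_def)
    show ?thesis
      unfolding runs_def
      by (intro exI[of _ "1 + bcost b + t1 + t2"] exI[of _ s2] conjI exec.WhileTrue[OF True 1(1) 2(1)])
        (use 1 2 in auto)
  qed
qed

section \<open>Symbolic evaluation of loop-free programs\<close>

fun loop_free :: "com \<Rightarrow> bool" where
  "loop_free (Seq c1 c2) = (loop_free c1 \<and> loop_free c2)"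
| "loop_free (Cond b c1 c2) = (loop_free c1 \<and> loop_free c2)"
| "loop_free (While b c) = False"
| "loop_free _ = True"

fun result :: "com \<Rightarrow> store \<Rightarrow> store" where
  "result (Assign r a) s = s\<lparr>reg := (reg s)(r := aval a s)\<rparr>"
| "result (Store A i a) s = s\<lparr>arr := (arr s)(A := (arr s A)(aval i s := aval a s))\<rparr>"
| "result (Seq c1 c2) s = result c2 (result c1 s)"
| "result (Cond b c1 c2) s = (if bval b s then result c1 s else result c2 s)"
| "result _ s = s"

fun safe :: "nat \<Rightarrow> com \<Rightarrow> store \<Rightarrow> bool" where
  "safe W (Assign r a) s \<longleftrightarrow> aval a s \<le> W"
| "safe W (Store A i a) s \<longleftrightarrow> aval i s \<le> W \<and> aval a s \<le> W"
| "safe W (Seq c1 c2) s \<longleftrightarrow> safe W c1 s \<and> safe W c2 (result c1 s)"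
| "safe W (Cond b c1 c2) s \<longleftrightarrow> (if bval b s then safe W c1 s else safe W c2 s)"
| "safe W _ s \<longleftrightarrow> True"

text \<open>A conditional is charged for both branches, which gives a bound independent of the
  state.\<close>

fun max_time :: "com \<Rightarrow> nat" where
  "max_time (Assign r a) = 1 + acost a"
| "max_time (Store A i a) = 1 + acost i + acost a"
| "max_time (Seq c1 c2) = max_time c1 + max_time c2"
| "max_time (Cond b c1 c2) = 1 + bcost b + (max_time c1 + max_time c2)"
| "max_time _ = 1"

lemma exec_result: "loop_free c \<Longrightarrow> safe W c s \<Longrightarrow> \<exists>t\<le>max_time c. exec W c s t (result c s)"
proof (induction c arbitrary: s)
  case (Seq c1 c2)
  then obtain t1 t2 where "t1 \<le> max_time c1" "exec W c1 s t1 (result c1 s)"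
    "t2 \<le> max_time c2" "exec W c2 (result c1 s) t2 (result c2 (result c1 s))"
    by fastforce
  then show ?case by (intro exI[of _ "t1 + t2"]) (auto intro: exec.Seq)
next
  case (Cond b c1 c2)
  show ?case
  proof (cases "bval b s")
    case True
    then obtain t where "t \<le> max_time c1" "exec W c1 s t (result c1 s)" using Cond by fastforce
    then show ?thesis using True
      by (intro exI[of _ "1 + bcost b + t"] conjI) (auto simp del: add_Suc intro!: exec.CondTrue[simplified])
  next
    case False
    then obtain t where "t \<le> max_time c2" "exec W c2 s t (result c2 s)" using Cond by fastforce
    then show ?thesis using False
      by (intro exI[of _ "1 + bcost b + t"] conjI) (auto simp del: add_Suc intro!: exec.CondFalse[simplified])
  qed
next
  case Skip
  then show ?case by (auto intro: exec.Skip[simplified])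
next
  case (Assign r a)
  then show ?case by (intro exI[of _ "1 + acost a"]) (use exec.Assign in auto)
next
  case (Store A i a)
  then show ?case by (intro exI[of _ "1 + acost i + acost a"]) (use exec.Store in auto)
qed simp

lemma runs_loop_free:
  "loop_free c \<Longrightarrow> safe W c s \<Longrightarrow> Q (result c s) \<Longrightarrow> runs W c s (max_time c) Q"
  unfolding runs_def using exec_result by blast

section \<open>Incidence lists as doubly linked chains\<close>

text \<open>Occurrence chains: edge number \<open>j\<close> has the end point \<open>U j\<close> and is represented by the node
  \<open>n + 1 + j\<close>. \<open>P\<close> leads from this node to the previous edge node with the same end point, or to the
  end point itself if there is none; \<open>N\<close> inverts \<open>P\<close>; \<open>L u\<close> is the last node in the chain of \<open>u\<close>.\<close>

definition chain :: "nat \<Rightarrow> (nat \<Rightarrow> nat) \<Rightarrow> nat \<Rightarrow> (nat \<Rightarrow> nat) \<Rightarrow> (nat \<Rightarrow> nat) \<Rightarrow> (nat \<Rightarrow> nat) \<Rightarrow> bool" where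
  "chain n U m P N L \<longleftrightarrow>
     (\<forall>u\<in>{1..n}. (L u = u \<or> (\<exists>j<m. U j = u \<and> L u = n + 1 + j)) \<and> N (L u) = 0) \<and>
     (\<forall>j<m. U j \<in> {1..n} \<and> (P (n + 1 + j) = U j \<or> (\<exists>j'<j. U j' = U j \<and> P (n + 1 + j) = n + 1 + j')) \<and>
        N (P (n + 1 + j)) = n + 1 + j) \<and>
     (\<forall>w. N w \<noteq> 0 \<longrightarrow> (\<exists>j<m. N w = n + 1 + j \<and> P (n + 1 + j) = w)) \<and>
     (\<forall>w. P w \<noteq> 0 \<longrightarrow> (\<exists>j<m. w = n + 1 + j))"

lemma chain_0: "(\<And>u. u \<in> {1..n} \<Longrightarrow> L u = u) \<Longrightarrow> chain n U 0 (\<lambda>_. 0) (\<lambda>_. 0) L"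
  by (auto simp: chain_def)

text \<open>The new edge node is appended after the last node of its end point, where
  \<open>N\<close> is still 0, so a constant number of writes extends the chain.\<close>

lemma chain_Suc:
  assumes c: "chain n U m P N L" and u: "U m \<in> {1..n}"
  shows "chain n U (Suc m) (P(n + 1 + m := L (U m))) (N(L (U m) := n + 1 + m)) (L(U m := n + 1 + m))"
proof -
  have L: "L v = v \<or> (\<exists>j<m. U j = v \<and> L v = n + 1 + j)" "N (L v) = 0" if "v \<in> {1..n}" for v
    using c that unfolding chain_def by blast+
  have P: "U j \<in> {1..n}" "P (n + 1 + j) = U j \<or> (\<exists>j'<j. U j' = U j \<and> P (n + 1 + j) = n + 1 + j')"
    "N (P (n + 1 + j)) = n + 1 + j" if "j < m" for j
    using c that unfolding chain_def by blast+
  have N: "\<exists>j<m. N w = n + 1 + j \<and> P (n + 1 + j) = w" if "N w \<noteq> 0" for w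
    using c that unfolding chain_def by blast
  have P0: "\<exists>j<m. w = n + 1 + j" if "P w \<noteq> 0" for w
    using c that unfolding chain_def by blast
  let ?u = "U m" and ?k = "n + 1 + m"
  let ?P = "P(?k := L ?u)" and ?N = "N(L ?u := ?k)" and ?L = "L(?u := ?k)"
  have Lu: "L ?u < ?k" using L(1)[OF u] u by auto
  \<comment> \<open>A last node determines its end point: it is either that city itself or the node
    of an edge with that end point.\<close>
  have Lne: "L v \<noteq> L ?u" if "v \<in> {1..n}" "v \<noteq> ?u" for v
    using L(1)[OF that(1)] L(1)[OF u] that u by auto
  have Nk: "N ?k = 0"
  proof (rule ccontr)
    assume "N ?k \<noteq> 0"
    then obtain j where j: "j < m" "P (n + 1 + j) = ?k" using N by blast
    then show False using P(1,2)[OF j(1)] by auto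
  qed
  have 1: "(?L v = v \<or> (\<exists>j<Suc m. U j = v \<and> ?L v = n + 1 + j)) \<and> ?N (?L v) = 0" if v: "v \<in> {1..n}" for v
  proof (cases "v = ?u")
    case True
    then show ?thesis using Lu Nk by auto
  next
    case False
    then show ?thesis using L[OF v] Lne[OF v] less_SucI by auto
  qed
  have 2: "U j \<in> {1..n} \<and> (?P (n + 1 + j) = U j \<or> (\<exists>j'<j. U j' = U j \<and> ?P (n + 1 + j) = n + 1 + j')) \<and>
      ?N (?P (n + 1 + j)) = n + 1 + j" if j: "j < Suc m" for j
  proof (cases "j = m")
    case True
    then show ?thesis using u L(1)[OF u] by auto
  next
    case False
    then have j: "j < m" using j by simp
    have "P (n + 1 + j) \<noteq> L ?u" using P(3)[OF j] L(2)[OF u] by auto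
    then show ?thesis using P[OF j] False by simp
  qed
  have 3: "\<exists>j<Suc m. ?N w = n + 1 + j \<and> ?P (n + 1 + j) = w" if "?N w \<noteq> 0" for w
  proof (cases "w = L ?u")
    case False
    then have "N w \<noteq> 0" using that by simp
    then obtain j where "j < m" "N w = n + 1 + j" "P (n + 1 + j) = w" using N by blast
    then show ?thesis using False by (intro exI[of _ j]) auto
  qed auto
  have 4: "\<exists>j<Suc m. w = n + 1 + j" if "?P w \<noteq> 0" for w
    using P0[of w] that by (cases "w = ?k") (auto intro: less_SucI)
  show ?thesis unfolding chain_def using 1 2 3 4 by blast
qed

text \<open>Links can be followed in both directions, so membership in a closed set is the same for
  a node and its predecessor; descending along \<open>P\<close> reaches the end point.\<close>

lemma chain_closed:
  assumes c: "chain n U m P N L" and j: "j < m"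
    and R: "\<And>w. w \<in> R \<Longrightarrow> P w \<noteq> 0 \<Longrightarrow> P w \<in> R" "\<And>w. w \<in> R \<Longrightarrow> N w \<noteq> 0 \<Longrightarrow> N w \<in> R"
  shows "n + 1 + j \<in> R \<longleftrightarrow> U j \<in> R"
  using j
proof (induction j rule: less_induct)
  case (less j)
  have P: "U j \<in> {1..n}" "P (n + 1 + j) = U j \<or> (\<exists>j'<j. U j' = U j \<and> P (n + 1 + j) = n + 1 + j')"
    "N (P (n + 1 + j)) = n + 1 + j"
    using c less.prems unfolding chain_def by blast+
  have "P (n + 1 + j) \<noteq> 0" using P(1,2) by auto
  then have "n + 1 + j \<in> R \<longleftrightarrow> P (n + 1 + j) \<in> R"
    using R(1)[of "n + 1 + j"] R(2)[of "P (n + 1 + j)"] P(3) by auto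
  moreover have "P (n + 1 + j) \<in> R \<longleftrightarrow> U j \<in> R"
    using P(2)
  proof
    assume "\<exists>j'<j. U j' = U j \<and> P (n + 1 + j) = n + 1 + j'"
    then obtain j' where "j' < j" "U j' = U j" "P (n + 1 + j) = n + 1 + j'" by blast
    then show ?thesis using less.IH[of j'] less.prems by simp
  qed simp
  ultimately show ?case by simp
qed

text \<open>Dual to \<open>chain_closed\<close>: it turns a labelling of the graph into one that is
  constant along all links, the form in which the search describes what it reaches.\<close>

lemma chain_label:
  assumes c: "chain n U m P N L" and g: "\<And>j. j < m \<Longrightarrow> g (n + 1 + j) = g (U j)"
  shows "P w \<noteq> 0 \<Longrightarrow> g (P w) = g w" "N w \<noteq> 0 \<Longrightarrow> g (N w) = g w"
proof -
  have P: "g (P (n + 1 + j)) = g (n + 1 + j)" if j: "j < m" for j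
  proof -
    have "P (n + 1 + j) = U j \<or> (\<exists>j'<j. U j' = U j \<and> P (n + 1 + j) = n + 1 + j')"
      using c j unfolding chain_def by blast
    then show ?thesis using g j by (metis less_trans)
  qed
  show "g (P w) = g w" if "P w \<noteq> 0"
  proof -
    obtain j where "j < m" "w = n + 1 + j" using c \<open>P w \<noteq> 0\<close> unfolding chain_def by blast
    then show ?thesis using P by simp
  qed
  show "g (N w) = g w" if "N w \<noteq> 0"
  proof -
    obtain j where "j < m" "N w = n + 1 + j" "P (n + 1 + j) = w"
      using c \<open>N w \<noteq> 0\<close> unfolding chain_def by blast
    then show ?thesis using P[of j] by simp
  qed
qed

text \<open>The value 0 stands for an absent link and is no node. That 0 has no links itself lets
  the search treat it as a visited node.\<close>

lemma chain_bound:
  assumes c: "chain n U m P N L"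
  shows "P w \<le> n + m" "N w \<le> n + m" "P 0 = 0" "N 0 = 0" "u \<in> {1..n} \<Longrightarrow> L u \<le> n + m"
proof -
  have P: "U j \<in> {1..n}" "P (n + 1 + j) = U j \<or> (\<exists>j'<j. U j' = U j \<and> P (n + 1 + j) = n + 1 + j')" if "j < m" for j
    using c that unfolding chain_def by blast+
  have Pj: "1 \<le> P (n + 1 + j) \<and> P (n + 1 + j) \<le> n + m" if "j < m" for j using P[OF that] that by auto
  have N: "\<exists>j<m. N w = n + 1 + j \<and> P (n + 1 + j) = w" if "N w \<noteq> 0" for w
    using c that unfolding chain_def by blast
  have P0: "\<exists>j<m. w = n + 1 + j" if "P w \<noteq> 0" for w
    using c that unfolding chain_def by blast
  show "P w \<le> n + m" using P0[of w] Pj by (cases "P w = 0") auto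
  show "N w \<le> n + m" using N[of w] by (cases "N w = 0") auto
  show "P 0 = 0" using P0[of 0] by (cases "P 0 = 0") auto
  show "N 0 = 0" using N[of 0] Pj by (cases "N 0 = 0") force+
  show "L u \<le> n + m" if "u \<in> {1..n}"
  proof -
    have "L u = u \<or> (\<exists>j<m. U j = u \<and> L u = n + 1 + j)"
      using c that unfolding chain_def by blast
    then show ?thesis using that by auto
  qed
qed

section \<open>Loops over the cities\<close>

fun seqs :: "com list \<Rightarrow> com" where
  "seqs [] = Skip"
| "seqs (c # cs) = Seq c (seqs cs)"

definition incr :: "string \<Rightarrow> com" where
  "incr r = Assign r (Add (Var r) (Lit 1))"

definition for_each :: "com \<Rightarrow> com" where
  "for_each c = Seq (Assign ''i'' (Lit 1))
     (While (Lt (Var ''i'') (Add (Var ''n'') (Lit 1))) (Seq c (incr ''i'')))"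

text \<open>A round costs 6 for the test and 4 for the increment besides the body, hence
  \<open>B + 10\<close>. The first assignment and the last test are covered by the additional round
  in \<open>n + 1\<close>.\<close>

lemma runs_for_each:
  assumes W: "n + 1 \<le> W"
    and start: "J 1 (s\<lparr>reg := (reg s)(''i'' := 1)\<rparr>)"
    and J: "\<And>i s. J i s \<Longrightarrow> reg s ''i'' = i \<and> reg s ''n'' = n"
    and step: "\<And>i s. J i s \<Longrightarrow> i \<in> {1..n} \<Longrightarrow>
      runs W c s B (\<lambda>s'. reg s' ''i'' = i \<and> J (Suc i) (s'\<lparr>reg := (reg s')(''i'' := Suc i)\<rparr>))"
  shows "runs W (for_each c) s ((n + 1) * (B + 10)) (J (Suc n))"
proof -
  let ?b = "Lt (Var ''i'') (Add (Var ''n'') (Lit 1))" and ?c = "Seq c (incr ''i'')"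
  define I where "I k s \<longleftrightarrow> (\<exists>i. 1 \<le> i \<and> i \<le> Suc n \<and> k = Suc n - i \<and> J i s)" for k s
  have "runs W (Assign ''i'' (Lit 1)) s (max_time (Assign ''i'' (Lit 1))) (I n)"
    by (rule runs_loop_free) (use W start in \<open>auto simp: I_def intro!: exI[of _ 1]\<close>)
  then have "runs W (Assign ''i'' (Lit 1)) s 2 (I n)"
    by (rule runs_mono) simp_all
  moreover have "runs W (While ?b ?c) s' (n * (1 + bcost ?b + (B + 4)) + 1 + bcost ?b) (J (Suc n))"
    if "I n s'" for s'
  proof (rule runs_While[where I = I])
    fix k s assume "I k s" "bval ?b s"
    then obtain i where i: "i \<in> {1..n}" "k = Suc n - i" "J i s"
      using J by (fastforce simp: I_def)
    have "runs W ?c s (B + 4) (I (n - i))"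
    proof (rule runs_Seq[OF step[OF i(3,1)]])
      fix s' assume s': "reg s' ''i'' = i \<and> J (Suc i) (s'\<lparr>reg := (reg s')(''i'' := Suc i)\<rparr>)"
      have "runs W (incr ''i'') s' (max_time (incr ''i'')) (I (n - i))"
        by (rule runs_loop_free)
          (use W i s' in \<open>auto simp: incr_def I_def intro!: exI[of _ "Suc i"]\<close>)
      then show "runs W (incr ''i'') s' 4 (I (n - i))"
        by (rule runs_mono) (simp_all add: incr_def)
    qed
    then show "\<exists>k'. k = Suc k' \<and> runs W ?c s (B + 4) (I k')"
      using i by (intro exI[of _ "n - i"]) auto
  next
    fix k s assume "I k s" "\<not> bval ?b s"
    then show "J (Suc n) s"
      using J by (fastforce simp: I_def)
  qed (rule that)
  ultimately have "runs W (for_each c) s (2 + (n * (1 + bcost ?b + (B + 4)) + 1 + bcost ?b)) (J (Suc n))"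
    unfolding for_each_def by (rule runs_Seq)
  then show ?thesis by (rule runs_mono) (auto simp: algebra_simps)
qed

section \<open>Appending edges to the list\<close>

definition edge_set :: "store \<Rightarrow> (nat \<times> nat) set" where
  "edge_set s = (\<lambda>j. (arr s ''EU'' j, arr s ''EV'' j)) ` {..<reg s ''k''}"

text \<open>The array \<open>w\<close> translates end points before they are stored: the identity in
  the forward passes, \<open>inv x\<close> in the reversed ones, where an end point is a head and
  its label belongs to its tail.\<close>

definition emit :: "string \<Rightarrow> bexp \<Rightarrow> aexp \<Rightarrow> aexp \<Rightarrow> com" where
  "emit w b u v = Cond b (seqs [Store ''EU'' (Var ''k'') (Elem w u), Store ''EV'' (Var ''k'') (Elem w v),
     incr ''k'']) Skip"

definition same :: "store \<Rightarrow> store \<Rightarrow> bool" where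
  "same s s' \<longleftrightarrow> (\<forall>r. r \<noteq> ''k'' \<longrightarrow> reg s' r = reg s r) \<and>
     (\<forall>A. A \<noteq> ''EU'' \<longrightarrow> A \<noteq> ''EV'' \<longrightarrow> arr s' A = arr s A)"

text \<open>Emissions modify only \<open>k\<close> and the two edge arrays; expressions that read
  none of these keep their values through a whole round.\<close>

fun aindep :: "aexp \<Rightarrow> bool" where
  "aindep (Lit k) = True"
| "aindep (Var r) = (r \<noteq> ''k'')"
| "aindep (Elem A a) = (A \<noteq> ''EU'' \<and> A \<noteq> ''EV'' \<and> aindep a)"
| "aindep (Add a b) = (aindep a \<and> aindep b)"
| "aindep (Sub a b) = (aindep a \<and> aindep b)"

fun bindep :: "bexp \<Rightarrow> bool" where
  "bindep (Lt a b) = (aindep a \<and> aindep b)"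
| "bindep (Eql a b) = (aindep a \<and> aindep b)"
| "bindep (BNot b) = bindep b"
| "bindep (BAnd b c) = (bindep b \<and> bindep c)"

lemma aval_same: "same s s' \<Longrightarrow> aindep a \<Longrightarrow> aval a s' = aval a s"
  by (induction a) (auto simp: same_def)

lemma bval_same: "same s s' \<Longrightarrow> bindep b \<Longrightarrow> bval b s' = bval b s"
  by (induction b) (auto simp: aval_same)

text \<open>The guard and the end points refer to the state \<open>s\<close> before a sequence of emissions.\<close>

lemma runs_emit:
  assumes same: "same s s1" and indep: "bindep b" "aindep u" "aindep v"
    and w: "w \<noteq> ''EU''" "w \<noteq> ''EV''"
    and k: "reg s1 ''k'' < W"
    and bound: "bval b s \<Longrightarrow> arr s w (aval u s) \<le> W \<and> arr s w (aval v s) \<le> W"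
  shows "runs W (emit w b u v) s1 (20 + bcost b + acost u + acost v)
    (\<lambda>s'. same s s' \<and> reg s' ''k'' \<le> Suc (reg s1 ''k'') \<and>
      edge_set s' = edge_set s1 \<union> (if bval b s then {(arr s w (aval u s), arr s w (aval v s))} else {}))"
    (is "runs W ?c s1 _ ?Q")
proof -
  have w1: "arr s1 w = arr s w" using same w by (simp add: same_def)
  have u1: "aval u s1 = aval u s" and v1: "aval v s1 = aval v s" and b1: "bval b s1 = bval b s"
    using aval_same[OF same] bval_same[OF same] indep by auto
  define s2 where "s2 = s1\<lparr>arr := (arr s1)(''EU'' := (arr s1 ''EU'')(reg s1 ''k'' := arr s w (aval u s)))\<rparr>"
  have "same s1 s2" by (simp add: same_def s2_def)
  then have v2: "aval v s2 = aval v s" "arr s2 w = arr s w"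
    using aval_same[of s1 s2 v] indep v1 w1 w by (auto simp: same_def)
  have st: "result (Store ''EU'' (Var ''k'') (Elem w u)) s1 = s2"
    by (simp add: s2_def u1 w1)
  have "runs W ?c s1 (max_time ?c) ?Q"
  proof (rule runs_loop_free)
    show "loop_free ?c" by (simp add: emit_def incr_def)
    show "safe W ?c s1"
      using bound k by (simp add: emit_def incr_def b1 st u1 w1 v2 del: result.simps(2)) (simp add: s2_def)
    show "?Q (result ?c s1)"
    proof (cases "bval b s")
      case False
      then show ?thesis using same by (simp add: emit_def b1)
    next
      case True
      define s3 where "s3 = result ?c s1"
      have s3: "s3 = s2\<lparr>arr := (arr s2)(''EV'' := (arr s2 ''EV'')(reg s1 ''k'' := arr s w (aval v s))),
          reg := (reg s1)(''k'' := Suc (reg s1 ''k''))\<rparr>"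
        using True v2 unfolding s3_def emit_def
        by (simp add: b1 st incr_def del: result.simps(2)) (simp add: s2_def)
      have "same s s3" using same by (simp add: same_def s3 s2_def)
      moreover have "edge_set s3 = insert (arr s w (aval u s), arr s w (aval v s)) (edge_set s1)"
        by (auto simp: edge_set_def s3 s2_def lessThan_Suc)
      ultimately show ?thesis using True by (simp add: s3_def[symmetric]) (simp add: s3)
    qed
  qed
  then show ?thesis by (rule runs_mono) (auto simp: emit_def incr_def)
qed

section \<open>The edges of the constraint graph\<close>

lemma up_step_back_less: "derangement n y \<Longrightarrow> i \<in> {1..n} \<Longrightarrow> up_step_back y i \<Longrightarrow> Suc i < n"
  using derangement_mem[of n y i] by (auto simp: up_step_back_def)

lemma edges_mem:
  assumes vx: "valid n x" and vy: "valid n y" and i: "i \<in> {1..n}" and e: "(u, v) \<in> edges x y i"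
  shows "u \<in> {1..n} \<and> v \<in> {1..n}"
proof -
  have x: "derangement n x" and y: "derangement n y" using vx vy by (auto simp: valid_def)
  have inv_mem: "inv y j \<in> {1..n}" if "j \<in> {1..n}" for j
    using derangement_mem[OF derangement_inv[OF y], of j] that by simp
  have single: "\<Sum>(up_tails i z) \<in> {1..n}" if c: "card (up_tails i z) = 1" for z
  proof -
    obtain p where p: "up_tails i z = {p}" using c by (auto simp: card_1_singleton_iff)
    then have "p \<in> up_tails i z" by simp
    then show ?thesis using i p by (auto simp: up_tails_def)
  qed
  have sb: "Suc i < n" if "up_step_back y i" using up_step_back_less[OF y i that] .
  have down: "\<Sum>(up_tails i x) \<in> {1..n}" if "up_step_back y i" "x i < i"
  proof -
    have "i \<in> {1..<n}" using sb[OF that(1)] i by simp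
    from single_up_if_down[OF vx this that(2)] show ?thesis
      by (metis single card_1_singleton_iff One_nat_def)
  qed
  have xi: "x i \<in> {1..n}" using derangement_mem[OF x, of i] i by simp
  have Si: "Suc i \<in> {1..n}" if "up_step_back y i" using sb[OF that] by simp
  from e consider "u = i" "v = inv y (x i)"
    | "card (up_tails i x) = 1" "card (up_tails i y) = 1" "u = \<Sum>(up_tails i x)" "v = \<Sum>(up_tails i y)"
    | "up_step_back y i" "u = i" "v = Suc i"
    | "up_step_back y i" "x i < i" "u = inv y (Suc i) \<or> u = i" "v = \<Sum>(up_tails i x)"
    by (auto simp: edges_def split: if_splits)
  then show ?thesis
  proof cases
    case 1
    then show ?thesis using i inv_mem[OF xi] by simp
  next
    case 2
    then show ?thesis using single by simp
  next
    case 3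
    then show ?thesis using i Si by simp
  next
    case 4
    then show ?thesis using i down inv_mem[OF Si] by auto
  qed
qed

section \<open>The sweep over the cuts\<close>

text \<open>The set of tails is represented by its size and its sum. Both are updated in constant
  time, and the sum of a singleton is its element.\<close>

definition count_up_tails :: "string \<Rightarrow> string \<Rightarrow> string \<Rightarrow> string \<Rightarrow> com" where
  "count_up_tails p r c u = seqs [
     Cond (Lt (Var ''i'') (Elem p (Var ''i'')))
       (seqs [Assign c (Add (Var c) (Lit 1)), Assign u (Add (Var u) (Var ''i''))]) Skip,
     Cond (Lt (Elem r (Var ''i'')) (Var ''i''))
       (seqs [Assign c (Sub (Var c) (Lit 1)), Assign u (Sub (Var u) (Elem r (Var ''i'')))]) Skip]"

lemma runs_count_up_tails:
  assumes v: "valid n z" and i: "i \<in> {1..n}" and W: "5 * n \<le> W"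
    and s: "reg s ''i'' = i" "arr s p i = z i" "arr s r i = inv z i"
      "reg s c = card (up_tails (i - 1) z)" "reg s u = \<Sum>(up_tails (i - 1) z)"
    and names: "c \<noteq> u" "c \<noteq> ''i''" "u \<noteq> ''i''"
  shows "runs W (count_up_tails p r c u) s 40
    (\<lambda>s'. s' = s\<lparr>reg := (reg s)(c := card (up_tails i z), u := \<Sum>(up_tails i z))\<rparr>)"
proof -
  have z: "derangement n z" using v by (simp add: valid_def)
  obtain j where j: "i = Suc j" using i by (cases i) auto
  have jn: "Suc j \<le> n" using i j by simp
  \<comment> \<open>At most two tails of size at most \<open>n\<close> keep the sum below
    \<open>2 * n\<close>, so even after adding \<open>i\<close> and before subtracting it fits into
    a word.\<close>
  have c2: "card (up_tails j z) \<le> 2"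
  proof (cases "j = 0")
    case False
    then have "cut_ok z j" using v jn by (auto simp: valid_def)
    then show ?thesis by (auto simp: cut_ok_def)
  qed simp
  have "\<Sum>(up_tails j z) \<le> card (up_tails j z) * n"
    using sum_bounded_above[of "up_tails j z" "\<lambda>u. u" n] jn by (auto simp: up_tails_def)
  also have "\<dots> \<le> 2 * n" using c2 by simp
  finally have S2: "\<Sum>(up_tails j z) \<le> 2 * n" .
  have c: "card (up_tails (Suc j) z) = card (up_tails j z) + (if Suc j < z (Suc j) then 1 else 0)
      - (if inv z (Suc j) < Suc j then 1 else 0)"
    using card_up_tails_Suc[OF z jn] by auto
  have S: "\<Sum>(up_tails (Suc j) z) = \<Sum>(up_tails j z) + (if Suc j < z (Suc j) then Suc j else 0)
      - (if inv z (Suc j) < Suc j then inv z (Suc j) else 0)"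
    using sum_up_tails_Suc[OF z jn, of "\<lambda>u. u"] by auto
  let ?c = "count_up_tails p r c u"
  have "runs W ?c s (max_time ?c) (\<lambda>s'. s' = s\<lparr>reg := (reg s)(c := card (up_tails i z), u := \<Sum>(up_tails i z))\<rparr>)"
  proof (rule runs_loop_free)
    show "loop_free ?c" by (simp add: count_up_tails_def)
    show "safe W ?c s"
      using s names c2 S2 W jn unfolding j
      by (simp add: count_up_tails_def; intro conjI impI; linarith)
    have [simp]: "f(c := reg s c, u := reg s u) = f" if "f = reg s" for f using that by auto
    show "result ?c s = s\<lparr>reg := (reg s)(c := card (up_tails i z), u := \<Sum>(up_tails i z))\<rparr>"
      using s names by (auto simp: count_up_tails_def j c S fun_eq_iff intro!: store.equality)
  qed
  then show ?thesis by (rule runs_mono) (auto simp: count_up_tails_def)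
qed

abbreviation (input) "vi \<equiv> Var ''i''"
abbreviation (input) "vi1 \<equiv> Add (Var ''i'') (Lit 1)"

text \<open>The test against \<open>n\<close> is needed at the last city: the entry at
  \<open>n + 1\<close> is read all the same, but its value is then irrelevant.\<close>

definition step_back_guard :: "string \<Rightarrow> string \<Rightarrow> bexp" where
  "step_back_guard q t = BAnd (Lt vi (Var ''n'')) (BAnd (Eql (Elem q vi1) vi)
     (BAnd (Lt vi1 (Elem q vi)) (Lt (Elem t vi1) vi)))"

definition pass_body :: "string \<Rightarrow> string \<Rightarrow> string \<Rightarrow> string \<Rightarrow> string \<Rightarrow> com" where
  "pass_body p q r t w = seqs [count_up_tails p r ''ca'' ''sa'', count_up_tails q t ''cb'' ''sb'',
     emit w (Eql (Lit 0) (Lit 0)) vi (Elem t (Elem p vi)),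
     emit w (BAnd (Eql (Var ''ca'') (Lit 1)) (Eql (Var ''cb'') (Lit 1))) (Var ''sa'') (Var ''sb''),
     emit w (BAnd (step_back_guard q t)
         (BAnd (Lt (Elem p vi) (Add vi (Lit 2))) (BNot (Eql (Elem p vi1) vi)))) vi vi1,
     emit w (BAnd (step_back_guard q t)
         (BAnd (Lt (Elem p vi) vi) (BNot (Eql (Elem p (Var ''sa'')) vi1)))) (Elem t vi1) (Var ''sa''),
     emit w (BAnd (step_back_guard q t)
         (BAnd (Lt (Elem p vi) vi) (BNot (Eql (Elem p (Var ''sa'')) vi1)))) vi (Var ''sa'')]"

lemma runs_pass_body:
  assumes vx: "valid n x" and vy: "valid n y" and i: "i \<in> {1..n}" and W: "5 * n \<le> W"
    and k: "reg s ''k'' + 5 < W" and m: "\<And>j. j \<in> {1..n} \<Longrightarrow> m j \<in> {1..n}"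
    and regs: "reg s ''i'' = i" "reg s ''n'' = n"
      "reg s ''ca'' = card (up_tails (i - 1) x)" "reg s ''sa'' = \<Sum>(up_tails (i - 1) x)"
      "reg s ''cb'' = card (up_tails (i - 1) y)" "reg s ''sb'' = \<Sum>(up_tails (i - 1) y)"
    and arrs: "\<And>j. j \<in> {1..n} \<Longrightarrow> arr s p j = x j \<and> arr s q j = y j \<and> arr s r j = inv x j \<and>
      arr s t j = inv y j \<and> arr s w j = m j"
    and names: "\<And>A. A \<in> {p, q, r, t, w} \<Longrightarrow> A \<noteq> ''EU'' \<and> A \<noteq> ''EV''"
  shows "runs W (pass_body p q r t w) s 500
    (\<lambda>s'. reg s' ''i'' = i \<and> reg s' ''n'' = n \<and> reg s' ''k'' \<le> reg s ''k'' + 5 \<and>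
      reg s' ''ca'' = card (up_tails i x) \<and> reg s' ''sa'' = \<Sum>(up_tails i x) \<and>
      reg s' ''cb'' = card (up_tails i y) \<and> reg s' ''sb'' = \<Sum>(up_tails i y) \<and>
      (\<forall>A. A \<noteq> ''EU'' \<longrightarrow> A \<noteq> ''EV'' \<longrightarrow> arr s' A = arr s A) \<and>
      edge_set s' = edge_set s \<union> map_prod m m ` edges x y i)"
proof -
  have x: "derangement n x" and y: "derangement n y" using vx vy by (auto simp: valid_def)
  define s0 where "s0 = s\<lparr>reg := (reg s)(''ca'' := card (up_tails i x), ''sa'' := \<Sum>(up_tails i x),
    ''cb'' := card (up_tails i y), ''sb'' := \<Sum>(up_tails i y))\<rparr>"
  have s0: "reg s0 ''i'' = i" "reg s0 ''n'' = n" "reg s0 ''ca'' = card (up_tails i x)"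
    "reg s0 ''sa'' = \<Sum>(up_tails i x)" "reg s0 ''cb'' = card (up_tails i y)" "reg s0 ''sb'' = \<Sum>(up_tails i y)"
    "reg s0 ''k'' = reg s ''k''" "edge_set s0 = edge_set s" "arr s0 = arr s"
    by (simp_all add: s0_def regs edge_set_def)
  have arrs': "arr s p j = x j" "arr s q j = y j" "arr s r j = inv x j" "arr s t j = inv y j"
    "arr s w j = m j" if "j \<in> {1..n}" for j
    using arrs[OF that] by simp_all
  have xi: "x i \<in> {1..n}" using derangement_mem[OF x, of i] i by simp
  have sb: "up_step_back y i \<longleftrightarrow> bval (step_back_guard q t) s0"
  proof (cases "i < n")
    case True
    then show ?thesis using i by (auto simp: step_back_guard_def up_step_back_def s0 arrs')
  next
    case False
    then have "\<not> up_step_back y i" using up_step_back_less[OF y i] by auto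
    then show ?thesis using False by (simp add: step_back_guard_def s0)
  qed
  have down: "\<Sum>(up_tails i x) \<in> {1..n}" if "up_step_back y i" "x i < i"
  proof -
    have "i \<in> {1..<n}" using up_step_back_less[OF y i that(1)] i by simp
    from single_up_if_down[OF vx this that(2)] obtain p where "up_tails i x = {p}" "1 \<le> p" "p < i" by blast
    then show ?thesis using i by simp
  qed
  have Si: "Suc i \<in> {1..n}" if "up_step_back y i" using up_step_back_less[OF y i that] by simp
  let ?m = "map_prod m m"
  \<comment> \<open>One set per emission. The last kind of edges is split into \<open>E4\<close> and
    \<open>E5\<close> because an emission appends a single pair.\<close>
  define E1 where "E1 = {(i, inv y (x i))}"
  define E2 where "E2 = (if card (up_tails i x) = 1 \<and> card (up_tails i y) = 1 then {(\<Sum>(up_tails i x), \<Sum>(up_tails i y))} else {})"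
  define E3 where "E3 = (if up_step_back y i \<and> x i \<le> Suc i \<and> x (Suc i) \<noteq> i then {(i, Suc i)} else {})"
  define E4 where "E4 = (if up_step_back y i \<and> x i < i \<and> x (\<Sum>(up_tails i x)) \<noteq> Suc i then {(inv y (Suc i), \<Sum>(up_tails i x))} else {})"
  define E5 where "E5 = (if up_step_back y i \<and> x i < i \<and> x (\<Sum>(up_tails i x)) \<noteq> Suc i then {(i, \<Sum>(up_tails i x))} else {})"
  have E: "edges x y i = E1 \<union> E2 \<union> E3 \<union> E4 \<union> E5"
    by (auto simp: edges_def E1_def E2_def E3_def E4_def E5_def)
  have mem: "u \<in> {1..n}" "v \<in> {1..n}" if "(u, v) \<in> E1 \<union> E2 \<union> E3 \<union> E4 \<union> E5" for u v
    using edges_mem[OF vx vy i, of u v] that E by auto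
  have mW: "m j \<le> W" if "j \<in> {1..n}" for j using m[OF that] W by auto
  \<comment> \<open>The invariant after \<open>h\<close> emissions. All guards are evaluated
    relative to the fixed state \<open>s0\<close> that follows the updates of counts and
    sums.\<close>
  define P where "P h X s' \<longleftrightarrow> same s0 s' \<and> reg s' ''k'' \<le> reg s ''k'' + h \<and> edge_set s' = edge_set s \<union> ?m ` X"
    for h X s'
  have emit: "runs W (emit w b u v) s1 (20 + bcost b + acost u + acost v) (P (Suc h) (X \<union> F))"
    if P: "P h X s1" and ind: "bindep b" "aindep u" "aindep v" and h: "h < 5"
      and F: "F = (if bval b s0 then {(aval u s0, aval v s0)} else {})"
      and F': "F \<subseteq> {1..n} \<times> {1..n}"
    for b u v s1 h X F
  proof -
    have A: "bval b s0 \<Longrightarrow> aval u s0 \<in> {1..n} \<and> aval v s0 \<in> {1..n}" using F F' by auto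
    have "runs W (emit w b u v) s1 (20 + bcost b + acost u + acost v)
      (\<lambda>s'. same s0 s' \<and> reg s' ''k'' \<le> Suc (reg s1 ''k'') \<and>
        edge_set s' = edge_set s1 \<union> (if bval b s0 then {(arr s0 w (aval u s0), arr s0 w (aval v s0))} else {}))"
      by (rule runs_emit) (use P ind h k names A mW arrs' s0 in \<open>auto simp: P_def\<close>)
    then show ?thesis
    proof (rule runs_mono)
      fix s'
      assume s': "same s0 s' \<and> reg s' ''k'' \<le> Suc (reg s1 ''k'') \<and>
        edge_set s' = edge_set s1 \<union> (if bval b s0 then {(arr s0 w (aval u s0), arr s0 w (aval v s0))} else {})"
      have "(if bval b s0 then {(arr s0 w (aval u s0), arr s0 w (aval v s0))} else {}) = ?m ` F"
        using A arrs' s0 by (auto simp: F)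
      then show "P (Suc h) (X \<union> F) s'" using s' P by (auto simp: P_def)
    qed simp
  qed
  have nm: "p \<noteq> ''EU''" "q \<noteq> ''EU''" "t \<noteq> ''EU''" "p \<noteq> ''EV''" "q \<noteq> ''EV''" "t \<noteq> ''EV''"
    using names by auto
  have sub: "E1 \<subseteq> {1..n} \<times> {1..n}" "E2 \<subseteq> {1..n} \<times> {1..n}" "E3 \<subseteq> {1..n} \<times> {1..n}"
    "E4 \<subseteq> {1..n} \<times> {1..n}" "E5 \<subseteq> {1..n} \<times> {1..n}"
  proof -
    have "E1 \<union> E2 \<union> E3 \<union> E4 \<union> E5 \<subseteq> {1..n} \<times> {1..n}"
      by (rule subrelI) (use mem in blast)
    then show "E1 \<subseteq> {1..n} \<times> {1..n}" "E2 \<subseteq> {1..n} \<times> {1..n}" "E3 \<subseteq> {1..n} \<times> {1..n}"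
      "E4 \<subseteq> {1..n} \<times> {1..n}" "E5 \<subseteq> {1..n} \<times> {1..n}"
      by simp_all
  qed
  let ?sb = "step_back_guard q t"
  let ?b3 = "BAnd ?sb (BAnd (Lt (Elem p vi) (Add vi (Lit 2))) (BNot (Eql (Elem p vi1) vi)))"
  let ?b4 = "BAnd ?sb (BAnd (Lt (Elem p vi) vi) (BNot (Eql (Elem p (Var ''sa'')) vi1)))"
  have F1: "E1 = (if bval (Eql (Lit 0) (Lit 0)) s0 then {(aval vi s0, aval (Elem t (Elem p vi)) s0)} else {})"
    using i xi by (simp add: E1_def s0 arrs')
  have F2: "E2 = (if bval (BAnd (Eql (Var ''ca'') (Lit 1)) (Eql (Var ''cb'') (Lit 1))) s0
      then {(aval (Var ''sa'') s0, aval (Var ''sb'') s0)} else {})"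
    by (simp add: E2_def s0)
  have F3: "E3 = (if bval ?b3 s0 then {(aval vi s0, aval vi1 s0)} else {})"
    using i Si arrs' by (cases "up_step_back y i") (auto simp: E3_def sb[symmetric] s0)
  have F4: "E4 = (if bval ?b4 s0 then {(aval (Elem t vi1) s0, aval (Var ''sa'') s0)} else {})"
    using i Si arrs' down by (cases "up_step_back y i \<and> x i < i") (auto simp: E4_def sb[symmetric] s0)
  have F5: "E5 = (if bval ?b4 s0 then {(aval vi s0, aval (Var ''sa'') s0)} else {})"
    using i Si arrs' down by (cases "up_step_back y i \<and> x i < i") (auto simp: E5_def sb[symmetric] s0)
  have ind: "bindep ?b3" "bindep ?b4" using nm by (simp_all add: step_back_guard_def)
  have "runs W (seqs [count_up_tails p r ''ca'' ''sa'', count_up_tails q t ''cb'' ''sb'',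
     emit w (Eql (Lit 0) (Lit 0)) vi (Elem t (Elem p vi)),
     emit w (BAnd (Eql (Var ''ca'') (Lit 1)) (Eql (Var ''cb'') (Lit 1))) (Var ''sa'') (Var ''sb''),
     emit w ?b3 vi vi1, emit w ?b4 (Elem t vi1) (Var ''sa''), emit w ?b4 vi (Var ''sa'')]) s
     (40 + (40 + (29 + (31 + (70 + (70 + (70 + 1))))))) (P 5 (E1 \<union> E2 \<union> E3 \<union> E4 \<union> E5))"
    unfolding seqs.simps
  proof (rule runs_Seq)
    show "runs W (count_up_tails p r ''ca'' ''sa'') s 40
      (\<lambda>s'. s' = s\<lparr>reg := (reg s)(''ca'' := card (up_tails i x), ''sa'' := \<Sum>(up_tails i x))\<rparr>)"
      by (rule runs_count_up_tails[OF vx i W]) (use i in \<open>simp_all add: regs arrs'\<close>)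
  next
    fix s1 assume s1: "s1 = s\<lparr>reg := (reg s)(''ca'' := card (up_tails i x), ''sa'' := \<Sum>(up_tails i x))\<rparr>"
    show "runs W (Seq (count_up_tails q t ''cb'' ''sb'')
      (Seq (emit w (Eql (Lit 0) (Lit 0)) vi (Elem t (Elem p vi)))
      (Seq (emit w (BAnd (Eql (Var ''ca'') (Lit 1)) (Eql (Var ''cb'') (Lit 1))) (Var ''sa'') (Var ''sb''))
      (Seq (emit w ?b3 vi vi1) (Seq (emit w ?b4 (Elem t vi1) (Var ''sa''))
      (Seq (emit w ?b4 vi (Var ''sa'')) Skip)))))) s1
      (40 + (29 + (31 + (70 + (70 + (70 + 1)))))) (P 5 (E1 \<union> E2 \<union> E3 \<union> E4 \<union> E5))"
    proof (rule runs_Seq)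
      show "runs W (count_up_tails q t ''cb'' ''sb'') s1 40 (P 0 {})"
      proof (rule runs_mono)
        show "runs W (count_up_tails q t ''cb'' ''sb'') s1 40
          (\<lambda>s'. s' = s1\<lparr>reg := (reg s1)(''cb'' := card (up_tails i y), ''sb'' := \<Sum>(up_tails i y))\<rparr>)"
          by (rule runs_count_up_tails[OF vy i W]) (use i in \<open>simp_all add: regs arrs' s1\<close>)
        fix s' assume "s' = s1\<lparr>reg := (reg s1)(''cb'' := card (up_tails i y), ''sb'' := \<Sum>(up_tails i y))\<rparr>"
        then have "s' = s0" by (simp add: s1 s0_def)
        then show "P 0 {} s'" by (simp add: P_def same_def s0)
      qed simp
    next
      fix s2 assume s2: "P 0 {} s2"
      show "runs W (Seq (emit w (Eql (Lit 0) (Lit 0)) vi (Elem t (Elem p vi)))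
        (Seq (emit w (BAnd (Eql (Var ''ca'') (Lit 1)) (Eql (Var ''cb'') (Lit 1))) (Var ''sa'') (Var ''sb''))
        (Seq (emit w ?b3 vi vi1) (Seq (emit w ?b4 (Elem t vi1) (Var ''sa''))
        (Seq (emit w ?b4 vi (Var ''sa'')) Skip))))) s2
        (29 + (31 + (70 + (70 + (70 + 1))))) (P 5 (E1 \<union> E2 \<union> E3 \<union> E4 \<union> E5))"
      proof (intro runs_Seq)
        show "runs W (emit w (Eql (Lit 0) (Lit 0)) vi (Elem t (Elem p vi))) s2 29 (P (Suc 0) ({} \<union> E1))"
          by (rule runs_mono[OF emit[OF s2 _ _ _ _ F1 sub(1)]]) (use nm in simp_all)
        show "runs W (emit w (BAnd (Eql (Var ''ca'') (Lit 1)) (Eql (Var ''cb'') (Lit 1))) (Var ''sa'') (Var ''sb''))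
            s 31 (P (Suc (Suc 0)) ({} \<union> E1 \<union> E2))" if "P (Suc 0) ({} \<union> E1) s" for s
          by (rule runs_mono[OF emit[OF that _ _ _ _ F2 sub(2)]]) (use nm in simp_all)
        show "runs W (emit w ?b3 vi vi1) s 70 (P (Suc (Suc (Suc 0))) ({} \<union> E1 \<union> E2 \<union> E3))"
          if "P (Suc (Suc 0)) ({} \<union> E1 \<union> E2) s" for s
          by (rule runs_mono[OF emit[OF that ind(1) _ _ _ F3 sub(3)]])
            (simp_all add: step_back_guard_def)
        show "runs W (emit w ?b4 (Elem t vi1) (Var ''sa'')) s 70 (P (Suc (Suc (Suc (Suc 0)))) ({} \<union> E1 \<union> E2 \<union> E3 \<union> E4))"
          if "P (Suc (Suc (Suc 0))) ({} \<union> E1 \<union> E2 \<union> E3) s" for s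
          by (rule runs_mono[OF emit[OF that ind(2) _ _ _ F4 sub(4)]])
            (use nm in \<open>simp_all add: step_back_guard_def\<close>)
        show "runs W (emit w ?b4 vi (Var ''sa'')) s 70 (P 5 (E1 \<union> E2 \<union> E3 \<union> E4 \<union> E5))"
          if "P (Suc (Suc (Suc (Suc 0)))) ({} \<union> E1 \<union> E2 \<union> E3 \<union> E4) s" for s
          by (rule runs_mono[OF emit[OF that ind(2) _ _ _ F5 sub(5)]])
            (simp_all add: step_back_guard_def eval_nat_numeral)
        show "runs W Skip s 1 (P 5 (E1 \<union> E2 \<union> E3 \<union> E4 \<union> E5))"
          if "P 5 (E1 \<union> E2 \<union> E3 \<union> E4 \<union> E5) s" for s
          using that exec.Skip[of W s] unfolding runs_def by blast
      qed
    qed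
  qed
  then show ?thesis
    unfolding pass_body_def
    by (rule runs_mono) (auto simp: P_def same_def s0 E regs)
qed

definition pass :: "string \<Rightarrow> string \<Rightarrow> string \<Rightarrow> string \<Rightarrow> string \<Rightarrow> com" where
  "pass p q r t w = Seq (seqs [Assign ''ca'' (Lit 0), Assign ''sa'' (Lit 0), Assign ''cb'' (Lit 0),
     Assign ''sb'' (Lit 0)]) (for_each (pass_body p q r t w))"

lemma runs_pass:
  assumes vx: "valid n x" and vy: "valid n y" and W: "5 * n \<le> W" "1 < W"
    and k: "reg s0 ''k'' + 5 * n < W" and m: "\<And>j. j \<in> {1..n} \<Longrightarrow> m j \<in> {1..n}"
    and n: "reg s0 ''n'' = n"
    and arrs: "\<And>j. j \<in> {1..n} \<Longrightarrow> arr s0 p j = x j \<and> arr s0 q j = y j \<and> arr s0 r j = inv x j \<and>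
      arr s0 t j = inv y j \<and> arr s0 w j = m j"
    and names: "\<And>A. A \<in> {p, q, r, t, w} \<Longrightarrow> A \<noteq> ''EU'' \<and> A \<noteq> ''EV''"
  shows "runs W (pass p q r t w) s0 ((n + 1) * 520)
    (\<lambda>s'. reg s' ''n'' = n \<and> reg s' ''k'' \<le> reg s0 ''k'' + 5 * n \<and>
      (\<forall>A. A \<noteq> ''EU'' \<longrightarrow> A \<noteq> ''EV'' \<longrightarrow> arr s' A = arr s0 A) \<and>
      edge_set s' = edge_set s0 \<union> (\<Union>i\<in>{1..n}. map_prod m m ` edges x y i))"
proof -
  \<comment> \<open>Before round \<open>i\<close> the registers describe the cut
    \<open>i - 1\<close>. Nothing crosses the cut 0, hence the initial zeros.\<close>
  define J where "J i s \<longleftrightarrow> reg s ''i'' = i \<and> reg s ''n'' = n \<and> reg s ''k'' \<le> reg s0 ''k'' + 5 * (i - 1) \<and>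
    reg s ''ca'' = card (up_tails (i - 1) x) \<and> reg s ''sa'' = \<Sum>(up_tails (i - 1) x) \<and>
    reg s ''cb'' = card (up_tails (i - 1) y) \<and> reg s ''sb'' = \<Sum>(up_tails (i - 1) y) \<and>
    (\<forall>A. A \<noteq> ''EU'' \<longrightarrow> A \<noteq> ''EV'' \<longrightarrow> arr s A = arr s0 A) \<and>
    edge_set s = edge_set s0 \<union> (\<Union>j\<in>{1..<i}. map_prod m m ` edges x y j)" for i s
  let ?init = "seqs [Assign ''ca'' (Lit 0), Assign ''sa'' (Lit 0), Assign ''cb'' (Lit 0), Assign ''sb'' (Lit 0)]"
  have "runs W ?init s0 (max_time ?init) (\<lambda>s. J 1 (s\<lparr>reg := (reg s)(''i'' := 1)\<rparr>))"
    by (rule runs_loop_free) (auto simp: J_def n edge_set_def)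
  moreover have "runs W (for_each (pass_body p q r t w)) s ((n + 1) * (500 + 10)) (J (Suc n))"
    if "J 1 (s\<lparr>reg := (reg s)(''i'' := 1)\<rparr>)" for s
  proof (rule runs_for_each[where J = J])
    show "n + 1 \<le> W" using W by linarith
    show "J 1 (s\<lparr>reg := (reg s)(''i'' := 1)\<rparr>)" by (rule that)
    show "\<And>i s. J i s \<Longrightarrow> reg s ''i'' = i \<and> reg s ''n'' = n" by (simp add: J_def)
    fix i s assume J: "J i s" and i: "i \<in> {1..n}"
    have "5 * (i - 1) + 5 \<le> 5 * n" using i by auto
    then have k': "reg s ''k'' + 5 < W" using J k by (simp add: J_def)
    have arrs': "arr s p j = x j \<and> arr s q j = y j \<and> arr s r j = inv x j \<and>
      arr s t j = inv y j \<and> arr s w j = m j" if "j \<in> {1..n}" for j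
      using arrs[OF that] J names by (simp add: J_def)
    have "runs W (pass_body p q r t w) s 500
      (\<lambda>s'. reg s' ''i'' = i \<and> reg s' ''n'' = n \<and> reg s' ''k'' \<le> reg s ''k'' + 5 \<and>
      reg s' ''ca'' = card (up_tails i x) \<and> reg s' ''sa'' = \<Sum>(up_tails i x) \<and>
      reg s' ''cb'' = card (up_tails i y) \<and> reg s' ''sb'' = \<Sum>(up_tails i y) \<and>
      (\<forall>A. A \<noteq> ''EU'' \<longrightarrow> A \<noteq> ''EV'' \<longrightarrow> arr s' A = arr s A) \<and>
      edge_set s' = edge_set s \<union> map_prod m m ` edges x y i)"
      by (rule runs_pass_body[OF vx vy i W(1) k' m _ _ _ _ _ _ arrs' names]) (use J in \<open>simp_all add: J_def\<close>)
    then show "runs W (pass_body p q r t w) s 500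
      (\<lambda>s'. reg s' ''i'' = i \<and> J (Suc i) (s'\<lparr>reg := (reg s')(''i'' := Suc i)\<rparr>))"
    proof (rule runs_mono)
      fix s' assume s': "reg s' ''i'' = i \<and> reg s' ''n'' = n \<and> reg s' ''k'' \<le> reg s ''k'' + 5 \<and>
        reg s' ''ca'' = card (up_tails i x) \<and> reg s' ''sa'' = \<Sum>(up_tails i x) \<and>
        reg s' ''cb'' = card (up_tails i y) \<and> reg s' ''sb'' = \<Sum>(up_tails i y) \<and>
        (\<forall>A. A \<noteq> ''EU'' \<longrightarrow> A \<noteq> ''EV'' \<longrightarrow> arr s' A = arr s A) \<and>
        edge_set s' = edge_set s \<union> map_prod m m ` edges x y i"
      have "{1..<Suc i} = insert i {1..<i}" using i by auto
      then have U: "(\<Union>j\<in>{1..<Suc i}. map_prod m m ` edges x y j)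
          = (\<Union>j\<in>{1..<i}. map_prod m m ` edges x y j) \<union> map_prod m m ` edges x y i" by auto
      have e: "edge_set (s'\<lparr>reg := (reg s')(''i'' := Suc i)\<rparr>) = edge_set s'" by (simp add: edge_set_def)
      have "edge_set s' = edge_set s0 \<union> (\<Union>j\<in>{1..<Suc i}. map_prod m m ` edges x y j)"
        unfolding U using s' J by (simp add: J_def Un_assoc)
      moreover have "reg s' ''k'' \<le> reg s0 ''k'' + 5 * i"
      proof -
        have "reg s' ''k'' \<le> reg s ''k'' + 5" "reg s ''k'' \<le> reg s0 ''k'' + 5 * (i - 1)"
          using s' J by (simp_all add: J_def)
        moreover have "5 * (i - 1) + 5 = 5 * i" using i by auto
        ultimately show ?thesis by linarith
      qed
      ultimately show "reg s' ''i'' = i \<and> J (Suc i) (s'\<lparr>reg := (reg s')(''i'' := Suc i)\<rparr>)"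
        using s' J unfolding J_def e by simp
    qed simp
  qed
  ultimately have "runs W (pass p q r t w) s0 (max_time ?init + (n + 1) * (500 + 10)) (J (Suc n))"
    unfolding pass_def by (rule runs_Seq)
  then show ?thesis
    by (rule runs_mono) (auto simp: J_def atLeastLessThanSuc_atLeastAtMost)
qed

text \<open>Writing \<open>i\<close> at position \<open>x i\<close> inverts the permutation. The
  identity in \<open>L1\<close> and \<open>L2\<close> represents chains without edges.\<close>

definition init_body :: com where
  "init_body = seqs [Store ''c'' (Elem ''a'' vi) vi, Store ''d'' (Elem ''b'' vi) vi, Store ''e'' vi vi,
     Store ''L1'' vi vi, Store ''L2'' vi vi]"

definition loaded :: "nat \<Rightarrow> (nat \<Rightarrow> nat) \<Rightarrow> (nat \<Rightarrow> nat) \<Rightarrow> store \<Rightarrow> bool" where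
  "loaded n x y s \<longleftrightarrow> reg s ''n'' = n \<and> (\<forall>j\<in>{1..n}. arr s ''a'' j = x j \<and> arr s ''b'' j = y j) \<and>
     (\<forall>A\<in>{''P1'', ''N1'', ''P2'', ''N2'', ''mk''}. arr s A = (\<lambda>_. 0))"

definition prepared :: "nat \<Rightarrow> (nat \<Rightarrow> nat) \<Rightarrow> (nat \<Rightarrow> nat) \<Rightarrow> store \<Rightarrow> bool" where
  "prepared n x y s \<longleftrightarrow> loaded n x y s \<and> (\<forall>j\<in>{1..n}. arr s ''c'' j = inv x j \<and> arr s ''d'' j = inv y j \<and>
     arr s ''e'' j = j \<and> arr s ''L1'' j = j \<and> arr s ''L2'' j = j)"

lemma runs_init:
  assumes x: "derangement n x" and y: "derangement n y" and W: "n + 1 \<le> W" and s: "loaded n x y s"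
  shows "runs W (for_each init_body) s ((n + 1) * 40) (prepared n x y)"
proof -
  define J where "J i s \<longleftrightarrow> reg s ''i'' = i \<and> loaded n x y s \<and>
    (\<forall>j\<in>{1..<i}. arr s ''c'' (x j) = j \<and> arr s ''d'' (y j) = j \<and>
     arr s ''e'' j = j \<and> arr s ''L1'' j = j \<and> arr s ''L2'' j = j)" for i s
  have "runs W (for_each init_body) s ((n + 1) * (max_time init_body + 10)) (J (Suc n))"
  proof (rule runs_for_each[where J = J, OF W])
    show "J 1 (s\<lparr>reg := (reg s)(''i'' := 1)\<rparr>)" using s by (simp add: J_def loaded_def)
    show "\<And>i s. J i s \<Longrightarrow> reg s ''i'' = i \<and> reg s ''n'' = n" by (simp add: J_def loaded_def)
    fix i s assume J: "J i s" and i: "i \<in> {1..n}"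
    have ab: "arr s ''a'' i = x i" "arr s ''b'' i = y i" using J i by (auto simp: J_def loaded_def)
    have mem: "x i \<le> n" "y i \<le> n" using derangement_mem[OF x, of i] derangement_mem[OF y, of i] i by auto
    have inj: "x j = x i \<longleftrightarrow> j = i" "y j = y i \<longleftrightarrow> j = i" for j
      using derangement_inj[OF x] derangement_inj[OF y] by auto
    show "runs W init_body s (max_time init_body)
        (\<lambda>s'. reg s' ''i'' = i \<and> J (Suc i) (s'\<lparr>reg := (reg s')(''i'' := Suc i)\<rparr>))"
    proof (rule runs_loop_free)
      show "safe W init_body s" using J i W mem by (simp add: init_body_def J_def ab)
      show "reg (result init_body s) ''i'' = i \<and>
        J (Suc i) (result init_body s\<lparr>reg := (reg (result init_body s))(''i'' := Suc i)\<rparr>)"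
        using J i by (auto simp: init_body_def J_def loaded_def ab inj less_Suc_eq)
    qed (simp add: init_body_def)
  qed
  then show ?thesis
  proof (rule runs_mono)
    fix s' assume J: "J (Suc n) s'"
    have "arr s' ''c'' j = inv x j \<and> arr s' ''d'' j = inv y j" if j: "j \<in> {1..n}" for j
    proof -
      have "inv x j \<in> {1..<Suc n}" "inv y j \<in> {1..<Suc n}"
        using derangement_mem[OF derangement_inv[OF x], of j] derangement_mem[OF derangement_inv[OF y], of j] j
        by auto
      moreover have "x (inv x j) = j" "y (inv y j) = j"
        using derangement_eq_iff[OF x] derangement_eq_iff[OF y] by blast+
      ultimately show ?thesis using J unfolding J_def by metis
    qed
    then show "prepared n x y s'" using J by (auto simp: J_def prepared_def)
  qed (simp add: init_body_def)
qed

definition edge_graph :: "nat \<Rightarrow> (nat \<Rightarrow> nat) \<Rightarrow> (nat \<Rightarrow> nat) \<Rightarrow> (nat \<times> nat) set" where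
  "edge_graph n x y = (\<Union>i\<in>{1..n}. edges x y i) \<union> (\<Union>i\<in>{1..n}. edges y x i)
     \<union> (\<Union>i\<in>{1..n}. map_prod (inv x) (inv x) ` edges (inv x) (inv y) i)
     \<union> (\<Union>i\<in>{1..n}. map_prod (inv x) (inv x) ` edges (inv y) (inv x) i)"

lemma consistent_iff_edge_graph: "consistent n x y l \<longleftrightarrow> (\<forall>(u, v)\<in>edge_graph n x y. l u = l v)"
  by (simp add: consistent_def compatible_def edge_graph_def ball_Un case_prod_beta)

lemma edge_graph_mem:
  assumes vx: "valid n x" and vy: "valid n y" and e: "(u, v) \<in> edge_graph n x y"
  shows "u \<in> {1..n}" "v \<in> {1..n}"
proof -
  have ix: "inv x j \<in> {1..n}" if "j \<in> {1..n}" for j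
    using derangement_mem[OF derangement_inv, of n x j] vx that by (simp add: valid_def)
  have mem: "\<forall>i\<in>{1..n}. \<forall>e\<in>edges x' y' i. fst e \<in> {1..n} \<and> snd e \<in> {1..n}"
    if "valid n x'" "valid n y'" for x' y'
    using edges_mem[OF that] by (metis prod.collapse)
  have "\<forall>e\<in>edge_graph n x y. fst e \<in> {1..n} \<and> snd e \<in> {1..n}"
    unfolding edge_graph_def ball_Un ball_UN
    using mem[OF vx vy] mem[OF vy vx] mem[OF valid_inv[OF vx] valid_inv[OF vy]]
      mem[OF valid_inv[OF vy] valid_inv[OF vx]] ix
    by (simp del: atLeastAtMost_iff)
  then have "u \<in> {1..n} \<and> v \<in> {1..n}" using e by fastforce
  then show "u \<in> {1..n}" "v \<in> {1..n}" by auto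
qed

text \<open>For the reversed tours each array changes places with that of its inverse. Both reversed
  passes translate heads by \<open>c\<close>, that is, to tails in \<open>x\<close>, as
  \<open>consistent\<close> prescribes.\<close>

definition list_edges :: com where
  "list_edges = seqs [Assign ''k'' (Lit 0), pass ''a'' ''b'' ''c'' ''d'' ''e'', pass ''b'' ''a'' ''d'' ''c'' ''e'',
     pass ''c'' ''d'' ''a'' ''b'' ''c'', pass ''d'' ''c'' ''b'' ''a'' ''c'']"

lemma runs_list_edges:
  assumes vx: "valid n x" and vy: "valid n y" and W: "20 * n < W" "1 < W" and s0: "prepared n x y s0"
  shows "runs W list_edges s0 ((n + 1) * 2100)
    (\<lambda>s. prepared n x y s \<and> reg s ''k'' \<le> 20 * n \<and> edge_set s = edge_graph n x y)"
proof -
  have x: "derangement n x" and y: "derangement n y" using vx vy by (auto simp: valid_def)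
  have ix: "inv x j \<in> {1..n}" if "j \<in> {1..n}" for j
    using derangement_mem[OF derangement_inv[OF x], of j] that by simp
  have W5: "5 * n \<le> W" using W by simp
  define I where "I h X s \<longleftrightarrow> prepared n x y s \<and> reg s ''k'' \<le> 5 * h * n \<and> edge_set s = X" for h X s
  have step: "runs W (pass p q r t w) s ((n + 1) * 520) (I (Suc h) (X \<union> (\<Union>i\<in>{1..n}. map_prod m m ` edges x' y' i)))"
    if I: "I h X s" and h: "h < 4" and v: "valid n x'" "valid n y'" and m: "\<And>j. j \<in> {1..n} \<Longrightarrow> m j \<in> {1..n}"
      and arrs: "\<And>j. j \<in> {1..n} \<Longrightarrow> arr s p j = x' j \<and> arr s q j = y' j \<and> arr s r j = inv x' j \<and>
      arr s t j = inv y' j \<and> arr s w j = m j"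
      and names: "\<And>A. A \<in> {p, q, r, t, w} \<Longrightarrow> A \<noteq> ''EU'' \<and> A \<noteq> ''EV''"
    for p q r t w s h X m x' y'
  proof -
    have b: "5 * h * n + 5 * n \<le> 20 * n"
    proof -
      have "(5 * h + 5) * n \<le> 20 * n" using h by (intro mult_right_mono) auto
      then show ?thesis by (simp add: algebra_simps)
    qed
    have "reg s ''k'' \<le> 5 * h * n" using I by (simp add: I_def)
    then have k: "reg s ''k'' + 5 * n < W" using b W by linarith
    have "reg s ''n'' = n" using I by (simp add: I_def prepared_def loaded_def)
    from runs_pass[OF v W5 W(2) k m this arrs names] show ?thesis
      by (rule runs_mono) (use I in \<open>auto simp: I_def prepared_def loaded_def algebra_simps\<close>)
  qed
  have arrs: "arr s ''a'' j = x j" "arr s ''b'' j = y j" "arr s ''c'' j = inv x j" "arr s ''d'' j = inv y j"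
    "arr s ''e'' j = j" if "I h X s" "j \<in> {1..n}" for h X s j
    using that by (auto simp: I_def prepared_def loaded_def)
  let ?E = "\<lambda>m x y. \<Union>i\<in>{1..n}. map_prod m m ` edges x y i"
  let ?id = "\<lambda>j. j"
  have "runs W list_edges s0 (2 + ((n + 1) * 520 + ((n + 1) * 520 + ((n + 1) * 520 + ((n + 1) * 520 + 1)))))
    (I (Suc (Suc (Suc (Suc 0)))) ({} \<union> ?E ?id x y \<union> ?E ?id y x \<union> ?E (inv x) (inv x) (inv y) \<union> ?E (inv x) (inv y) (inv x)))"
    unfolding list_edges_def seqs.simps
  proof (intro runs_Seq)
    show "runs W (Assign ''k'' (Lit 0)) s0 2 (I 0 {})"
      by (rule runs_mono[OF runs_loop_free[where Q = "I 0 {}"]])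
        (use s0 in \<open>auto simp: I_def prepared_def loaded_def edge_set_def\<close>)
    show "runs W (pass ''a'' ''b'' ''c'' ''d'' ''e'') s ((n + 1) * 520) (I (Suc 0) ({} \<union> ?E ?id x y))"
      if "I 0 {} s" for s
      by (rule step[OF that _ vx vy]) (use arrs[OF that] in auto)
    show "runs W (pass ''b'' ''a'' ''d'' ''c'' ''e'') s ((n + 1) * 520)
        (I (Suc (Suc 0)) ({} \<union> ?E ?id x y \<union> ?E ?id y x))"
      if "I (Suc 0) ({} \<union> ?E ?id x y) s" for s
      by (rule step[OF that _ vy vx]) (use arrs[OF that] in auto)
    show "runs W (pass ''c'' ''d'' ''a'' ''b'' ''c'') s ((n + 1) * 520)
        (I (Suc (Suc (Suc 0))) ({} \<union> ?E ?id x y \<union> ?E ?id y x \<union> ?E (inv x) (inv x) (inv y)))"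
      if "I (Suc (Suc 0)) ({} \<union> ?E ?id x y \<union> ?E ?id y x) s" for s
      by (rule step[OF that _ valid_inv[OF vx] valid_inv[OF vy] ix])
        (unfold inv_inv[OF x] inv_inv[OF y], use arrs[OF that] in auto)
    show "runs W (pass ''d'' ''c'' ''b'' ''a'' ''c'') s ((n + 1) * 520)
        (I (Suc (Suc (Suc (Suc 0)))) ({} \<union> ?E ?id x y \<union> ?E ?id y x \<union> ?E (inv x) (inv x) (inv y) \<union> ?E (inv x) (inv y) (inv x)))"
      if "I (Suc (Suc (Suc 0))) ({} \<union> ?E ?id x y \<union> ?E ?id y x \<union> ?E (inv x) (inv x) (inv y)) s" for s
      by (rule step[OF that _ valid_inv[OF vy] valid_inv[OF vx] ix])
        (unfold inv_inv[OF x] inv_inv[OF y], use arrs[OF that] in auto)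
    show "runs W Skip s 1 Q" if "Q s" for Q s
      using that exec.Skip[of W s] unfolding runs_def by blast
  qed
  then show ?thesis
  proof (rule runs_mono)
    have id: "map_prod ?id ?id = (\<lambda>e. e)" by auto
    fix s assume "I (Suc (Suc (Suc (Suc 0)))) ({} \<union> ?E ?id x y \<union> ?E ?id y x \<union> ?E (inv x) (inv x) (inv y) \<union> ?E (inv x) (inv y) (inv x)) s"
    then show "prepared n x y s \<and> reg s ''k'' \<le> 20 * n \<and> edge_set s = edge_graph n x y"
      by (simp add: I_def edge_graph_def id)
  qed simp
qed

section \<open>Connectivity\<close>

definition link :: "string \<Rightarrow> string \<Rightarrow> string \<Rightarrow> string \<Rightarrow> com" where
  "link U P N L = seqs [Assign ''v'' (Elem U (Var ''j'')), Store P (Var ''q'') (Elem L (Var ''v'')),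
     Store N (Elem L (Var ''v'')) (Var ''q''), Store L (Var ''v'') (Var ''q'')]"

text \<open>After the increment \<open>q\<close> is the node \<open>n + 1 + j\<close> of edge
  \<open>j\<close>. The same node enters a chain of each end point, and this joins the two end
  points.\<close>

definition link_body :: com where
  "link_body = seqs [incr ''q'', link ''EU'' ''P1'' ''N1'' ''L1'', link ''EV'' ''P2'' ''N2'' ''L2'', incr ''j'']"

definition build_chains :: com where
  "build_chains = seqs [Assign ''j'' (Lit 0), Assign ''q'' (Var ''n''),
     While (Lt (Var ''j'') (Var ''k'')) link_body]"

definition chains_built :: "nat \<Rightarrow> nat \<Rightarrow> (nat \<Rightarrow> nat) \<Rightarrow> (nat \<Rightarrow> nat) \<Rightarrow> nat \<Rightarrow> store \<Rightarrow> bool" where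
  "chains_built n j U V k s \<longleftrightarrow> reg s ''n'' = n \<and> reg s ''k'' = k \<and>
     arr s ''EU'' = U \<and> arr s ''EV'' = V \<and>
     chain n U j (arr s ''P1'') (arr s ''N1'') (arr s ''L1'') \<and>
     chain n V j (arr s ''P2'') (arr s ''N2'') (arr s ''L2'')"

lemma runs_build_chains:
  assumes W: "n + m + 1 \<le> W" and n: "reg s0 ''n'' = n" and k: "reg s0 ''k'' = m"
    and U: "\<And>j. j < m \<Longrightarrow> arr s0 ''EU'' j \<in> {1..n}" and V: "\<And>j. j < m \<Longrightarrow> arr s0 ''EV'' j \<in> {1..n}"
    and zero: "\<forall>A\<in>{''P1'', ''N1'', ''P2'', ''N2''}. arr s0 A = (\<lambda>_. 0)"
    and L: "\<And>u. u \<in> {1..n} \<Longrightarrow> arr s0 ''L1'' u = u \<and> arr s0 ''L2'' u = u"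
  shows "runs W build_chains s0 (m * 60 + 20)
    (\<lambda>s. chains_built n m (arr s0 ''EU'') (arr s0 ''EV'') m s \<and>
      arr s ''a'' = arr s0 ''a'' \<and> arr s ''b'' = arr s0 ''b'' \<and> arr s ''mk'' = arr s0 ''mk'')"
proof -
  let ?U = "arr s0 ''EU''" and ?V = "arr s0 ''EV''"
  define I where "I r s \<longleftrightarrow> (\<exists>j. j \<le> m \<and> r = m - j \<and> reg s ''j'' = j \<and> reg s ''q'' = n + j \<and>
    chains_built n j ?U ?V m s \<and>
    arr s ''a'' = arr s0 ''a'' \<and> arr s ''b'' = arr s0 ''b'' \<and> arr s ''mk'' = arr s0 ''mk'')" for r s
  let ?b = "Lt (Var ''j'') (Var ''k'')"
  let ?Q = "\<lambda>s. chains_built n m (arr s0 ''EU'') (arr s0 ''EV'') m s \<and>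
      arr s ''a'' = arr s0 ''a'' \<and> arr s ''b'' = arr s0 ''b'' \<and> arr s ''mk'' = arr s0 ''mk''"
  have "runs W build_chains s0 (2 + (2 + ((m * (1 + bcost ?b + max_time link_body) + 1 + bcost ?b) + 1))) ?Q"
    unfolding build_chains_def seqs.simps
  proof (rule runs_Seq)
    show "runs W (Assign ''j'' (Lit 0)) s0 2 (\<lambda>s. s = s0\<lparr>reg := (reg s0)(''j'' := 0)\<rparr>)"
      by (rule runs_mono[OF runs_loop_free[where Q = "\<lambda>s. s = s0\<lparr>reg := (reg s0)(''j'' := 0)\<rparr>"]]) auto
    fix s1 assume s1: "s1 = s0\<lparr>reg := (reg s0)(''j'' := 0)\<rparr>"
    show "runs W (Seq (Assign ''q'' (Var ''n'')) (Seq (While ?b link_body) Skip)) s1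
      (2 + ((m * (1 + bcost ?b + max_time link_body) + 1 + bcost ?b) + 1)) ?Q"
    proof (rule runs_Seq)
      show "runs W (Assign ''q'' (Var ''n'')) s1 2 (I m)"
      proof (rule runs_mono[OF runs_loop_free[where Q = "I m"]])
        have "chain n ?U 0 (\<lambda>_. 0) (\<lambda>_. 0) (arr s0 ''L1'')" "chain n ?V 0 (\<lambda>_. 0) (\<lambda>_. 0) (arr s0 ''L2'')"
          by (rule chain_0, use L in simp)+
        then show "I m (result (Assign ''q'' (Var ''n'')) s1)"
          using zero n k by (auto simp: I_def chains_built_def s1 intro!: exI[of _ 0])
      qed (use W n in \<open>auto simp: s1\<close>)
    next
      fix s2 assume "I m s2"
      have "runs W (While ?b link_body) s2 (m * (1 + bcost ?b + max_time link_body) + 1 + bcost ?b) ?Q"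
      proof (rule runs_While[where I = I])
        fix r s assume Ir: "I r s" and b: "bval ?b s"
        then obtain j where j: "j \<le> m" "r = m - j" "reg s ''j'' = j" "reg s ''q'' = n + j"
          and c: "chains_built n j ?U ?V m s" and
          fr: "arr s ''a'' = arr s0 ''a''" "arr s ''b'' = arr s0 ''b''" "arr s ''mk'' = arr s0 ''mk''"
          unfolding I_def by blast
        have jm: "j < m" using b j c by (simp add: chains_built_def)
        have EU: "arr s ''EU'' = ?U" "arr s ''EV'' = ?V" using c by (simp_all add: chains_built_def)
        have cU: "chain n ?U j (arr s ''P1'') (arr s ''N1'') (arr s ''L1'')"
          and cV: "chain n ?V j (arr s ''P2'') (arr s ''N2'') (arr s ''L2'')"
          using c by (simp_all add: chains_built_def)
        note cU' = chain_Suc[OF cU U[OF jm]] and cV' = chain_Suc[OF cV V[OF jm]]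
        have LW: "arr s ''L1'' (?U j) \<le> W" "arr s ''L2'' (?V j) \<le> W" "?U j \<le> W" "?V j \<le> W"
          using chain_bound(5)[OF cU U[OF jm]] chain_bound(5)[OF cV V[OF jm]] U[OF jm] V[OF jm] W jm
          by auto
        have "runs W link_body s (max_time link_body) (I (m - Suc j))"
        proof (rule runs_loop_free)
          show "loop_free link_body" by (simp add: link_body_def link_def incr_def)
          show "safe W link_body s"
            using LW j W jm by (simp add: link_body_def link_def incr_def EU)
          show "I (m - Suc j) (result link_body s)"
            unfolding I_def
            by (rule exI[of _ "Suc j"])
              (use cU' cV' jm j c fr in \<open>simp add: link_body_def link_def incr_def EU chains_built_def\<close>)
        qed
        then show "\<exists>r'. r = Suc r' \<and> runs W link_body s (max_time link_body) (I r')"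
          using jm j by (intro exI[of _ "m - Suc j"]) auto
      next
        fix r s assume "I r s" "\<not> bval ?b s"
        then show "?Q s" unfolding I_def by (auto simp: chains_built_def)
      qed fact
      moreover have "runs W Skip s 1 ?Q" if "?Q s" for s
        using that exec.Skip[of W s] unfolding runs_def by blast
      ultimately show "runs W (Seq (While ?b link_body) Skip) s2
        ((m * (1 + bcost ?b + max_time link_body) + 1 + bcost ?b) + 1) ?Q" by (rule runs_Seq)
    qed
  qed
  then show ?thesis by (rule runs_mono) (auto simp: link_body_def link_def incr_def)
qed

section \<open>Breadth-first search along the links\<close>

definition visit :: "string \<Rightarrow> com" where
  "visit A = seqs [Assign ''t'' (Elem A (Var ''w'')), Cond (Eql (Elem ''mk'' (Var ''t'')) (Lit 0))
     (seqs [Store ''mk'' (Var ''t'') (Lit 1), Store ''Q'' (Var ''qt'') (Var ''t''), incr ''qt'']) Skip]"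

definition search_body :: com where
  "search_body = Seq (seqs [Assign ''w'' (Elem ''Q'' (Var ''qh'')), incr ''qh''])
     (Seq (visit ''P1'') (Seq (visit ''N1'') (Seq (visit ''P2'') (visit ''N2''))))"

text \<open>Marking 0 beforehand makes an absent link look visited, so a visit needs no separate
  test.\<close>

definition search :: com where
  "search = Seq (seqs [Store ''mk'' (Lit 0) (Lit 1), Store ''mk'' (Var ''st'') (Lit 1),
       Store ''Q'' (Lit 0) (Var ''st''), Assign ''qh'' (Lit 0), Assign ''qt'' (Lit 1)])
     (While (Lt (Var ''qh'') (Var ''qt'')) search_body)"

definition marked :: "store \<Rightarrow> nat set" where
  "marked s = {v. arr s ''mk'' v \<noteq> 0}"

definition links :: "string set" where
  "links = {''P1'', ''N1'', ''P2'', ''N2''}"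

text \<open>Reachability is stated through labellings: whatever is constant along the links is
  constant on the nodes found. This matches the form of \<open>adj_crit\<close>.\<close>

definition respects_links :: "store \<Rightarrow> (nat \<Rightarrow> bool) \<Rightarrow> bool" where
  "respects_links s g \<longleftrightarrow> (\<forall>w. \<forall>A\<in>links. arr s A w \<noteq> 0 \<longrightarrow> g (arr s A w) = g w)"

definition queue_ok :: "nat \<Rightarrow> store \<Rightarrow> store \<Rightarrow> bool" where
  "queue_ok N s0 s \<longleftrightarrow> marked s = insert 0 (arr s ''Q'' ` {..<reg s ''qt''}) \<and>
     inj_on (arr s ''Q'') {..<reg s ''qt''} \<and> arr s ''Q'' ` {..<reg s ''qt''} \<subseteq> {..N} \<and>
     reg s ''qt'' \<ge> 1 \<and> arr s ''Q'' 0 = reg s0 ''st'' \<and>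
     (\<forall>g. respects_links s0 g \<longrightarrow> (\<forall>j<reg s ''qt''. g (arr s ''Q'' j) = g (reg s0 ''st''))) \<and>
     (\<forall>A. A \<noteq> ''mk'' \<longrightarrow> A \<noteq> ''Q'' \<longrightarrow> arr s A = arr s0 A) \<and>
     reg s ''n'' = reg s0 ''n'' \<and> reg s ''st'' = reg s0 ''st''"

text \<open>An intermediate state within one round: \<open>s0\<close> precedes the search,
  \<open>s1\<close> follows the removal of \<open>w\<close> from the queue, and \<open>As\<close>
  are the link arrays already followed.\<close>

definition visited :: "nat \<Rightarrow> store \<Rightarrow> store \<Rightarrow> string set \<Rightarrow> store \<Rightarrow> bool" where
  "visited N s0 s1 As s \<longleftrightarrow> queue_ok N s0 s \<and> reg s ''w'' = reg s1 ''w'' \<and> reg s ''qh'' = reg s1 ''qh'' \<and>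
     reg s1 ''qt'' \<le> reg s ''qt'' \<and> (\<forall>j<reg s1 ''qt''. arr s ''Q'' j = arr s1 ''Q'' j) \<and>
     marked s1 \<subseteq> marked s \<and> (\<forall>A\<in>As. arr s0 A (reg s1 ''w'') \<in> marked s)"

text \<open>Entries are distinct and at most \<open>N\<close>; this bounds both the number of rounds
  and the queue pointers.\<close>

lemma queue_bound: "queue_ok N s0 s \<Longrightarrow> reg s ''qt'' \<le> N + 1"
  using card_mono[of "{..N}" "arr s ''Q'' ` {..<reg s ''qt''}"]
  by (auto simp: queue_ok_def card_image)

lemma runs_visit:
  assumes v: "visited N s0 s1 As s" and A: "A \<in> links"
    and w: "\<exists>j<reg s1 ''qt''. reg s1 ''w'' = arr s1 ''Q'' j"
    and bound: "\<And>w. arr s0 A w \<le> N" and W: "N + 2 \<le> W"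
  shows "runs W (visit A) s 40 (visited N s0 s1 (insert A As))"
proof -
  let ?t = "arr s0 A (reg s1 ''w'')"
  have ok: "queue_ok N s0 s" using v by (simp add: visited_def)
  have A': "A \<noteq> ''mk''" "A \<noteq> ''Q''" using A by (auto simp: links_def)
  have t: "arr s A (reg s ''w'') = ?t" using v ok A' by (simp add: visited_def queue_ok_def)
  have tN: "?t \<le> N" by (rule bound)
  have qt: "reg s ''qt'' \<le> N + 1" by (rule queue_bound[OF ok])
  have "runs W (visit A) s (max_time (visit A)) (visited N s0 s1 (insert A As))"
  proof (rule runs_loop_free)
    show "loop_free (visit A)" by (simp add: visit_def incr_def)
    show "safe W (visit A) s" using t tN qt W by (simp add: visit_def incr_def)
    show "visited N s0 s1 (insert A As) (result (visit A) s)"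
    proof (cases "?t \<in> marked s")
      case True
      then have r: "result (visit A) s = s\<lparr>reg := (reg s)(''t'' := ?t)\<rparr>"
        using t by (simp add: visit_def marked_def)
      have mk: "marked (result (visit A) s) = marked s" by (simp add: r marked_def)
      have "queue_ok N s0 (result (visit A) s)"
        using ok mk unfolding queue_ok_def by (simp add: r)
      then show ?thesis using v True mk unfolding visited_def by (simp add: r)
    next
      case False
      let ?q = "reg s ''qt''"
      let ?s = "s\<lparr>reg := (reg s)(''t'' := ?t, ''qt'' := Suc ?q),
        arr := (arr s)(''mk'' := (arr s ''mk'')(?t := 1), ''Q'' := (arr s ''Q'')(?q := ?t))\<rparr>"
      have r: "result (visit A) s = ?s"
        using t False by (simp add: visit_def marked_def incr_def)
      \<comment> \<open>Since 0 is marked from the start, an unmarked target is a genuine link,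
        along which labels are preserved.\<close>
      have t0: "?t \<noteq> 0" "?t \<notin> arr s ''Q'' ` {..<?q}"
        using False ok by (auto simp: queue_ok_def)
      have mk: "marked ?s = insert ?t (marked s)" by (auto simp: marked_def)
      have Qi: "arr ?s ''Q'' ` {..<Suc ?q} = insert ?t (arr s ''Q'' ` {..<?q})"
        by (auto simp: lessThan_Suc image_iff)
      have inj: "inj_on (arr ?s ''Q'') {..<Suc ?q}"
      proof -
        let ?f = "(arr s ''Q'')(?q := ?t)"
        have "inj_on (arr s ''Q'') {..<?q}" using ok by (simp add: queue_ok_def)
        then have "inj_on ?f {..<?q}" by (rule inj_on_cong[THEN iffD2, rotated]) simp
        moreover have "?f ` {..<?q} = arr s ''Q'' ` {..<?q}" by (rule image_cong) auto
        then have "?f ?q \<notin> ?f ` ({..<?q} - {?q})" using t0(2) by simp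
        ultimately have "inj_on ?f (insert ?q {..<?q})" by (intro inj_on_insert[THEN iffD2] conjI)
        then show ?thesis by (simp add: lessThan_Suc)
      qed
      have q1: "1 \<le> ?q" and Q0: "arr s ''Q'' 0 = reg s0 ''st''" using ok by (auto simp: queue_ok_def)
      have lab: "g ?t = g (reg s0 ''st'')" if g: "respects_links s0 g" for g
      proof -
        obtain j where j: "j < reg s1 ''qt''" "reg s1 ''w'' = arr s1 ''Q'' j" using w by blast
        then have "reg s1 ''w'' = arr s ''Q'' j" "j < ?q" using v by (auto simp: visited_def)
        then have "g (reg s1 ''w'') = g (reg s0 ''st'')" using ok g by (simp add: queue_ok_def)
        moreover have "g ?t = g (reg s1 ''w'')" using g A t0 by (simp add: respects_links_def)
        ultimately show ?thesis by simp
      qed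
      have "queue_ok N s0 ?s"
        unfolding queue_ok_def
      proof (intro conjI)
        show "marked ?s = insert 0 (arr ?s ''Q'' ` {..<reg ?s ''qt''})"
          using ok Qi mk by (simp add: queue_ok_def insert_commute)
        show "inj_on (arr ?s ''Q'') {..<reg ?s ''qt''}" using inj by simp
        show "arr ?s ''Q'' ` {..<reg ?s ''qt''} \<subseteq> {..N}"
          using ok Qi tN by (simp add: queue_ok_def)
        show "1 \<le> reg ?s ''qt''" by simp
        show "arr ?s ''Q'' 0 = reg s0 ''st''" using q1 Q0 by simp
        show "\<forall>g. respects_links s0 g \<longrightarrow> (\<forall>j<reg ?s ''qt''. g (arr ?s ''Q'' j) = g (reg s0 ''st''))"
          using ok lab by (simp add: queue_ok_def less_Suc_eq)
      qed (use ok in \<open>auto simp: queue_ok_def\<close>)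
      then show ?thesis
        unfolding r using v mk by (auto simp: visited_def)
    qed
  qed
  then show ?thesis by (rule runs_mono) (simp_all add: visit_def incr_def)
qed

lemma runs_search:
  assumes bound: "\<And>A w. A \<in> links \<Longrightarrow> arr s0 A w \<le> N" and zero: "\<And>A. A \<in> links \<Longrightarrow> arr s0 A 0 = 0"
    and st: "reg s0 ''st'' \<le> N" and mk: "arr s0 ''mk'' = (\<lambda>_. 0)" and W: "N + 2 \<le> W"
  shows "runs W search s0 (N * 200 + 300)
    (\<lambda>s. (\<forall>A. A \<noteq> ''mk'' \<longrightarrow> A \<noteq> ''Q'' \<longrightarrow> arr s A = arr s0 A) \<and>
      reg s ''n'' = reg s0 ''n'' \<and> reg s ''st'' = reg s0 ''st'' \<and> reg s0 ''st'' \<in> marked s \<and>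
      (\<forall>w\<in>marked s. \<forall>A\<in>links. arr s0 A w \<in> marked s) \<and>
      (\<forall>g. respects_links s0 g \<longrightarrow> (\<forall>v\<in>marked s. v \<noteq> 0 \<longrightarrow> g v = g (reg s0 ''st''))))"
    (is "runs W search s0 _ ?Q")
proof -
  \<comment> \<open>Each round advances \<open>qh\<close> by one, and at most \<open>N + 1\<close>
    entries are ever queued, so \<open>N + 1 - qh\<close> is a variant. Entries before
    \<open>qh\<close> have all their neighbours marked.\<close>
  define I where "I r s \<longleftrightarrow> queue_ok N s0 s \<and> reg s ''qh'' \<le> reg s ''qt'' \<and> r = N + 1 - reg s ''qh'' \<and>
    (\<forall>j<reg s ''qh''. \<forall>A\<in>links. arr s0 A (arr s ''Q'' j) \<in> marked s)" for r s
  let ?init = "seqs [Store ''mk'' (Lit 0) (Lit 1), Store ''mk'' (Var ''st'') (Lit 1),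
       Store ''Q'' (Lit 0) (Var ''st''), Assign ''qh'' (Lit 0), Assign ''qt'' (Lit 1)]"
  let ?b = "Lt (Var ''qh'') (Var ''qt'')"
  have "runs W search s0 (max_time ?init + ((N + 1) * (1 + bcost ?b + 200 - 10) + 1 + bcost ?b)) ?Q"
    unfolding search_def
  proof (rule runs_Seq)
    show "runs W ?init s0 (max_time ?init) (I (N + 1))"
    proof (rule runs_loop_free)
      show "safe W ?init s0" using st W by simp
      show "I (N + 1) (result ?init s0)"
        using st by (auto simp: I_def queue_ok_def marked_def mk lessThan_Suc)
    qed simp
  next
    fix s assume "I (N + 1) s"
    then have "runs W (While ?b search_body) s ((N + 1) * (1 + bcost ?b + 186) + 1 + bcost ?b) ?Q"
    proof (rule runs_While[where I = I, rotated 2])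
      fix r s assume I: "I r s" and b: "bval ?b s"
      let ?h = "reg s ''qh''"
      have ok: "queue_ok N s0 s" using I by (simp add: I_def)
      have h: "?h < reg s ''qt''" using b by simp
      have hN: "?h < N + 1" "arr s ''Q'' ?h \<le> N"
        using h queue_bound[OF ok] ok by (auto simp: queue_ok_def)
      define s1 where "s1 = s\<lparr>reg := (reg s)(''w'' := arr s ''Q'' ?h, ''qh'' := Suc ?h)\<rparr>"
      have w: "\<exists>j<reg s1 ''qt''. reg s1 ''w'' = arr s1 ''Q'' j" using h by (auto simp: s1_def)
      note rv = runs_visit[OF _ _ w bound W]
      have "runs W search_body s (max_time (seqs [Assign ''w'' (Elem ''Q'' (Var ''qh'')), incr ''qh''])
          + (40 + (40 + (40 + 40)))) (visited N s0 s1 {''N2'', ''P2'', ''N1'', ''P1''})"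
        unfolding search_body_def
      proof (intro runs_Seq)
        show "runs W (seqs [Assign ''w'' (Elem ''Q'' (Var ''qh'')), incr ''qh'']) s
          (max_time (seqs [Assign ''w'' (Elem ''Q'' (Var ''qh'')), incr ''qh''])) (visited N s0 s1 {})"
          by (rule runs_loop_free)
            (use ok hN W in \<open>auto simp: incr_def s1_def visited_def queue_ok_def marked_def\<close>)
        show "runs W (visit ''P1'') s 40 (visited N s0 s1 {''P1''})" if "visited N s0 s1 {} s" for s
          by (rule rv[OF that]) (auto simp: links_def)
        show "runs W (visit ''N1'') s 40 (visited N s0 s1 {''N1'', ''P1''})" if "visited N s0 s1 {''P1''} s" for s
          by (rule rv[OF that]) (auto simp: links_def)
        show "runs W (visit ''P2'') s 40 (visited N s0 s1 {''P2'', ''N1'', ''P1''})"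
          if "visited N s0 s1 {''N1'', ''P1''} s" for s
          by (rule rv[OF that]) (auto simp: links_def)
        show "runs W (visit ''N2'') s 40 (visited N s0 s1 {''N2'', ''P2'', ''N1'', ''P1''})"
          if "visited N s0 s1 {''P2'', ''N1'', ''P1''} s" for s
          by (rule rv[OF that]) (auto simp: links_def)
      qed
      then have "runs W search_body s 186 (I (N - ?h))"
      proof (rule runs_mono)
        fix s' assume v: "visited N s0 s1 {''N2'', ''P2'', ''N1'', ''P1''} s'"
        have eq: "links = {''N2'', ''P2'', ''N1'', ''P1''}" by (auto simp: links_def)
        have Q: "\<forall>j<reg s ''qt''. arr s' ''Q'' j = arr s ''Q'' j" and qh: "reg s' ''qh'' = Suc ?h"
          and qt: "reg s ''qt'' \<le> reg s' ''qt''" and mk': "marked s \<subseteq> marked s'"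
          and new: "\<forall>A\<in>links. arr s0 A (arr s ''Q'' ?h) \<in> marked s'" and ok': "queue_ok N s0 s'"
          using v unfolding eq by (simp_all add: visited_def s1_def marked_def)
        have "\<forall>A\<in>links. arr s0 A (arr s' ''Q'' j) \<in> marked s'" if "j < Suc ?h" for j
        proof (cases "j = ?h")
          case True
          then show ?thesis using new Q h by simp
        next
          case False
          then have "j < ?h" using that by simp
          then show ?thesis using I Q h mk' by (auto simp: I_def)
        qed
        then show "I (N - ?h) s'" using ok' qh qt h by (simp add: I_def)
      qed (simp add: incr_def)
      then show "\<exists>r'. r = Suc r' \<and> runs W search_body s 186 (I r')"
        using I hN by (intro exI[of _ "N - ?h"]) (auto simp: I_def)
    next
      fix r s assume I: "I r s" and b: "\<not> bval ?b s"
      then have ok: "queue_ok N s0 s" and eq: "reg s ''qh'' = reg s ''qt''" by (auto simp: I_def)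
      have m: "marked s = insert 0 (arr s ''Q'' ` {..<reg s ''qt''})" using ok by (simp add: queue_ok_def)
      have 1: "reg s0 ''st'' \<in> marked s"
        unfolding m using ok by (auto simp: queue_ok_def image_iff intro!: bexI[of _ 0])
      have 2: "arr s0 A w \<in> marked s" if w: "w \<in> marked s" and A: "A \<in> links" for w A
      proof (cases "w = 0")
        case True
        then show ?thesis using zero[OF A] by (simp add: m)
      next
        case False
        then obtain j where "j < reg s ''qt''" "w = arr s ''Q'' j" using w by (auto simp: m)
        then show ?thesis using I A by (simp add: I_def eq)
      qed
      have 3: "g v = g (reg s0 ''st'')" if g: "respects_links s0 g" and v: "v \<in> marked s" "v \<noteq> 0" for g v
      proof -
        obtain j where "j < reg s ''qt''" "v = arr s ''Q'' j" using v by (auto simp: m)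
        then show ?thesis using ok g by (simp add: queue_ok_def)
      qed
      show "?Q s" using ok 1 2 3 by (simp add: queue_ok_def)
    qed
    then show "runs W (While ?b search_body) s ((N + 1) * (1 + bcost ?b + 200 - 10) + 1 + bcost ?b) ?Q"
      by (rule runs_mono) auto
  qed
  then show ?thesis by (rule runs_mono) auto
qed

section \<open>The decision procedure\<close>

text \<open>One direction spreads a consistent labelling over the edge nodes and uses that it is
  constant on what was found. The other applies the criterion to the found set itself, taken as a
  labelling.\<close>

lemma marked_criterion:
  assumes vx: "valid n x" and vy: "valid n y"
    and G: "(\<lambda>j. (U j, V j)) ` {..<m} = edge_graph n x y"
    and cU: "chain n U m P1 N1 L1" and cV: "chain n V m P2 N2 L2"
    and closed: "\<And>w. w \<in> M \<Longrightarrow> P1 w \<in> M \<and> N1 w \<in> M \<and> P2 w \<in> M \<and> N2 w \<in> M"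
    and label: "\<And>g :: nat \<Rightarrow> bool. (\<And>w. (P1 w \<noteq> 0 \<longrightarrow> g (P1 w) = g w) \<and> (N1 w \<noteq> 0 \<longrightarrow> g (N1 w) = g w) \<and>
      (P2 w \<noteq> 0 \<longrightarrow> g (P2 w) = g w) \<and> (N2 w \<noteq> 0 \<longrightarrow> g (N2 w) = g w)) \<Longrightarrow>
      (\<forall>v\<in>M. v \<noteq> 0 \<longrightarrow> g v = g st)"
    and st: "st \<in> M" "st \<in> {1..n}" "x st \<noteq> y st"
  shows "(\<forall>i\<in>{1..n}. x i \<noteq> y i \<longrightarrow> i \<in> M) \<longleftrightarrow> adj_crit n x y"
proof
  assume all: "\<forall>i\<in>{1..n}. x i \<noteq> y i \<longrightarrow> i \<in> M"
  have "l u = l v" if l: "consistent n x y l" and u: "x u \<noteq> y u" and v: "x v \<noteq> y v" for l u v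
  proof -
    have mem: "w \<in> {1..n}" if "x w \<noteq> y w" for w
      using that vx vy derangement_outside unfolding valid_def by metis
    \<comment> \<open>An edge node inherits the label of its first end point; by consistency the
      second end point has the same label, so both chains respect \<open>g\<close>.\<close>
    define g where "g w = (if w \<le> n then l w else l (U (w - (n + 1))))" for w
    have UV: "U j \<in> {1..n}" "V j \<in> {1..n}" "l (U j) = l (V j)" if "j < m" for j
    proof -
      have e: "(U j, V j) \<in> edge_graph n x y" using G that by blast
      show "U j \<in> {1..n}" "V j \<in> {1..n}" using edge_graph_mem[OF vx vy e] by auto
      show "l (U j) = l (V j)" using l e unfolding consistent_iff_edge_graph by blast
    qed
    have gU: "g (n + 1 + j) = g (U j)" and gV: "g (n + 1 + j) = g (V j)" if "j < m" for j
      using UV[OF that] by (auto simp: g_def)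
    have "\<forall>w\<in>M. w \<noteq> 0 \<longrightarrow> g w = g st"
      by (rule label) (use chain_label[OF cU gU] chain_label[OF cV gV] in blast)
    then have "g u = g v" using all mem[OF u] mem[OF v] u v by auto
    then show ?thesis using mem[OF u] mem[OF v] by (simp add: g_def)
  qed
  then show "adj_crit n x y" using st by (auto simp: adj_crit_def)
next
  assume c: "adj_crit n x y"
  \<comment> \<open>A set closed under the links contains an edge node if and only if it contains
    either end point, so membership is constant on edges. It holds at \<open>st\<close>, hence at
    all differing cities.\<close>
  have "consistent n x y (\<lambda>u. u \<in> M)"
    unfolding consistent_iff_edge_graph
  proof (rule ballI, clarify)
    fix u v assume "(u, v) \<in> edge_graph n x y"
    then have "(u, v) \<in> (\<lambda>j. (U j, V j)) ` {..<m}" using G by simp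
    then obtain j where j: "j < m" "u = U j" "v = V j" by blast
    have "n + 1 + j \<in> M \<longleftrightarrow> U j \<in> M" "n + 1 + j \<in> M \<longleftrightarrow> V j \<in> M"
      using chain_closed[OF cU j(1), of M] chain_closed[OF cV j(1), of M] closed by blast+
    then show "(u \<in> M) = (v \<in> M)" using j by simp
  qed
  then show "\<forall>i\<in>{1..n}. x i \<noteq> y i \<longrightarrow> i \<in> M"
    using c st by (auto simp: adj_crit_def)
qed

text \<open>The value 0 of \<open>st\<close>, which is no city, records that the tours coincide;
  \<open>check\<close> then answers in the negative.\<close>

definition find_start :: com where
  "find_start = Seq (Assign ''st'' (Lit 0))
     (for_each (Cond (Eql (Elem ''a'' vi) (Elem ''b'' vi)) Skip (Assign ''st'' vi)))"

lemma runs_find_start: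
  assumes W: "n + 1 \<le> W" and n: "reg s0 ''n'' = n"
  shows "runs W find_start s0 ((n + 1) * 40)
    (\<lambda>s. arr s = arr s0 \<and> reg s ''n'' = n \<and> reg s ''k'' = reg s0 ''k'' \<and>
      (if \<exists>j\<in>{1..n}. arr s0 ''a'' j \<noteq> arr s0 ''b'' j
       then reg s ''st'' \<in> {1..n} \<and> arr s0 ''a'' (reg s ''st'') \<noteq> arr s0 ''b'' (reg s ''st'')
       else reg s ''st'' = 0))"
proof -
  define J where "J i s \<longleftrightarrow> arr s = arr s0 \<and> reg s ''i'' = i \<and> reg s ''n'' = n \<and> reg s ''k'' = reg s0 ''k'' \<and>
    (if \<exists>j\<in>{1..<i}. arr s0 ''a'' j \<noteq> arr s0 ''b'' j
       then reg s ''st'' \<in> {1..<i} \<and> arr s0 ''a'' (reg s ''st'') \<noteq> arr s0 ''b'' (reg s ''st'')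
       else reg s ''st'' = 0)" for i and s :: store
  let ?c = "Cond (Eql (Elem ''a'' vi) (Elem ''b'' vi)) Skip (Assign ''st'' vi)"
  have "runs W find_start s0 (2 + (n + 1) * (max_time ?c + 10)) (J (Suc n))"
    unfolding find_start_def
  proof (rule runs_Seq)
    let ?Q = "\<lambda>s. J 1 (s\<lparr>reg := (reg s)(''i'' := 1)\<rparr>)"
    show "runs W (Assign ''st'' (Lit 0)) s0 2 ?Q"
      by (rule runs_mono[OF runs_loop_free[where Q = ?Q]]) (auto simp: J_def n)
    fix s assume s: "?Q s"
    show "runs W (for_each ?c) s ((n + 1) * (max_time ?c + 10)) (J (Suc n))"
    proof (rule runs_for_each[where J = J, OF W s])
      fix i s assume J: "J i s" and i: "i \<in> {1..n}"
      have split: "(\<exists>j\<in>{1..<Suc i}. arr s0 ''a'' j \<noteq> arr s0 ''b'' j) \<longleftrightarrow>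
        (\<exists>j\<in>{1..<i}. arr s0 ''a'' j \<noteq> arr s0 ''b'' j) \<or> arr s0 ''a'' i \<noteq> arr s0 ''b'' i"
        using i by (auto simp: less_Suc_eq)
      show "runs W ?c s (max_time ?c) (\<lambda>s'. reg s' ''i'' = i \<and> J (Suc i) (s'\<lparr>reg := (reg s')(''i'' := Suc i)\<rparr>))"
      proof (rule runs_loop_free)
        show "safe W ?c s" using J i W by (simp add: J_def)
        show "reg (result ?c s) ''i'' = i \<and> J (Suc i) (result ?c s\<lparr>reg := (reg (result ?c s))(''i'' := Suc i)\<rparr>)"
        proof (cases "arr s0 ''a'' i = arr s0 ''b'' i")
          case True
          then have "result ?c s = s" using J by (simp add: J_def)
          then show ?thesis using J True unfolding J_def split by (auto split: if_splits)
        next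
          case False
          then have r: "result ?c s = s\<lparr>reg := (reg s)(''st'' := i)\<rparr>" using J by (simp add: J_def)
          show ?thesis using J False i unfolding J_def split r by simp
        qed
      qed simp
    qed (simp add: J_def)
  qed
  then show ?thesis
    by (rule runs_mono) (auto simp: J_def atLeastLessThanSuc_atLeastAtMost split: if_splits)
qed

definition check :: com where
  "check = Seq (Cond (Eql (Var ''st'') (Lit 0)) (Assign ''answer'' (Lit 0)) (Assign ''answer'' (Lit 1)))
     (for_each (Cond (Eql (Elem ''a'' vi) (Elem ''b'' vi)) Skip
       (Cond (Eql (Elem ''mk'' vi) (Lit 0)) (Assign ''answer'' (Lit 0)) Skip)))"

lemma runs_check:
  assumes W: "n + 1 \<le> W" and n: "reg s0 ''n'' = n"
  shows "runs W check s0 ((n + 1) * 50)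
    (\<lambda>s. reg s ''answer'' = (if reg s0 ''st'' \<noteq> 0 \<and>
      (\<forall>i\<in>{1..n}. arr s0 ''a'' i \<noteq> arr s0 ''b'' i \<longrightarrow> i \<in> marked s0) then 1 else 0))"
proof -
  define J where "J i s \<longleftrightarrow> arr s = arr s0 \<and> reg s ''i'' = i \<and> reg s ''n'' = n \<and>
    reg s ''answer'' = (if reg s0 ''st'' \<noteq> 0 \<and>
      (\<forall>j\<in>{1..<i}. arr s0 ''a'' j \<noteq> arr s0 ''b'' j \<longrightarrow> arr s0 ''mk'' j \<noteq> 0) then 1 else 0)" for i and s :: store
  let ?c = "Cond (Eql (Elem ''a'' vi) (Elem ''b'' vi)) Skip
       (Cond (Eql (Elem ''mk'' vi) (Lit 0)) (Assign ''answer'' (Lit 0)) Skip)"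
  have "runs W check s0 (8 + (n + 1) * (max_time ?c + 10)) (J (Suc n))"
    unfolding check_def
  proof (rule runs_Seq)
    let ?Q = "\<lambda>s. J 1 (s\<lparr>reg := (reg s)(''i'' := 1)\<rparr>)"
    show "runs W (Cond (Eql (Var ''st'') (Lit 0)) (Assign ''answer'' (Lit 0)) (Assign ''answer'' (Lit 1))) s0 8 ?Q"
      by (rule runs_mono[OF runs_loop_free[where Q = ?Q]]) (use W in \<open>auto simp: J_def n\<close>)
    fix s assume s: "?Q s"
    show "runs W (for_each ?c) s ((n + 1) * (max_time ?c + 10)) (J (Suc n))"
    proof (rule runs_for_each[where J = J, OF W s])
      fix i s assume J: "J i s" and i: "i \<in> {1..n}"
      have split: "(\<forall>j\<in>{1..<Suc i}. arr s0 ''a'' j \<noteq> arr s0 ''b'' j \<longrightarrow> arr s0 ''mk'' j \<noteq> 0) \<longleftrightarrow>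
        (\<forall>j\<in>{1..<i}. arr s0 ''a'' j \<noteq> arr s0 ''b'' j \<longrightarrow> arr s0 ''mk'' j \<noteq> 0) \<and>
        (arr s0 ''a'' i \<noteq> arr s0 ''b'' i \<longrightarrow> arr s0 ''mk'' i \<noteq> 0)"
        using i by (auto simp: less_Suc_eq)
      show "runs W ?c s (max_time ?c) (\<lambda>s'. reg s' ''i'' = i \<and> J (Suc i) (s'\<lparr>reg := (reg s')(''i'' := Suc i)\<rparr>))"
      proof (rule runs_loop_free)
        show "reg (result ?c s) ''i'' = i \<and> J (Suc i) (result ?c s\<lparr>reg := (reg (result ?c s))(''i'' := Suc i)\<rparr>)"
        proof (cases "arr s0 ''a'' i = arr s0 ''b'' i \<or> arr s0 ''mk'' i \<noteq> 0")
          case True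
          then have "result ?c s = s" using J by (auto simp: J_def)
          then show ?thesis using J True unfolding J_def split by auto
        next
          case False
          then have r: "result ?c s = s\<lparr>reg := (reg s)(''answer'' := 0)\<rparr>" using J by (simp add: J_def)
          show ?thesis using J False unfolding J_def split r by simp
        qed
      qed simp_all
    qed (simp add: J_def)
  qed
  then show ?thesis
  proof (rule runs_mono)
    fix s assume "J (Suc n) s"
    then show "reg s ''answer'' = (if reg s0 ''st'' \<noteq> 0 \<and>
      (\<forall>i\<in>{1..n}. arr s0 ''a'' i \<noteq> arr s0 ''b'' i \<longrightarrow> i \<in> marked s0) then 1 else 0)"
      unfolding J_def marked_def atLeastLessThanSuc_atLeastAtMost by simp
  qed simp
qed

definition decide :: com where
  "decide = Seq (for_each init_body) (Seq list_edges (Seq build_chains (Seq find_start (Seq search check))))"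

lemma runs_decide:
  assumes n: "n \<ge> 3" and vx: "valid n x" and vy: "valid n y" and W: "100 * n \<le> W" and s: "loaded n x y s"
  shows "runs W decide s (20000 * n) (\<lambda>s'. reg s' ''answer'' = (if adj_crit n x y then 1 else 0))"
proof -
  have x: "derangement n x" and y: "derangement n y" using vx vy by (auto simp: valid_def)
  have W': "n + 1 \<le> W" "20 * n < W" "1 < W" using W n by auto
  let ?Q = "\<lambda>s'. reg s' ''answer'' = (if adj_crit n x y then 1 else 0)"
  \<comment> \<open>With at most \<open>20 * n\<close> edges there are at most \<open>21 * n\<close>
    nodes, counting cities and edges; this explains the factors in the terms for
    \<open>build_chains\<close> and \<open>search\<close>.\<close>
  have "runs W decide s ((n + 1) * 40 + ((n + 1) * 2100 + ((20 * n * 60 + 20) + ((n + 1) * 40 +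
    ((21 * n * 200 + 300) + (n + 1) * 50))))) ?Q"
    unfolding decide_def
  proof (rule runs_Seq[OF runs_init[OF x y W'(1) s]], rule runs_Seq[OF runs_list_edges[OF vx vy W'(2,3)]])
    fix s1 :: store assume s1: "prepared n x y s1 \<and> reg s1 ''k'' \<le> 20 * n \<and> edge_set s1 = edge_graph n x y"
    let ?m = "reg s1 ''k''" and ?U = "arr s1 ''EU''" and ?V = "arr s1 ''EV''"
    have m: "?m \<le> 20 * n" and G: "(\<lambda>j. (?U j, ?V j)) ` {..<?m} = edge_graph n x y"
      using s1 by (simp_all add: edge_set_def)
    have UV: "?U j \<in> {1..n}" "?V j \<in> {1..n}" if "j < ?m" for j
    proof -
      have "(?U j, ?V j) \<in> edge_graph n x y" using G that by blast
      then show "?U j \<in> {1..n}" "?V j \<in> {1..n}" using edge_graph_mem[OF vx vy] by blast+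
    qed
    have ab: "arr s1 ''a'' j = x j" "arr s1 ''b'' j = y j" if "j \<in> {1..n}" for j
      using s1 that by (auto simp: prepared_def loaded_def)
    have n1: "reg s1 ''n'' = n" using s1 by (simp add: prepared_def loaded_def)
    have Wm: "n + ?m + 1 \<le> W" using m W n by linarith
    have "runs W build_chains s1 (?m * 60 + 20) (\<lambda>s. chains_built n ?m ?U ?V ?m s \<and>
      arr s ''a'' = arr s1 ''a'' \<and> arr s ''b'' = arr s1 ''b'' \<and> arr s ''mk'' = arr s1 ''mk'')"
      by (rule runs_build_chains[OF Wm n1 refl UV])
        (use s1 in \<open>auto simp: prepared_def loaded_def\<close>)
    then have bc: "runs W build_chains s1 (20 * n * 60 + 20) (\<lambda>s. chains_built n ?m ?U ?V ?m s \<and>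
      arr s ''a'' = arr s1 ''a'' \<and> arr s ''b'' = arr s1 ''b'' \<and> arr s ''mk'' = arr s1 ''mk'')"
      by (rule runs_mono) (use m in auto)
    show "runs W (Seq build_chains (Seq find_start (Seq search check))) s1
      ((20 * n * 60 + 20) + ((n + 1) * 40 + ((21 * n * 200 + 300) + (n + 1) * 50))) ?Q"
    proof (rule runs_Seq[OF bc])
      fix s2 :: store assume s2: "chains_built n ?m ?U ?V ?m s2 \<and>
        arr s2 ''a'' = arr s1 ''a'' \<and> arr s2 ''b'' = arr s1 ''b'' \<and> arr s2 ''mk'' = arr s1 ''mk''"
      have n2: "reg s2 ''n'' = n" using s2 by (simp add: chains_built_def)
      have cU: "chain n ?U ?m (arr s2 ''P1'') (arr s2 ''N1'') (arr s2 ''L1'')"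
        and cV: "chain n ?V ?m (arr s2 ''P2'') (arr s2 ''N2'') (arr s2 ''L2'')"
        using s2 by (simp_all add: chains_built_def)
      have ab2: "arr s2 ''a'' j = x j" "arr s2 ''b'' j = y j" if "j \<in> {1..n}" for j
        using s2 ab that by auto
      have mk2: "arr s2 ''mk'' = (\<lambda>_. 0)" using s1 s2 by (simp add: prepared_def loaded_def)
      show "runs W (Seq find_start (Seq search check)) s2
        ((n + 1) * 40 + ((21 * n * 200 + 300) + (n + 1) * 50)) ?Q"
      proof (rule runs_Seq[OF runs_find_start[OF W'(1) n2]])
        fix s3 :: store assume s3: "arr s3 = arr s2 \<and> reg s3 ''n'' = n \<and> reg s3 ''k'' = reg s2 ''k'' \<and>
          (if \<exists>j\<in>{1..n}. arr s2 ''a'' j \<noteq> arr s2 ''b'' j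
           then reg s3 ''st'' \<in> {1..n} \<and> arr s2 ''a'' (reg s3 ''st'') \<noteq> arr s2 ''b'' (reg s3 ''st'')
           else reg s3 ''st'' = 0)"
        let ?st = "reg s3 ''st''" and ?N = "n + ?m"
        have st: "?st = 0 \<and> (\<forall>j\<in>{1..n}. x j = y j) \<or> ?st \<in> {1..n} \<and> x ?st \<noteq> y ?st"
          using s3 ab2 by (cases "\<exists>j\<in>{1..n}. arr s2 ''a'' j \<noteq> arr s2 ''b'' j") auto
        have stN: "?st \<le> ?N" using st by auto
        have bound: "arr s3 A w \<le> ?N" "arr s3 A 0 = 0" if "A \<in> links" for A w
          using that s3 chain_bound[OF cU] chain_bound[OF cV] by (auto simp: links_def)
        have Wm2: "?N + 2 \<le> W" using m W n by linarith
        have "runs W search s3 (?N * 200 + 300)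
          (\<lambda>s. (\<forall>A. A \<noteq> ''mk'' \<longrightarrow> A \<noteq> ''Q'' \<longrightarrow> arr s A = arr s3 A) \<and>
          reg s ''n'' = reg s3 ''n'' \<and> reg s ''st'' = ?st \<and> ?st \<in> marked s \<and>
          (\<forall>w\<in>marked s. \<forall>A\<in>links. arr s3 A w \<in> marked s) \<and>
          (\<forall>g. respects_links s3 g \<longrightarrow> (\<forall>v\<in>marked s. v \<noteq> 0 \<longrightarrow> g v = g ?st)))"
          by (rule runs_search[OF bound stN _ Wm2]) (use s3 mk2 in auto)
        then have se: "runs W search s3 (21 * n * 200 + 300)
          (\<lambda>s. (\<forall>A. A \<noteq> ''mk'' \<longrightarrow> A \<noteq> ''Q'' \<longrightarrow> arr s A = arr s3 A) \<and>
          reg s ''n'' = reg s3 ''n'' \<and> reg s ''st'' = ?st \<and> ?st \<in> marked s \<and>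
          (\<forall>w\<in>marked s. \<forall>A\<in>links. arr s3 A w \<in> marked s) \<and>
          (\<forall>g. respects_links s3 g \<longrightarrow> (\<forall>v\<in>marked s. v \<noteq> 0 \<longrightarrow> g v = g ?st)))"
          by (rule runs_mono) (use m in auto)
        show "runs W (Seq search check) s3 ((21 * n * 200 + 300) + (n + 1) * 50) ?Q"
        proof (rule runs_Seq[OF se])
          fix s4 :: store assume s4: "(\<forall>A. A \<noteq> ''mk'' \<longrightarrow> A \<noteq> ''Q'' \<longrightarrow> arr s4 A = arr s3 A) \<and>
            reg s4 ''n'' = reg s3 ''n'' \<and> reg s4 ''st'' = ?st \<and> ?st \<in> marked s4 \<and>
            (\<forall>w\<in>marked s4. \<forall>A\<in>links. arr s3 A w \<in> marked s4) \<and>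
            (\<forall>g. respects_links s3 g \<longrightarrow> (\<forall>v\<in>marked s4. v \<noteq> 0 \<longrightarrow> g v = g ?st))"
          have n4: "reg s4 ''n'' = n" using s3 s4 by simp
          have ab4: "arr s4 ''a'' j = x j" "arr s4 ''b'' j = y j" if "j \<in> {1..n}" for j
            using s3 s4 ab2 that by auto
          have iff: "?st \<noteq> 0 \<and> (\<forall>i\<in>{1..n}. arr s4 ''a'' i \<noteq> arr s4 ''b'' i \<longrightarrow> i \<in> marked s4) \<longleftrightarrow> adj_crit n x y"
          proof (cases "?st = 0")
            case True
            then have "x j = y j" for j
              using st derangement_outside[OF x, of j] derangement_outside[OF y, of j]
              by (cases "j \<in> {1..n}") auto
            then have "x = y" by blast
            then show ?thesis using True by (simp add: adj_crit_def)
          next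
            case False
            then have st': "?st \<in> {1..n}" "x ?st \<noteq> y ?st" using st by auto
            have "(\<forall>i\<in>{1..n}. x i \<noteq> y i \<longrightarrow> i \<in> marked s4) \<longleftrightarrow> adj_crit n x y"
            proof (rule marked_criterion[OF vx vy G cU cV _ _ _ st'])
              show "arr s2 ''P1'' w \<in> marked s4 \<and> arr s2 ''N1'' w \<in> marked s4 \<and>
                arr s2 ''P2'' w \<in> marked s4 \<and> arr s2 ''N2'' w \<in> marked s4" if "w \<in> marked s4" for w
                using s4 s3 that by (simp add: links_def)
              show "\<forall>v\<in>marked s4. v \<noteq> 0 \<longrightarrow> g v = g ?st"
                if "\<And>w. (arr s2 ''P1'' w \<noteq> 0 \<longrightarrow> g (arr s2 ''P1'' w) = g w) \<and>
                  (arr s2 ''N1'' w \<noteq> 0 \<longrightarrow> g (arr s2 ''N1'' w) = g w) \<and>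
                  (arr s2 ''P2'' w \<noteq> 0 \<longrightarrow> g (arr s2 ''P2'' w) = g w) \<and>
                  (arr s2 ''N2'' w \<noteq> 0 \<longrightarrow> g (arr s2 ''N2'' w) = g w)" for g :: "nat \<Rightarrow> bool"
              proof -
                have "respects_links s3 g" using that s3 by (simp add: respects_links_def links_def)
                then show ?thesis using s4 by blast
              qed
              show "?st \<in> marked s4" using s4 by simp
            qed
            then show ?thesis using False ab4 by simp
          qed
          show "runs W check s4 ((n + 1) * 50) ?Q"
            by (rule runs_mono[OF runs_check[OF W'(1) n4]]) (use s4 iff in simp_all)
        qed
      qed
    qed
  qed
  then show ?thesis by (rule runs_mono) (use n in auto)
qed

section \<open>The two input encodings\<close>

definition load_successors :: com where
  "load_successors = for_each (seqs [Store ''a'' vi (Elem ''x'' vi), Store ''b'' vi (Elem ''y'' vi)])"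

lemma runs_load_successors:
  assumes x: "derangement n x" and y: "derangement n y" and W: "n + 1 \<le> W"
  shows "runs W load_successors (input n (successor_array n x) (successor_array n y)) ((n + 1) * 30) (loaded n x y)"
proof -
  let ?s0 = "input n (successor_array n x) (successor_array n y)"
  let ?c = "seqs [Store ''a'' vi (Elem ''x'' vi), Store ''b'' vi (Elem ''y'' vi)]"
  define J where "J i s \<longleftrightarrow> reg s ''i'' = i \<and> reg s ''n'' = n \<and>
    arr s ''x'' = successor_array n x \<and> arr s ''y'' = successor_array n y \<and>
    (\<forall>j\<in>{1..<i}. arr s ''a'' j = x j \<and> arr s ''b'' j = y j) \<and>
    (\<forall>A\<in>{''P1'', ''N1'', ''P2'', ''N2'', ''mk''}. arr s A = (\<lambda>_. 0))" for i and s :: store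
  have "runs W load_successors ?s0 ((n + 1) * (max_time ?c + 10)) (J (Suc n))"
    unfolding load_successors_def
  proof (rule runs_for_each[where J = J, OF W])
    show "J 1 (?s0\<lparr>reg := (reg ?s0)(''i'' := 1)\<rparr>)" by (simp add: J_def input_def)
    fix i s assume J: "J i s" and i: "i \<in> {1..n}"
    have xy: "arr s ''x'' i = x i" "arr s ''y'' i = y i"
      using J i by (simp_all add: J_def successor_array_def)
    have mem: "x i \<le> n" "y i \<le> n" using derangement_mem[OF x, of i] derangement_mem[OF y, of i] i by auto
    show "runs W ?c s (max_time ?c) (\<lambda>s'. reg s' ''i'' = i \<and> J (Suc i) (s'\<lparr>reg := (reg s')(''i'' := Suc i)\<rparr>))"
    proof (rule runs_loop_free)
      show "safe W ?c s" using J i W mem xy by (simp add: J_def)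
      show "reg (result ?c s) ''i'' = i \<and> J (Suc i) (result ?c s\<lparr>reg := (reg (result ?c s))(''i'' := Suc i)\<rparr>)"
        using J xy by (auto simp: J_def less_Suc_eq)
    qed simp
  qed (simp add: J_def)
  then show ?thesis
    by (rule runs_mono) (auto simp: J_def loaded_def)
qed

text \<open>The iterates before the first return to \<open>c\<close> are distinct and fill the
  orbit, so the first return time is the number of cities.\<close>

lemma hamiltonian_sequence:
  assumes t: "hamiltonian_tour n z" and c: "c \<in> {1..n}"
  shows "(\<lambda>i. (z ^^ i) c) ` {..<n} = {1..n}" "(z ^^ n) c = c"
proof -
  have cyc: "cyclic_on z {1..n}" using t by (simp add: hamiltonian_tour_def)
  have orb: "orbit z c = {1..n}" using cyc c by (metis cyclic_on_alldef)
  then have c': "c \<in> orbit z c" using c by simp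
  let ?d = "funpow_dist1 z c c"
  have im: "{1..n} = (\<lambda>i. (z ^^ i) c) ` {0..<?d}"
    using orbit_conv_funpow_dist1[OF c'] orb by simp
  have "card {1..n} = card {0..<?d}"
    unfolding im by (rule card_image[OF inj_on_funpow_dist1[OF c']])
  then have d: "?d = n" by simp
  show "(\<lambda>i. (z ^^ i) c) ` {..<n} = {1..n}" using im unfolding d by (simp add: lessThan_atLeast0)
  show "(z ^^ n) c = c" using funpow_dist1_prop[OF c'] unfolding d .
qed

text \<open>Positions in the sequence start at 0 while the counter starts at 1, hence the
  predecessor index \<open>i - 1\<close>. In the last round the sequence wraps around to its first
  entry.\<close>

definition load_next :: "string \<Rightarrow> string \<Rightarrow> com" where
  "load_next A S = Cond (Lt vi (Var ''n''))
     (Store A (Elem S (Sub vi (Lit 1))) (Elem S vi)) (Store A (Elem S (Sub vi (Lit 1))) (Elem S (Lit 0)))"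

definition load_sequences :: com where
  "load_sequences = for_each (Seq (load_next ''a'' ''x'') (load_next ''b'' ''y''))"

lemma runs_load_sequences:
  assumes x: "hamiltonian_tour n x" and y: "hamiltonian_tour n y" and W: "n + 1 \<le> W"
    and c: "c \<in> {1..n}" and d: "d \<in> {1..n}"
  shows "runs W load_sequences (input n (sequence_array n x c) (sequence_array n y d)) ((n + 1) * 70) (loaded n x y)"
proof -
  let ?s0 = "input n (sequence_array n x c) (sequence_array n y d)"
  let ?c = "Seq (load_next ''a'' ''x'') (load_next ''b'' ''y'')"
  \<comment> \<open>Successors are entered in the order of the cycle, not of the city numbers, so
    the arrays are described along the iterates and become complete only at the end.\<close>
  define J where "J i s \<longleftrightarrow> reg s ''i'' = i \<and> reg s ''n'' = n \<and>
    arr s ''x'' = sequence_array n x c \<and> arr s ''y'' = sequence_array n y d \<and>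
    (\<forall>j<i - 1. arr s ''a'' ((x ^^ j) c) = x ((x ^^ j) c) \<and> arr s ''b'' ((y ^^ j) d) = y ((y ^^ j) d)) \<and>
    (\<forall>A\<in>{''P1'', ''N1'', ''P2'', ''N2'', ''mk''}. arr s A = (\<lambda>_. 0))" for i and s :: store
  have seqx: "sequence_array n z c (i - 1) = (z ^^ (i - 1)) c"
    "(if i < n then sequence_array n z c i else sequence_array n z c 0) = z ((z ^^ (i - 1)) c)"
    "(z ^^ (i - 1)) c \<le> n" "z ((z ^^ (i - 1)) c) \<le> n"
    if z: "hamiltonian_tour n z" and c: "c \<in> {1..n}" and i: "i \<in> {1..n}" for z c i
  proof -
    have perm: "z permutes {1..n}" using z by (simp add: hamiltonian_tour_def)
    have mem: "(z ^^ j) c \<in> {1..n}" for j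
      by (induction j) (use c permutes_in_image[OF perm] in auto)
    obtain j where j: "i = Suc j" using i by (cases i) auto
    show "sequence_array n z c (i - 1) = (z ^^ (i - 1)) c"
      using i by (auto simp: sequence_array_def)
    show "(if i < n then sequence_array n z c i else sequence_array n z c 0) = z ((z ^^ (i - 1)) c)"
    proof (cases "i < n")
      case False
      then have "Suc j = n" using i j by simp
      then show ?thesis using hamiltonian_sequence(2)[OF z c] j by (auto simp: sequence_array_def)
    qed (simp add: sequence_array_def j)
    show "(z ^^ (i - 1)) c \<le> n" using mem[of "i - 1"] by simp
    show "z ((z ^^ (i - 1)) c) \<le> n" using mem[of "Suc (i - 1)"] by simp
  qed
  have "runs W load_sequences ?s0 ((n + 1) * (max_time ?c + 10)) (J (Suc n))"
    unfolding load_sequences_def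
  proof (rule runs_for_each[where J = J, OF W])
    show "J 1 (?s0\<lparr>reg := (reg ?s0)(''i'' := 1)\<rparr>)" by (simp add: J_def input_def)
    fix i s assume J: "J i s" and i: "i \<in> {1..n}"
    let ?u = "(x ^^ (i - 1)) c" and ?v = "(y ^^ (i - 1)) d"
    note sx = seqx[OF x c i] and sy = seqx[OF y d i]
    let ?s' = "s\<lparr>arr := (arr s)(''a'' := (arr s ''a'')(?u := x ?u), ''b'' := (arr s ''b'')(?v := y ?v))\<rparr>"
    have J': "arr s ''x'' = sequence_array n x c" "arr s ''y'' = sequence_array n y d"
      "reg s ''i'' = i" "reg s ''n'' = n" using J by (simp_all add: J_def)
    have r: "result ?c s = ?s'"
      using J' sx(1,2) sy(1,2) by (cases "i < n") (simp_all add: load_next_def)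
    show "runs W ?c s (max_time ?c) (\<lambda>s'. reg s' ''i'' = i \<and> J (Suc i) (s'\<lparr>reg := (reg s')(''i'' := Suc i)\<rparr>))"
    proof (rule runs_loop_free)
      show "loop_free ?c" by (simp add: load_next_def)
      show "safe W ?c s"
        using J' sx sy W by (cases "i < n") (simp_all add: load_next_def)
      have "j < i - 1 \<or> j = i - 1" if "j < i" for j using that by auto
      then show "reg (result ?c s) ''i'' = i \<and> J (Suc i) (result ?c s\<lparr>reg := (reg (result ?c s))(''i'' := Suc i)\<rparr>)"
        unfolding r using J by (auto simp: J_def)
    qed
  qed (simp add: J_def)
  then show ?thesis
  proof (rule runs_mono)
    fix s assume J: "J (Suc n) s"
    have "arr s ''a'' j = x j" if "j \<in> {1..n}" for j
      using J that unfolding hamiltonian_sequence(1)[OF x c, symmetric] by (auto simp: J_def)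
    moreover have "arr s ''b'' j = y j" if "j \<in> {1..n}" for j
      using J that unfolding hamiltonian_sequence(1)[OF y d, symmetric] by (auto simp: J_def)
    ultimately show "loaded n x y s" using J by (simp add: J_def loaded_def)
  qed (simp add: load_next_def)
qed

text \<open>The same number bounds time and word contents. The factor 30000 covers loading plus the
  \<open>20000 * n\<close> of \<open>decide\<close>, and amply exceeds the word bound
  \<open>100 * n\<close>.\<close>

lemma answers_within_decide:
  assumes n: "n \<ge> 3" and x: "psb_tour n x" and y: "psb_tour n y"
    and load: "runs (30000 * n) load s ((n + 1) * 70) (loaded n x y)"
  shows "answers_within (30000 * n) (Seq load decide) s
    (skeleton_adjacent (PSB n) (char_vec n x) (char_vec n y))"
proof -
  have vx: "valid n x" and vy: "valid n y" using psb_tour_iff_valid[OF n] x y by auto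
  have "runs (30000 * n) (Seq load decide) s ((n + 1) * 70 + 20000 * n)
    (\<lambda>s'. reg s' ''answer'' = (if adj_crit n x y then 1 else 0))"
    by (rule runs_Seq[OF load runs_decide[OF n vx vy]]) simp
  moreover have "(n + 1) * 70 + 20000 * n \<le> 30000 * n" using n by simp
  ultimately show ?thesis
    unfolding runs_def answers_within_def skeleton_adjacent_iff[OF n vx vy] by (meson order_trans)
qed

theorem theorem2:
  shows
    "(\<exists>P C. \<forall>n\<ge>3. \<forall>x y. psb_tour n x \<longrightarrow> psb_tour n y \<longrightarrow>
        answers_within (C * n) P (input n (successor_array n x) (successor_array n y))
          (skeleton_adjacent (PSB n) (char_vec n x) (char_vec n y)))
     \<and>
     (\<exists>P C. \<forall>n\<ge>3. \<forall>x y. psb_tour n x \<longrightarrow> psb_tour n y \<longrightarrow>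
        (\<forall>c\<in>{1..n}. \<forall>d\<in>{1..n}.
          answers_within (C * n) P (input n (sequence_array n x c) (sequence_array n y d))
            (skeleton_adjacent (PSB n) (char_vec n x) (char_vec n y))))"
proof (intro conjI)
  have "answers_within (30000 * n) (Seq load_successors decide)
      (input n (successor_array n x) (successor_array n y))
      (skeleton_adjacent (PSB n) (char_vec n x) (char_vec n y))"
    if n: "n \<ge> 3" and x: "psb_tour n x" and y: "psb_tour n y" for n x y
  proof (rule answers_within_decide[OF n x y])
    have "derangement n x" "derangement n y"
      using psb_tour_iff_valid[OF n] x y by (auto simp: valid_def)
    then show "runs (30000 * n) load_successors (input n (successor_array n x) (successor_array n y))
      ((n + 1) * 70) (loaded n x y)"
      by (rule runs_mono[OF runs_load_successors]) (use n in simp_all)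
  qed
  then show "\<exists>P C. \<forall>n\<ge>3. \<forall>x y. psb_tour n x \<longrightarrow> psb_tour n y \<longrightarrow>
        answers_within (C * n) P (input n (successor_array n x) (successor_array n y))
          (skeleton_adjacent (PSB n) (char_vec n x) (char_vec n y))"
    by blast
next
  have "answers_within (30000 * n) (Seq load_sequences decide)
      (input n (sequence_array n x c) (sequence_array n y d))
      (skeleton_adjacent (PSB n) (char_vec n x) (char_vec n y))"
    if n: "n \<ge> 3" and x: "psb_tour n x" and y: "psb_tour n y" and "c \<in> {1..n}" "d \<in> {1..n}" for n x y c d
    by (rule answers_within_decide[OF n x y], rule runs_load_sequences)
      (use that in \<open>auto simp: psb_tour_def\<close>)
  then show "\<exists>P C. \<forall>n\<ge>3. \<forall>x y. psb_tour n x \<longrightarrow> psb_tour n y \<longrightarrow>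
        (\<forall>c\<in>{1..n}. \<forall>d\<in>{1..n}.
          answers_within (C * n) P (input n (sequence_array n x c) (sequence_array n y d))
            (skeleton_adjacent (PSB n) (char_vec n x) (char_vec n y)))"
    by blast
qed

end
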